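(* Let $\mathbf U\supseteq\mathbf k[G]$ be a right coideal subalgebra of $U_q^+(\mathfrak{sl}_{n+1})$, or of $u_q^+(\mathfrak{sl}_{n+1})$ (when $q$ has finite multiplicative order $t>2$). If $\mathbf U$ contains a homogeneous element $c$ with the leading term $u[k,m]$, $1\le k\le m\le n$, then for a suitable subset $S$ of the interval $[k,m-1]$ the value of the element $\Psi^S(k,m)$ belongs to $\mathbf U$.
   Context: Let $\mathbf k$ be a field, $n\ge 1$, and $q\in\mathbf k$, $q\ne 0,\pm1$. Let $G$ be a commutative group, $g_1,\dots,g_n\in G$, and let $\chi^1,\dots,\chi^n:G\to\mathbf k^*$ be characters such that $p_{ij}:=\chi^i(g_j)$ satisfy $p_{ii}=q$, $p_{i\,i+1}p_{i+1\,i}=q^{-1}$, and $p_{ij}p_{ji}=1$ for $|i-j|>1$. Let $X=\{x_1,\dots,x_n\}$ and let $G\langle X\rangle$ be the skew group algebra generated by $\mathbf k[G]$ and the free algebra $\mathbf k\langle X\rangle$ with $g^{-1}x_ig=\chi^i(g)x_i$; it is a Hopf algebra with $\Delta(x_i)=x_i\otimes1+g_i\otimes x_i$, $\Delta(g)=g\otimes g$. For a word $u$ in $X$ let $g_u$ and $\chi^u$ be obtained from $u$ by replacing each $x_i$ by $g_i$, resp. $\chi^i$; put $[u,v]=uv-\chi^u(g_v)vu$, extended bilinearly to polynomials homogeneous in each variable. $U_q^+(\mathfrak{sl}_{n+1})$ is the quotient Hopf algebra of $G\langle X\rangle$ by the relations $[[x_i,x_{i+1}],x_{i+1}]=[x_i,[x_i,x_{i+1}]]=0$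 and $[x_i,x_j]=0$ for $|i-j|>1$. If $q$ has finite multiplicative order $t>2$, then $u_q^+(\mathfrak{sl}_{n+1})=G\langle X\rangle/\mathbf\Lambda$, where $\mathbf\Lambda$ is the biggest Hopf ideal contained in the ideal generated by all $x_ix_j$. Both algebras are graded by the free commutative monoid on $x_1,\dots,x_n$ with $\deg x_i=x_i$, $\deg g=0$; "homogeneous" means homogeneous for this grading. A right coideal subalgebra of a Hopf algebra $A$ is a (unital) subalgebra $\mathbf U$ with $\Delta(\mathbf U)\subseteq\mathbf U\otimes A$. Put $u[k,k]=x_k$ and $u[k,m]=[x_k,u[k+1,m]]$ for $k<m$. Order these elements by $u[k,m]>u[k',m']$ iff $k<k'$, or $k=k'$ and $m<m'$. The products $g\,w_1^{e_1}\cdots w_l^{e_l}$ ($g\in G$, $w_1<\dots<w_l$ among the $u[k,m]$, $e_i\ge1$, and $e_i<t$ in the case of $u_q^+$) form a basis (PBW-basis). A homogeneous element $c$ has leading term $u[k,m]$ if $c=u[k,m]+\sum_i\alpha_iW_i$ with $\alpha_i\in\mathbf k$, where the $W_i$ are PBW-basis elements with trivial group factor, of degree $x_k+x_{k+1}+\dots+x_m$, whose first factor is less than $u[k,m]$. For a set $S$ of integers with $S\cap[k,m-1]=\{s_1<\dots<s_r\}$ put $$\Psi^S(k,m)=[[\ldots[u[1+s_r,m],u[1+s_{r-1},s_r]],\ldots,u[1+s_1,s_2]],u[k,s_1]]$$ ($=u[k,m]$ if $r=0$). *)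

theory Defs
  imports
    "HOL-Algebra.QuotRing"
    "HOL-Algebra.Subrings"
    "HOL-Library.Poly_Mapping"
    "HOL-Library.Multiset"
    "HOL-Library.Extended_Nat"
begin

section \<open>Linear algebra with finitely supported functions\<close>

abbreviation pm_scale :: "'k::field \<Rightarrow> ('b \<Rightarrow>\<^sub>0 'k) \<Rightarrow> ('b \<Rightarrow>\<^sub>0 'k)" where
  "pm_scale c \<equiv> Poly_Mapping.map ((*) c)"

text \<open>Linear extension of a map given on the basis.\<close>

definition lin :: "('b \<Rightarrow> ('c \<Rightarrow>\<^sub>0 'k)) \<Rightarrow> ('b \<Rightarrow>\<^sub>0 'k) \<Rightarrow> ('c \<Rightarrow>\<^sub>0 'k::field)" where
  "lin f a = (\<Sum>b\<in>Poly_Mapping.keys a. pm_scale (Poly_Mapping.lookup a b) (f b))"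


section \<open>Hopf algebras, tensor squares and quotients\<close>

text \<open>
  The tensor square of a vector space \<open>M\<close> is the free vector space on \<open>M \<times> M\<close> modulo the
  subspace of bilinearity relations; its elements are cosets.
\<close>

definition tensor_rel :: "('k::field, 'v, 'm) module_scheme \<Rightarrow> (('v \<times> 'v) \<Rightarrow>\<^sub>0 'k) set" where
  "tensor_rel M = Modules.module.span pm_scale
    ( {Poly_Mapping.single (x \<oplus>\<^bsub>M\<^esub> y, z) 1 - Poly_Mapping.single (x, z) 1 - Poly_Mapping.single (y, z) 1
        | x y z. x \<in> carrier M \<and> y \<in> carrier M \<and> z \<in> carrier M}
    \<union> {Poly_Mapping.single (x, y \<oplus>\<^bsub>M\<^esub> z) 1 - Poly_Mapping.single (x, y) 1 - Poly_Mapping.single (x, z) 1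
        | x y z. x \<in> carrier M \<and> y \<in> carrier M \<and> z \<in> carrier M}
    \<union> {Poly_Mapping.single (a \<odot>\<^bsub>M\<^esub> x, y) 1 - Poly_Mapping.single (x, y) a
        | a x y. x \<in> carrier M \<and> y \<in> carrier M}
    \<union> {Poly_Mapping.single (x, a \<odot>\<^bsub>M\<^esub> y) 1 - Poly_Mapping.single (x, y) a
        | a x y. x \<in> carrier M \<and> y \<in> carrier M})"

definition tensor_class ::
    "('k::field, 'v, 'm) module_scheme \<Rightarrow> (('v \<times> 'v) \<Rightarrow>\<^sub>0 'k) \<Rightarrow> (('v \<times> 'v) \<Rightarrow>\<^sub>0 'k) set" where
  "tensor_class M s = {t. t - s \<in> tensor_rel M}"

text \<open>
  The subspace of \<open>M \<otimes> M\<close> spanned by the \<open>x \<otimes> y\<close> with \<open>(x, y) \<in> P\<close>. For subspaces \<open>V\<close>, \<open>W\<close> of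
  \<open>M\<close>, \<open>tensor_span M (V \<times> W)\<close> is \<open>V \<otimes> W\<close>, and \<open>tensor_span M (V \<times> M \<union> M \<times> V)\<close> is
  \<open>V \<otimes> M + M \<otimes> V\<close>.
\<close>

definition tensor_span ::
    "('k::field, 'v, 'm) module_scheme \<Rightarrow> ('v \<times> 'v) set \<Rightarrow> (('v \<times> 'v) \<Rightarrow>\<^sub>0 'k) set set" where
  "tensor_span M P = {tensor_class M s | s. Poly_Mapping.keys s \<subseteq> P}"

record (overloaded) ('k::zero, 'v) hopf_algebra = "('k, 'v) module" +
  comult :: "'v \<Rightarrow> (('v \<times> 'v) \<Rightarrow>\<^sub>0 'k) set"
  counit :: "'v \<Rightarrow> 'k"
  antipode :: "'v \<Rightarrow> 'v"

definition hopf_ideal :: "'v set \<Rightarrow> ('k::field, 'v) hopf_algebra \<Rightarrow> bool" where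
  "hopf_ideal I H \<longleftrightarrow> ideal I H
    \<and> (\<forall>a\<in>I. comult H a \<in> tensor_span H (I \<times> carrier H \<union> carrier H \<times> I))
    \<and> (\<forall>a\<in>I. counit H a = 0)
    \<and> (\<forall>a\<in>I. antipode H a \<in> I)"

text \<open>
  The quotient by a Hopf ideal. Operations on cosets are given by unions over representatives;
  all members of such a union coincide because \<open>I\<close> is a Hopf ideal. The comultiplication of the
  coset of \<open>a\<close> is the image of \<open>\<Delta>(a)\<close> under \<open>\<pi> \<otimes> \<pi>\<close>, with \<open>\<pi>\<close> the projection.
\<close>

definition quot_algebra :: "('k::field, 'v) hopf_algebra \<Rightarrow> 'v set \<Rightarrow> ('k, 'v set) module" where
  "quot_algebra H I = ring.extend (H Quot I)
     (module.fields (\<lambda>c X. \<Union>x\<in>X. I +>\<^bsub>H\<^esub> (c \<odot>\<^bsub>H\<^esub> x)))"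

definition quot_hopf :: "('k::field, 'v) hopf_algebra \<Rightarrow> 'v set \<Rightarrow> ('k, 'v set) hopf_algebra" where
  "quot_hopf H I = module.extend (quot_algebra H I)
     (hopf_algebra.fields
       (\<lambda>X. \<Union>x\<in>X. \<Union>s\<in>comult H x. tensor_class (quot_algebra H I)
              (lin (\<lambda>(a, b). Poly_Mapping.single (I +>\<^bsub>H\<^esub> a, I +>\<^bsub>H\<^esub> b) 1) s))
       (\<lambda>X. the_elem (counit H ` X))
       (\<lambda>X. \<Union>x\<in>X. I +>\<^bsub>H\<^esub> antipode H x))"

definition right_coideal_subalgebra :: "'v set \<Rightarrow> ('k::field, 'v) hopf_algebra \<Rightarrow> bool" where
  "right_coideal_subalgebra U A \<longleftrightarrow> subring U A
    \<and> (\<forall>c. \<forall>a\<in>U. c \<odot>\<^bsub>A\<^esub> a \<in> U)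
    \<and> (\<forall>a\<in>U. comult A a \<in> tensor_span A (U \<times> carrier A))"


section \<open>The skew group algebra\<close>

text \<open>
  The commutative group is written additively. The key \<open>(g, [i\<^sub>1, \<dots>, i\<^sub>r])\<close> stands for the
  element \<open>g x\<^bsub>i\<^sub>1\<^esub> \<cdots> x\<^bsub>i\<^sub>r\<^esub>\<close>; these are a basis of the skew group algebra.
\<close>

type_synonym ('g, 'k) skew = "('g \<times> nat list) \<Rightarrow>\<^sub>0 'k"

definition chi_word :: "(nat \<Rightarrow> 'g \<Rightarrow> 'k::field) \<Rightarrow> nat list \<Rightarrow> 'g \<Rightarrow> 'k" where
  "chi_word \<chi> u g = (\<Prod>i\<leftarrow>u. \<chi> i g)"

definition g_word :: "(nat \<Rightarrow> 'g::ab_group_add) \<Rightarrow> nat list \<Rightarrow> 'g" where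
  "g_word gs u = (\<Sum>i\<leftarrow>u. gs i)"

definition skew_grp :: "'g \<Rightarrow> ('g, 'k::field) skew" where
  "skew_grp g = Poly_Mapping.single (g, []) 1"

definition skew_var :: "nat \<Rightarrow> ('g::ab_group_add, 'k::field) skew" where
  "skew_var i = Poly_Mapping.single (0, [i]) 1"

text \<open>The relation \<open>g\<inverse> x\<^sub>i g = \<chi>\<^sup>i(g) x\<^sub>i\<close> gives \<open>(g u)(h v) = \<chi>\<^sup>u(h) (g h) (u v)\<close> for words \<open>u\<close>, \<open>v\<close>.\<close>

definition skew_mult ::
    "(nat \<Rightarrow> 'g::ab_group_add \<Rightarrow> 'k::field) \<Rightarrow> ('g, 'k) skew \<Rightarrow> ('g, 'k) skew \<Rightarrow> ('g, 'k) skew" where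
  "skew_mult \<chi> a b =
     lin (\<lambda>(g, u). lin (\<lambda>(h, v). Poly_Mapping.single (g + h, u @ v) (chi_word \<chi> u h)) b) a"

definition skew_algebra ::
    "nat \<Rightarrow> (nat \<Rightarrow> 'g::ab_group_add \<Rightarrow> 'k::field) \<Rightarrow> ('k, ('g, 'k) skew) module" where
  "skew_algebra n \<chi> =
     \<lparr>carrier = {a. \<forall>(g, w)\<in>Poly_Mapping.keys a. set w \<subseteq> {1..n}},
      monoid.mult = skew_mult \<chi>, one = skew_grp 0, zero = 0, add = (+), smult = pm_scale\<rparr>"

text \<open>
  The comultiplication is computed with representatives in the free vector space on pairs:
  \<open>\<Delta>(g x\<^bsub>i\<^sub>1\<^esub> \<cdots> x\<^bsub>i\<^sub>r\<^esub>)\<close> is \<open>(g \<otimes> g) \<Prod>\<^sub>j (x\<^bsub>i\<^sub>j\<^esub> \<otimes> 1 + g\<^bsub>i\<^sub>j\<^esub> \<otimes> x\<^bsub>i\<^sub>j\<^esub>)\<close>, with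
  \<open>(a \<otimes> b)(c \<otimes> d) = a c \<otimes> b d\<close>.
\<close>

definition pair_mult ::
    "(nat \<Rightarrow> 'g::ab_group_add \<Rightarrow> 'k::field) \<Rightarrow> ((('g, 'k) skew \<times> ('g, 'k) skew) \<Rightarrow>\<^sub>0 'k) \<Rightarrow>
     ((('g, 'k) skew \<times> ('g, 'k) skew) \<Rightarrow>\<^sub>0 'k) \<Rightarrow> ((('g, 'k) skew \<times> ('g, 'k) skew) \<Rightarrow>\<^sub>0 'k)" where
  "pair_mult \<chi> s t =
     lin (\<lambda>(a, b). lin (\<lambda>(c, d). Poly_Mapping.single (skew_mult \<chi> a c, skew_mult \<chi> b d) 1) t) s"

fun comult_word ::
    "(nat \<Rightarrow> 'g::ab_group_add \<Rightarrow> 'k::field) \<Rightarrow> (nat \<Rightarrow> 'g) \<Rightarrow> nat list \<Rightarrow>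
     ((('g, 'k) skew \<times> ('g, 'k) skew) \<Rightarrow>\<^sub>0 'k)" where
  "comult_word \<chi> gs [] = Poly_Mapping.single (skew_grp 0, skew_grp 0) 1"
| "comult_word \<chi> gs (i # w) =
     pair_mult \<chi>
       (Poly_Mapping.single (skew_var i, skew_grp 0) 1
        + Poly_Mapping.single (skew_grp (gs i), skew_var i) 1)
       (comult_word \<chi> gs w)"

text \<open>
  Counit and antipode are determined by the comultiplication: \<open>\<epsilon>(g) = 1\<close>, \<open>\<epsilon>(x\<^sub>i) = 0\<close>,
  \<open>S(g) = g\<inverse>\<close>, \<open>S(x\<^sub>i) = - g\<^sub>i\<inverse> x\<^sub>i\<close>, and \<open>S\<close> reverses products.
\<close>

fun antipode_word ::
    "(nat \<Rightarrow> 'g::ab_group_add \<Rightarrow> 'k::field) \<Rightarrow> (nat \<Rightarrow> 'g) \<Rightarrow> nat list \<Rightarrow> ('g, 'k) skew" where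
  "antipode_word \<chi> gs [] = skew_grp 0"
| "antipode_word \<chi> gs (i # w) =
     skew_mult \<chi> (antipode_word \<chi> gs w) (- skew_mult \<chi> (skew_grp (- gs i)) (skew_var i))"

definition skew_hopf ::
    "nat \<Rightarrow> (nat \<Rightarrow> 'g::ab_group_add \<Rightarrow> 'k::field) \<Rightarrow> (nat \<Rightarrow> 'g) \<Rightarrow>
     ('k, ('g, 'k) skew) hopf_algebra" where
  "skew_hopf n \<chi> gs = module.extend (skew_algebra n \<chi>)
     (hopf_algebra.fields
       (\<lambda>a. tensor_class (skew_algebra n \<chi>)
          (lin (\<lambda>(g, w). pair_mult \<chi>
             (Poly_Mapping.single (skew_grp g, skew_grp g) 1) (comult_word \<chi> gs w)) a))
       (\<lambda>a. \<Sum>(g, w)\<in>Poly_Mapping.keys a. if w = [] then Poly_Mapping.lookup a (g, w) else 0)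
       (lin (\<lambda>(g, w). skew_mult \<chi> (antipode_word \<chi> gs w) (skew_grp (- g)))))"

text \<open>
  The bracket \<open>[u, v] = u v - \<chi>\<^sup>u(g\<^sub>v) v u\<close> for words, extended bilinearly. It is used only on
  elements of the free algebra, that is, with trivial group parts.
\<close>

definition bracket ::
    "(nat \<Rightarrow> 'g::ab_group_add \<Rightarrow> 'k::field) \<Rightarrow> (nat \<Rightarrow> 'g) \<Rightarrow> ('g, 'k) skew \<Rightarrow> ('g, 'k) skew \<Rightarrow>
     ('g, 'k) skew" where
  "bracket \<chi> gs a b =
     lin (\<lambda>(g, u). lin (\<lambda>(h, v).
        skew_mult \<chi> (Poly_Mapping.single (g, u) 1) (Poly_Mapping.single (h, v) 1)
        - pm_scale (chi_word \<chi> u (g_word gs v))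
            (skew_mult \<chi> (Poly_Mapping.single (h, v) 1) (Poly_Mapping.single (g, u) 1))) b) a"


section \<open>The quantum groups\<close>

definition serre_ideal ::
    "nat \<Rightarrow> (nat \<Rightarrow> 'g::ab_group_add \<Rightarrow> 'k::field) \<Rightarrow> (nat \<Rightarrow> 'g) \<Rightarrow> ('g, 'k) skew set" where
  "serre_ideal n \<chi> gs = Idl\<^bsub>skew_hopf n \<chi> gs\<^esub>
    ( {bracket \<chi> gs (bracket \<chi> gs (skew_var i) (skew_var (i + 1))) (skew_var (i + 1))
        | i. 1 \<le> i \<and> i < n}
    \<union> {bracket \<chi> gs (skew_var i) (bracket \<chi> gs (skew_var i) (skew_var (i + 1)))
        | i. 1 \<le> i \<and> i < n}
    \<union> {bracket \<chi> gs (skew_var i) (skew_var j)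
        | i j. i \<in> {1..n} \<and> j \<in> {1..n} \<and> (i + 1 < j \<or> j + 1 < i)})"

definition Lambda_ideal ::
    "nat \<Rightarrow> (nat \<Rightarrow> 'g::ab_group_add \<Rightarrow> 'k::field) \<Rightarrow> (nat \<Rightarrow> 'g) \<Rightarrow> ('g, 'k) skew set" where
  "Lambda_ideal n \<chi> gs = (GREATEST I. hopf_ideal I (skew_hopf n \<chi> gs) \<and>
     I \<subseteq> Idl\<^bsub>skew_hopf n \<chi> gs\<^esub> {skew_mult \<chi> (skew_var i) (skew_var j) | i j. i \<in> {1..n} \<and> j \<in> {1..n}})"

definition Uq_plus ::
    "nat \<Rightarrow> (nat \<Rightarrow> 'g::ab_group_add \<Rightarrow> 'k::field) \<Rightarrow> (nat \<Rightarrow> 'g) \<Rightarrow>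
     ('k, ('g, 'k) skew set) hopf_algebra" where
  "Uq_plus n \<chi> gs = quot_hopf (skew_hopf n \<chi> gs) (serre_ideal n \<chi> gs)"

definition small_uq_plus ::
    "nat \<Rightarrow> (nat \<Rightarrow> 'g::ab_group_add \<Rightarrow> 'k::field) \<Rightarrow> (nat \<Rightarrow> 'g) \<Rightarrow>
     ('k, ('g, 'k) skew set) hopf_algebra" where
  "small_uq_plus n \<chi> gs = quot_hopf (skew_hopf n \<chi> gs) (Lambda_ideal n \<chi> gs)"

text \<open>
  Both algebras have the form \<open>quot_hopf (skew_hopf n \<chi> gs) I\<close>. In such an algebra \<open>A\<close> the zero
  element is \<open>I\<close>, so the projection of the skew group algebra onto \<open>A\<close> is
\<close>

definition proj ::
    "nat \<Rightarrow> (nat \<Rightarrow> 'g::ab_group_add \<Rightarrow> 'k::field) \<Rightarrow> (nat \<Rightarrow> 'g) \<Rightarrow>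
     ('k, ('g, 'k) skew set) hopf_algebra \<Rightarrow> ('g, 'k) skew \<Rightarrow> ('g, 'k) skew set" where
  "proj n \<chi> gs A a = \<zero>\<^bsub>A\<^esub> +>\<^bsub>skew_hopf n \<chi> gs\<^esub> a"

definition group_algebra ::
    "nat \<Rightarrow> (nat \<Rightarrow> 'g::ab_group_add \<Rightarrow> 'k::field) \<Rightarrow> (nat \<Rightarrow> 'g) \<Rightarrow>
     ('k, ('g, 'k) skew set) hopf_algebra \<Rightarrow> ('g, 'k) skew set set" where
  "group_algebra n \<chi> gs A = proj n \<chi> gs A ` {a. \<forall>(g, w)\<in>Poly_Mapping.keys a. w = []}"

text \<open>Elements of the free commutative monoid on the variables are multisets of indices.\<close>

definition graded_component ::
    "nat \<Rightarrow> (nat \<Rightarrow> 'g::ab_group_add \<Rightarrow> 'k::field) \<Rightarrow> (nat \<Rightarrow> 'g) \<Rightarrow>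
     ('k, ('g, 'k) skew set) hopf_algebra \<Rightarrow> nat multiset \<Rightarrow> ('g, 'k) skew set set" where
  "graded_component n \<chi> gs A d =
     proj n \<chi> gs A ` {a \<in> carrier (skew_hopf n \<chi> gs). \<forall>(g, w)\<in>Poly_Mapping.keys a. mset w = d}"

definition homogeneous ::
    "nat \<Rightarrow> (nat \<Rightarrow> 'g::ab_group_add \<Rightarrow> 'k::field) \<Rightarrow> (nat \<Rightarrow> 'g) \<Rightarrow>
     ('k, ('g, 'k) skew set) hopf_algebra \<Rightarrow> ('g, 'k) skew set \<Rightarrow> bool" where
  "homogeneous n \<chi> gs A c \<longleftrightarrow> (\<exists>d. c \<in> graded_component n \<chi> gs A d)"


section \<open>PBW monomials, leading terms and the elements \<open>\<Psi>\<^sup>S(k, m)\<close>\<close>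

function ubr ::
    "(nat \<Rightarrow> 'g::ab_group_add \<Rightarrow> 'k::field) \<Rightarrow> (nat \<Rightarrow> 'g) \<Rightarrow> nat \<Rightarrow> nat \<Rightarrow> ('g, 'k) skew" where
  "ubr \<chi> gs k m = (if k < m then bracket \<chi> gs (skew_var k) (ubr \<chi> gs (k + 1) m) else skew_var k)"
  by pat_completeness auto
termination by (relation "measure (\<lambda>(_, _, k, m). m - k)") auto

declare ubr.simps [simp del]

text \<open>\<open>root_less (k, m) (k', m')\<close> means \<open>u[k, m] < u[k', m']\<close>; note the reversal.\<close>

definition root_less :: "nat \<times> nat \<Rightarrow> nat \<times> nat \<Rightarrow> bool" where
  "root_less p r \<longleftrightarrow> fst r < fst p \<or> (fst r = fst p \<and> snd r < snd p)"

text \<open>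
  A list \<open>[((k\<^sub>1, m\<^sub>1), e\<^sub>1), \<dots>, ((k\<^sub>l, m\<^sub>l), e\<^sub>l)]\<close> encodes the PBW-basis element
  \<open>u[k\<^sub>1, m\<^sub>1]\<^bsup>e\<^sub>1\<^esup> \<cdots> u[k\<^sub>l, m\<^sub>l]\<^bsup>e\<^sub>l\<^esup>\<close> with trivial group factor. All exponents are less than
  \<open>h\<close>, where \<open>h = \<infinity>\<close> means that there is no bound.
\<close>

type_synonym pbw_exponents = "((nat \<times> nat) \<times> nat) list"

definition pbw_exponents :: "nat \<Rightarrow> enat \<Rightarrow> pbw_exponents set" where
  "pbw_exponents n h = {ws. sorted_wrt (\<lambda>x y. root_less (fst x) (fst y)) ws \<and>
     (\<forall>((k, m), e)\<in>set ws. 1 \<le> k \<and> k \<le> m \<and> m \<le> n \<and> 1 \<le> e \<and> enat e < h)}"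

definition pbw_degree :: "pbw_exponents \<Rightarrow> nat multiset" where
  "pbw_degree ws = (\<Sum>((k, m), e)\<leftarrow>ws. repeat_mset e (mset_set {k..m}))"

definition pbw_monomial ::
    "nat \<Rightarrow> (nat \<Rightarrow> 'g::ab_group_add \<Rightarrow> 'k::field) \<Rightarrow> (nat \<Rightarrow> 'g) \<Rightarrow>
     ('k, ('g, 'k) skew set) hopf_algebra \<Rightarrow> pbw_exponents \<Rightarrow> ('g, 'k) skew set" where
  "pbw_monomial n \<chi> gs A ws =
     foldr (\<lambda>((k, m), e) a. (proj n \<chi> gs A (ubr \<chi> gs k m) [^]\<^bsub>A\<^esub> e) \<otimes>\<^bsub>A\<^esub> a) ws \<one>\<^bsub>A\<^esub>"

definition has_leading_term ::
    "nat \<Rightarrow> (nat \<Rightarrow> 'g::ab_group_add \<Rightarrow> 'k::field) \<Rightarrow> (nat \<Rightarrow> 'g) \<Rightarrow>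
     ('k, ('g, 'k) skew set) hopf_algebra \<Rightarrow> enat \<Rightarrow> ('g, 'k) skew set \<Rightarrow> nat \<Rightarrow> nat \<Rightarrow> bool" where
  "has_leading_term n \<chi> gs A h c k m \<longleftrightarrow>
     (\<exists>J \<alpha>. finite J \<and>
        J \<subseteq> {ws \<in> pbw_exponents n h. pbw_degree ws = mset_set {k..m} \<and>
              ws \<noteq> [] \<and> root_less (fst (hd ws)) (k, m)} \<and>
        c = proj n \<chi> gs A (ubr \<chi> gs k m)
            \<oplus>\<^bsub>A\<^esub> (\<Oplus>\<^bsub>A\<^esub>ws\<in>J. \<alpha> ws \<odot>\<^bsub>A\<^esub> pbw_monomial n \<chi> gs A ws))"

text \<open>\<open>psi_list \<chi> gs k [s\<^sub>1, \<dots>, s\<^sub>r] m = [[\<dots>[u[1 + s\<^sub>r, m], u[1 + s\<^bsub>r-1\<^esub>, s\<^sub>r]], \<dots>], u[k, s\<^sub>1]]\<close>\<close>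

fun psi_list ::
    "(nat \<Rightarrow> 'g::ab_group_add \<Rightarrow> 'k::field) \<Rightarrow> (nat \<Rightarrow> 'g) \<Rightarrow> nat \<Rightarrow> nat list \<Rightarrow> nat \<Rightarrow>
     ('g, 'k) skew" where
  "psi_list \<chi> gs k [] m = ubr \<chi> gs k m"
| "psi_list \<chi> gs k (s # ss) m = bracket \<chi> gs (psi_list \<chi> gs (1 + s) ss m) (ubr \<chi> gs k s)"

definition Psi ::
    "(nat \<Rightarrow> 'g::ab_group_add \<Rightarrow> 'k::field) \<Rightarrow> (nat \<Rightarrow> 'g) \<Rightarrow> nat set \<Rightarrow> nat \<Rightarrow> nat \<Rightarrow>
     ('g, 'k) skew" where
  "Psi \<chi> gs S k m = psi_list \<chi> gs k (sorted_list_of_set (S \<inter> {k..<m})) m"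

end

theory Submission
  imports Defs
begin

text \<open>
  An element with leading term \<open>u[k, m]\<close> lifts to the free algebra as a multilinear element in which
  the word \<open>x\<^sub>k \<cdots> x\<^sub>m\<close> has coefficient 1. Modulo the commutation relations \<open>[x\<^sub>i, x\<^sub>j] = 0\<close>, \<open>\<bar>i - j\<bar> > 1\<close>,
  the multilinear elements of degree \<open>x\<^sub>k + \<dots> + x\<^sub>m\<close> are spanned by the \<open>\<Psi>\<^sup>S(k, m)\<close>, one for each
  \<open>S \<subseteq> [k, m - 1]\<close>, and the coefficient of \<open>x\<^sub>k \<cdots> x\<^sub>m\<close> is an invariant, so some \<open>\<Psi>\<^sup>S(k, m)\<close> occurs in
  the lift \<open>c\<close>.

  The preimage of \<open>\<^bold>U\<close> is a subalgebra that is stable under the skew derivations \<open>\<partial>\<^sub>i\<close>, obtained by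
  contracting the right factor of the coproduct with the dual of \<open>x\<^sub>i\<close>; this functional vanishes on
  every ideal contained in the ideal of all \<open>x\<^sub>i x\<^sub>j\<close>. At each edge \<open>(i, i + 1)\<close> of \<open>[k, m]\<close> the element
  \<open>\<Psi>\<^sup>S(k, m)\<close> is a bracket of its two parts, in one of the two orders. Removing the left part by
  derivations kills it in one order and removing the right part kills it in the other, because
  \<open>p\<^bsub>i i+1\<^esub> p\<^bsub>i+1 i\<^esub> = q\<inverse> \<noteq> 1\<close>. Hence if two different sets \<open>S\<close> occur in \<open>c\<close>, they differ at some \<open>i\<close>, and
  suitable derivations produce nonzero elements of \<open>\<^bold>U\<close> of both degrees \<open>x\<^bsub>i+1\<^esub> + \<dots> + x\<^sub>m\<close> and
  \<open>x\<^sub>k + \<dots> + x\<^sub>i\<close>. By induction \<open>\<^bold>U\<close> contains some \<open>\<Psi>\<^sup>R(i + 1, m)\<close> and \<open>\<Psi>\<^sup>T(k, i)\<close>, and therefore their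
  bracket. If only one \<open>S\<close> occurs, \<open>c\<close> itself is a multiple of \<open>\<Psi>\<^sup>S(k, m)\<close>.
\<close>

section \<open>Linear extension, and products twisted by a scalar cocycle\<close>

section \<open>Linear extension\<close>

text \<open>The computations take place in the free algebra, where derivations are explicit. Both
  quotients enter through one ideal \<open>I\<close> that contains the far commutators and lies in
  \<open>K2\<close>, the span of basis elements with at least two letters. For the small quantum
  group the first property is the delicate one: \<open>Lambda_ideal\<close> is known only as a
  greatest Hopf ideal, so its existence has to be shown and the commutators have to be seen to
  generate a Hopf ideal. This is what multiplicativity of the coproduct and anti-multiplicativity of
  the antipode serve.

  The number 2^(m-k) of elements has a simple origin: modulo far commutation and up to a scalar, a
  multilinear word only remembers, for each i, whether x_i stands before or after x_(i+1). The two
  orders of x_k against the rest are recovered from the two brackets by a linear system of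
  determinant 1 - 1/q.

  In the induction the surviving terms must not cancel. A word of derivations therefore selects the
  sets with a prescribed restriction on one side of i; the selected sets still differ pairwise on
  the other side and keep nonzero coefficients.\<close>

lemma lookup_pm_scale [simp]: "Poly_Mapping.lookup (pm_scale c a) x = c * Poly_Mapping.lookup a x"
  by (simp add: Poly_Mapping.map.rep_eq when_def)

lemma pm_map_id [simp]: "Poly_Mapping.map (\<lambda>a. a) x = x"
  by (rule poly_mapping_eqI) (simp add: Poly_Mapping.map.rep_eq when_def)

lemma pm_scale_module: "Modules.module (pm_scale :: 'k::field \<Rightarrow> ('b \<Rightarrow>\<^sub>0 'k) \<Rightarrow> _)"
  by unfold_locales (auto intro!: poly_mapping_eqI simp: lookup_add algebra_simps)

lemmas pm_scale_add = Modules.module.scale_right_distrib[OF pm_scale_module]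
  and pm_scale_diff = Modules.module.scale_right_diff_distrib[OF pm_scale_module]
  and pm_scale_add_left = Modules.module.scale_left_distrib[OF pm_scale_module]
  and pm_scale_scale = Modules.module.scale_scale[OF pm_scale_module]
  and pm_scale_sum = Modules.module.scale_sum_right[OF pm_scale_module]
  and pm_scale_zero [simp] = Modules.module.scale_zero_left[OF pm_scale_module]
     Modules.module.scale_zero_right[OF pm_scale_module]
  and pm_scale_diff_left = Modules.module.scale_left_diff_distrib[OF pm_scale_module]
  and pm_scale_uminus = Modules.module.scale_minus_right[OF pm_scale_module]
  and pm_scale_minus_left = Modules.module.scale_minus_left[OF pm_scale_module]
  and pm_scale_one [simp] = Modules.module.scale_one[OF pm_scale_module]

lemma pm_scale_single: "pm_scale c (Poly_Mapping.single x d) = Poly_Mapping.single x (c * d :: 'k::field)"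
  by simp

declare map_single [simp del]

lemma keys_pm_scale: "Poly_Mapping.keys (pm_scale c a) \<subseteq> Poly_Mapping.keys a"
  by (auto simp: in_keys_iff)

lemma pm_expand: "(a :: 'b \<Rightarrow>\<^sub>0 'k::field) =
    (\<Sum>b\<in>Poly_Mapping.keys a. pm_scale (Poly_Mapping.lookup a b) (Poly_Mapping.single b 1))"
proof (rule poly_mapping_eqI)
  fix x
  show "Poly_Mapping.lookup a x = Poly_Mapping.lookup (\<Sum>b\<in>Poly_Mapping.keys a.
      pm_scale (Poly_Mapping.lookup a b) (Poly_Mapping.single b 1)) x"
    by (auto simp: lookup_sum lookup_single when_def if_distrib in_keys_iff cong: if_cong)
qed

lemma lin_superset:
  assumes "finite B" "Poly_Mapping.keys a \<subseteq> B"
  shows "lin f a = (\<Sum>b\<in>B. pm_scale (Poly_Mapping.lookup a b) (f b))"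
  unfolding lin_def using assms
  by (intro sum.mono_neutral_left) (auto simp: in_keys_iff pm_scale_zero)

lemma lin_add: "lin f (a + b) = lin f a + lin f b"
proof -
  let ?B = "Poly_Mapping.keys a \<union> Poly_Mapping.keys b"
  have "Poly_Mapping.keys (a + b) \<subseteq> ?B" by (rule keys_add)
  then show ?thesis
    by (simp add: lin_superset[of ?B] lookup_add pm_scale_add_left sum.distrib)
qed

lemma lin_scale: "lin f (pm_scale c a) = pm_scale c (lin f a)"
proof -
  have "Poly_Mapping.keys (pm_scale c a) \<subseteq> Poly_Mapping.keys a" by (rule keys_pm_scale)
  then show ?thesis
    by (simp add: lin_superset[of "Poly_Mapping.keys a"] pm_scale_sum pm_scale_scale)
qed

lemma lin_zero [simp]: "lin f 0 = 0"
  by (simp add: lin_def)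

lemma lin_single: "lin f (Poly_Mapping.single b c) = pm_scale c (f b)"
  by (cases "c = 0") (auto simp: lin_def pm_scale_zero)

lemma lin_uminus: "lin f (- a) = - lin f a"
  by (metis add.right_inverse lin_add lin_zero add_eq_0_iff)

lemma lin_diff: "lin f (a - b) = lin f a - lin f b"
  by (metis diff_add_cancel lin_add add_diff_cancel)

lemma lin_sum: "lin f (\<Sum>i\<in>I. a i) = (\<Sum>i\<in>I. lin f (a i))"
  by (induction I rule: infinite_finite_induct) (auto simp: lin_add)

lemma lin_cong: "(\<And>b. b \<in> Poly_Mapping.keys a \<Longrightarrow> f b = g b) \<Longrightarrow> lin f a = lin g a"
  by (simp add: lin_def)

lemma lin_fun_add: "lin (\<lambda>x. f x + g x) a = lin f a + lin g a"
  by (simp add: lin_def pm_scale_add sum.distrib)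

lemma lin_fun_scale: "lin (\<lambda>x. pm_scale c (f x)) a = pm_scale c (lin f a)"
  by (simp add: lin_def pm_scale_sum pm_scale_scale mult.commute)

lemma lin_fun_zero [simp]: "lin (\<lambda>x. 0) a = 0"
  by (simp add: lin_def pm_scale_zero)

lemma lin_lin: "lin f (lin g a) = lin (\<lambda>x. lin f (g x)) a"
  by (simp add: lin_def[of g] lin_def[of "\<lambda>x. lin f (g x)"] lin_sum lin_scale)

lemma lin_swap: "lin (\<lambda>x. lin (\<lambda>y. f x y) b) a = lin (\<lambda>y. lin (\<lambda>x. f x y) a) b"
proof -
  have "lin (\<lambda>x. lin (\<lambda>y. f x y) b) a = (\<Sum>x\<in>Poly_Mapping.keys a. \<Sum>y\<in>Poly_Mapping.keys b.
      pm_scale (Poly_Mapping.lookup a x * Poly_Mapping.lookup b y) (f x y))"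
    by (simp add: lin_def pm_scale_sum pm_scale_scale)
  also have "\<dots> = (\<Sum>y\<in>Poly_Mapping.keys b. \<Sum>x\<in>Poly_Mapping.keys a.
      pm_scale (Poly_Mapping.lookup a x * Poly_Mapping.lookup b y) (f x y))"
    by (rule sum.swap)
  also have "\<dots> = lin (\<lambda>y. lin (\<lambda>x. f x y) a) b"
    by (simp add: lin_def pm_scale_sum pm_scale_scale mult.commute)
  finally show ?thesis .
qed

lemma lin_single_id: "lin (\<lambda>x. Poly_Mapping.single x 1) a = a"
  by (subst (2) pm_expand) (simp add: lin_def)

text \<open>Arguments by expansion into basis elements take this form: the subspace \<open>V\<close>
  is described by its closure properties alone, so that \<open>tensor_rel\<close>, ideals and
  preimages all qualify.\<close>

lemma lin_mem:
  assumes "0 \<in> V" "\<And>a b. a \<in> V \<Longrightarrow> b \<in> V \<Longrightarrow> a + b \<in> V" "\<And>c a. a \<in> V \<Longrightarrow> pm_scale c a \<in> V"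
    and "\<And>x. x \<in> Poly_Mapping.keys a \<Longrightarrow> f x \<in> V"
  shows "lin f a \<in> V"
proof -
  have "(\<Sum>x\<in>B. pm_scale (Poly_Mapping.lookup a x) (f x)) \<in> V" if "B \<subseteq> Poly_Mapping.keys a" "finite B" for B
    using that(2,1) by (induction B rule: finite_induct) (use assms in auto)
  then show ?thesis by (simp add: lin_def)
qed

lemma keys_lin: "Poly_Mapping.keys (lin f a) \<subseteq> (\<Union>x\<in>Poly_Mapping.keys a. Poly_Mapping.keys (f x))"
proof -
  have "lin f a \<in> {v. Poly_Mapping.keys v \<subseteq> (\<Union>x\<in>Poly_Mapping.keys a. Poly_Mapping.keys (f x))}"
    by (rule lin_mem) (use keys_add keys_pm_scale in \<open>fastforce+\<close>)
  then show ?thesis by simp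
qed

section \<open>Twisted semigroup algebras\<close>

text \<open>Both the skew group algebra and the free vector space on its pairs are instances.\<close>

definition twist ::
    "('b \<Rightarrow> 'b \<Rightarrow> 'b) \<Rightarrow> ('b \<Rightarrow> 'b \<Rightarrow> 'k::field) \<Rightarrow> ('b \<Rightarrow>\<^sub>0 'k) \<Rightarrow> ('b \<Rightarrow>\<^sub>0 'k) \<Rightarrow> ('b \<Rightarrow>\<^sub>0 'k)" where
  "twist f \<sigma> a b = lin (\<lambda>x. lin (\<lambda>y. Poly_Mapping.single (f x y) (\<sigma> x y)) b) a"

lemma twist_add_left: "twist f \<sigma> (a + a') b = twist f \<sigma> a b + twist f \<sigma> a' b"
  and twist_diff_left: "twist f \<sigma> (a - a') b = twist f \<sigma> a b - twist f \<sigma> a' b"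
  and twist_uminus_left: "twist f \<sigma> (- a) b = - twist f \<sigma> a b"
  and twist_scale_left: "twist f \<sigma> (pm_scale c a) b = pm_scale c (twist f \<sigma> a b)"
  and twist_zero_left: "twist f \<sigma> 0 b = 0"
  by (simp_all add: twist_def lin_add lin_diff lin_uminus lin_scale)

text \<open>Passing to the opposite product makes each rule for the right argument an instance of
  the rule for the left one.\<close>

lemma twist_swap: "twist f \<sigma> a b = twist (\<lambda>x y. f y x) (\<lambda>x y. \<sigma> y x) b a"
  unfolding twist_def by (rule lin_swap)

lemma twist_add_right: "twist f \<sigma> b (a + a') = twist f \<sigma> b a + twist f \<sigma> b a'"
  and twist_diff_right: "twist f \<sigma> b (a - a') = twist f \<sigma> b a - twist f \<sigma> b a'"
  and twist_uminus_right: "twist f \<sigma> b (- a) = - twist f \<sigma> b a"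
  and twist_scale_right: "twist f \<sigma> b (pm_scale c a) = pm_scale c (twist f \<sigma> b a)"
  and twist_zero_right: "twist f \<sigma> b 0 = 0"
  by (simp_all add: twist_swap[of f \<sigma> b] twist_add_left twist_diff_left twist_uminus_left
      twist_scale_left twist_zero_left)

lemma twist_lin_left: "twist f \<sigma> (lin h a) b = lin (\<lambda>x. twist f \<sigma> (h x) b) a"
  by (simp add: twist_def lin_lin)

lemma twist_lin_right: "twist f \<sigma> b (lin h a) = lin (\<lambda>x. twist f \<sigma> b (h x)) a"
  by (simp add: twist_swap[of f \<sigma> b] twist_lin_left)

lemma twist_single: "twist f \<sigma> (Poly_Mapping.single x c) (Poly_Mapping.single y d) =
    Poly_Mapping.single (f x y) (c * d * \<sigma> x y)"
  by (simp add: twist_def lin_single pm_scale_single mult.assoc)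

text \<open>The condition on \<open>\<sigma>\<close> is the 2-cocycle identity. It is asked for on a
  set \<open>C\<close> of keys because the characters are multiplicative only at the indices
  \<open>1..n\<close>.\<close>

lemma twist_assoc:
  assumes C: "Poly_Mapping.keys a \<subseteq> C" "Poly_Mapping.keys b \<subseteq> C" "Poly_Mapping.keys c \<subseteq> C"
    and f: "\<And>x y z. x \<in> C \<Longrightarrow> y \<in> C \<Longrightarrow> z \<in> C \<Longrightarrow> f (f x y) z = f x (f y z)"
    and \<sigma>: "\<And>x y z. x \<in> C \<Longrightarrow> y \<in> C \<Longrightarrow> z \<in> C \<Longrightarrow> \<sigma> x y * \<sigma> (f x y) z = \<sigma> y z * \<sigma> x (f y z)"
  shows "twist f \<sigma> (twist f \<sigma> a b) c = twist f \<sigma> a (twist f \<sigma> b c)"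
proof -
  have "twist f \<sigma> (twist f \<sigma> a b) c = lin (\<lambda>x. lin (\<lambda>y. lin (\<lambda>z.
      Poly_Mapping.single (f (f x y) z) (\<sigma> x y * \<sigma> (f x y) z)) c) b) a"
    unfolding twist_def[of f \<sigma> a b] twist_lin_left
    by (simp add: twist_def lin_single lin_fun_scale[symmetric] pm_scale_single)
  also have "\<dots> = lin (\<lambda>x. lin (\<lambda>y. lin (\<lambda>z.
      Poly_Mapping.single (f x (f y z)) (\<sigma> y z * \<sigma> x (f y z))) c) b) a"
    by (intro lin_cong) (simp add: f \<sigma> subsetD[OF C(1)] subsetD[OF C(2)] subsetD[OF C(3)])
  also have "\<dots> = twist f \<sigma> a (twist f \<sigma> b c)"
    by (simp add: twist_def lin_lin lin_single pm_scale_single)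
  finally show ?thesis .
qed

lemma keys_twist: "Poly_Mapping.keys (twist f \<sigma> a b) \<subseteq>
    {f x y | x y. x \<in> Poly_Mapping.keys a \<and> y \<in> Poly_Mapping.keys b}"
  unfolding twist_def
  by (rule order_trans[OF keys_lin], rule UN_least, rule order_trans[OF keys_lin]) (auto split: if_splits)

section \<open>Multilinear elements of the free algebra\<close>

section \<open>The free algebra and its skew derivations\<close>

text \<open>The wrapper makes words a monoid in the sense of the type class, so that the free algebra is a \<open>ring_1\<close>.\<close>

datatype fword = FW (letters: "nat list")

instantiation fword :: monoid_add
begin
definition "0 = FW []"
definition "u + v = FW (letters u @ letters v)"
instance by standard (auto simp: zero_fword_def plus_fword_def)
end

lemma letters_zero [simp]: "letters 0 = []"
  and letters_plus [simp]: "letters (u + v) = letters u @ letters v"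
  by (simp_all add: zero_fword_def plus_fword_def)

type_synonym 'k free = "fword \<Rightarrow>\<^sub>0 'k"

definition var :: "nat \<Rightarrow> 'k::field free" where
  "var i = Poly_Mapping.single (FW [i]) 1"

text \<open>Scalars act as multiples of the empty word; their centrality lets
  \<open>pm_scale\<close> move through products on either side.\<close>

lemma single_zero_central: "a * Poly_Mapping.single (0::fword) c = Poly_Mapping.single 0 c * (a :: 'k::field free)"
proof -
  have "lin (\<lambda>w. Poly_Mapping.single w 1 * Poly_Mapping.single 0 c) a =
      lin (\<lambda>w. Poly_Mapping.single 0 c * Poly_Mapping.single w 1) a"
    by (simp add: mult_single)
  moreover have "lin (\<lambda>w. f w * b) a = lin f a * b" for f :: "fword \<Rightarrow> 'k free" and b
    by (simp add: lin_def sum_distrib_right mult_map_scale_conv_mult mult.assoc)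
  moreover have "lin (\<lambda>w. Poly_Mapping.single 0 c * f w) a = Poly_Mapping.single 0 c * lin f a"
    for f :: "fword \<Rightarrow> 'k free"
    using lin_fun_scale[of c f a] by (simp add: mult_map_scale_conv_mult)
  ultimately show ?thesis by (simp add: lin_single_id)
qed

lemma scale_mult_left [simp]: "pm_scale c a * b = pm_scale c (a * b :: 'k::field free)"
  by (simp add: mult_map_scale_conv_mult mult.assoc)

lemma scale_mult_right [simp]: "a * pm_scale c b = pm_scale c (a * b :: 'k::field free)"
  by (simp add: mult_map_scale_conv_mult mult.assoc[symmetric] single_zero_central)

lemma lin_mult_left: "lin f a * b = lin (\<lambda>w. f w * b) a" for b :: "'k::field free"
  by (simp add: lin_def sum_distrib_right)

lemma lin_mult_right: "b * lin f a = lin (\<lambda>w. b * f w) a" for b :: "'k::field free"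
  by (simp add: lin_def sum_distrib_left)

lemma single_Cons: "Poly_Mapping.single (FW (i # w)) 1 = var i * Poly_Mapping.single (FW w) (1::'k::field)"
  by (simp add: var_def mult_single plus_fword_def)

lemma single_snoc: "Poly_Mapping.single (FW (w @ [i])) 1 = Poly_Mapping.single (FW w) (1::'k::field) * var i"
  by (simp add: var_def mult_single plus_fword_def)

lemma single_append: "Poly_Mapping.single (FW (u @ v)) 1 =
    Poly_Mapping.single (FW u) 1 * Poly_Mapping.single (FW v) (1::'k::field)"
  by (simp add: mult_single plus_fword_def)

lemma single_FW_Nil [simp]: "Poly_Mapping.single (FW []) 1 = (1 :: 'k::field free)"
  by (metis single_one zero_fword_def)

text \<open>Degrees are recorded as sets since all elements of degree x_k + ... + x_m are
  multilinear; products then require disjoint degrees.\<close>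

definition homog :: "nat set \<Rightarrow> 'k::field free \<Rightarrow> bool" where
  "homog A a \<longleftrightarrow> (\<forall>w\<in>Poly_Mapping.keys a. mset (letters w) = mset_set A)"

lemma homog_scale: "homog A a \<Longrightarrow> homog A (pm_scale c a)"
  unfolding homog_def using keys_pm_scale by fastforce

lemma homog_add: "homog A a \<Longrightarrow> homog A b \<Longrightarrow> homog A (a + b)"
  unfolding homog_def using keys_add[of a b] by fastforce

lemma homog_diff: "homog A a \<Longrightarrow> homog A b \<Longrightarrow> homog A (a - b)"
  using homog_add[of A a "pm_scale (-1) b"] homog_scale[of A b "-1"]
  by (simp add: pm_scale_minus_left pm_scale_one)

lemma homog_mult: "homog A a \<Longrightarrow> homog B b \<Longrightarrow> finite A \<Longrightarrow> finite B \<Longrightarrow> A \<inter> B = {} \<Longrightarrow> homog (A \<union> B) (a * b)"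
  unfolding homog_def using keys_mult[of a b] by (fastforce simp: mset_set_Union)

lemma homog_X: "homog {i} (var i)"
  by (simp add: homog_def var_def)

text \<open>The characters are controlled only at the indices \<open>1..n\<close>; this predicate
  carries that restriction through the free algebra.\<close>

definition supp_in :: "nat set \<Rightarrow> 'k::field free \<Rightarrow> bool" where
  "supp_in A a \<longleftrightarrow> (\<forall>w\<in>Poly_Mapping.keys a. set (letters w) \<subseteq> A)"

lemma supp_in_mult: "supp_in A a \<Longrightarrow> supp_in A b \<Longrightarrow> supp_in A (a * b)"
  unfolding supp_in_def using keys_mult[of a b] by fastforce

lemma supp_in_X: "i \<in> A \<Longrightarrow> supp_in A (var i)"
  by (simp add: supp_in_def var_def)

lemma supp_in_single: "set w \<subseteq> A \<Longrightarrow> supp_in A (Poly_Mapping.single (FW w) c)"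
  by (simp add: supp_in_def)

lemma supp_in_one: "supp_in A 1"
  using supp_in_single[of "[]" A 1] by simp

lemma homog_supp_in: "homog A a \<Longrightarrow> finite A \<Longrightarrow> A \<subseteq> B \<Longrightarrow> supp_in B a"
  unfolding homog_def supp_in_def by (metis finite_set_mset_mset_set set_mset_mset)

text \<open>The braiding scalar of a word depends on its degree only, which turns scalars chosen
  word by word into one scalar per homogeneous element.\<close>

lemma prod_list_homog:
  assumes "homog A a" "w \<in> Poly_Mapping.keys a"
  shows "(\<Prod>j\<leftarrow>letters w. f j) = (\<Prod>j\<in>A. f j)"
proof -
  have "prod_mset (image_mset f (mset (letters w))) = (\<Prod>j\<in>A. f j)"
    using assms by (simp add: homog_def prod_unfold_prod_mset)
  then show ?thesis by (metis mset_map prod_mset_prod_list)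
qed

lemma set_letters_homog:
  assumes "homog A a" "w \<in> Poly_Mapping.keys a" "finite A"
  shows "set (letters w) = A"
  using assms unfolding homog_def by (metis finite_set_mset_mset_set set_mset_mset)

text \<open>\<open>p i j\<close> stands for the value of the i-th character at g_j. Keeping only
  these numbers separates the free algebra from the group.\<close>

locale braiding =
  fixes p :: "nat \<Rightarrow> nat \<Rightarrow> 'k::field" and q :: 'k and n :: nat
  assumes q: "q \<noteq> 0" "q \<noteq> 1"
    and p_nz: "i \<in> {1..n} \<Longrightarrow> j \<in> {1..n} \<Longrightarrow> p i j \<noteq> 0"
    and p_adj: "1 \<le> i \<Longrightarrow> i < n \<Longrightarrow> p i (i + 1) * p (i + 1) i = inverse q"
    and p_far: "1 \<le> i \<Longrightarrow> i + 1 < j \<Longrightarrow> j \<le> n \<Longrightarrow> p i j * p j i = 1"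
begin

definition pp :: "nat set \<Rightarrow> nat set \<Rightarrow> 'k" where
  "pp A B = (\<Prod>i\<in>A. \<Prod>j\<in>B. p i j)"

text \<open>The factor 1 - \<open>p i j * p j i\<close> for adjacent i and j: what remains of a
  bracket when a derivation meets both of its terms.\<close>

definition \<kappa>\<^sub>0 :: 'k where "\<kappa>\<^sub>0 = 1 - inverse q"

lemma \<kappa>\<^sub>0_nz: "\<kappa>\<^sub>0 \<noteq> 0"
  using q by (simp add: \<kappa>\<^sub>0_def inverse_eq_1_iff)

lemma pp_un_right: "finite B \<Longrightarrow> finite C \<Longrightarrow> B \<inter> C = {} \<Longrightarrow> pp A (B \<union> C) = pp A B * pp A C"
  by (simp add: pp_def prod.union_disjoint prod.distrib)

lemma pp_un_left: "finite B \<Longrightarrow> finite C \<Longrightarrow> B \<inter> C = {} \<Longrightarrow> pp (B \<union> C) A = pp B A * pp C A"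
  by (simp add: pp_def prod.union_disjoint)

lemma pp_far: "1 \<le> k \<Longrightarrow> A \<subseteq> {k+2..n} \<Longrightarrow> pp {k} A * pp A {k} = 1"
  by (simp add: pp_def prod.distrib[symmetric], rule prod.neutral) (use p_far[of k] in force)

text \<open>Among the pairs formed by k and the letters of \<open>{Suc k..m}\<close> only (k, k+1)
  is adjacent; all others contribute 1.\<close>

lemma pp_adj:
  assumes "1 \<le> k" "k < m" "m \<le> n"
  shows "pp {k} {Suc k..m} * pp {Suc k..m} {k} = inverse q"
proof -
  have "{Suc k..m} = {Suc k} \<union> {k+2..m}" using assms by auto
  then show ?thesis
    using p_adj[of k] pp_far[of k "{k+2..m}"] assms
    by (simp add: pp_un_left pp_un_right) (simp add: pp_def mult_ac)
qed

text \<open>The twist \<open>p j i\<close> is the cost of moving the group factor g_i of the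
  coproduct to the left past x_j.\<close>

fun dw :: "nat \<Rightarrow> nat list \<Rightarrow> 'k free" where
  "dw i [] = 0"
| "dw i (j # w) = pm_scale (p j i) (var j * dw i w) + (if i = j then Poly_Mapping.single (FW w) 1 else 0)"

definition der :: "nat \<Rightarrow> 'k free \<Rightarrow> 'k free" where
  "der i a = lin (\<lambda>w. dw i (letters w)) a"

lemma der_add: "der i (a + b) = der i a + der i b"
  and der_diff: "der i (a - b) = der i a - der i b"
  and der_scale: "der i (pm_scale c a) = pm_scale c (der i a)"
  and der_zero [simp]: "der i 0 = 0"
  by (simp_all add: der_def lin_add lin_diff lin_scale)

lemma der_single: "der i (Poly_Mapping.single (FW w) 1) = dw i w"
  by (simp add: der_def lin_single pm_scale_one)

lemma der_lin: "der i (lin f a) = lin (\<lambda>w. der i (f w)) a"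
  by (simp add: der_def lin_lin)

lemma der_X_mult: "der i (var j * a) = pm_scale (p j i) (var j * der i a) + (if i = j then a else 0)"
proof -
  have "der i (var j * lin (\<lambda>w. Poly_Mapping.single (FW (letters w)) 1) a) =
      pm_scale (p j i) (var j * der i (lin (\<lambda>w. Poly_Mapping.single (FW (letters w)) 1) a))
      + (if i = j then lin (\<lambda>w. Poly_Mapping.single (FW (letters w)) 1) a else 0)"
    by (simp only: lin_mult_right der_lin lin_fun_scale[symmetric] single_Cons[symmetric] der_single)
      (simp add: lin_fun_add lin_fun_scale lin_mult_right)
  then show ?thesis by (simp add: lin_single_id)
qed

lemma dw_snoc: "dw i (w @ [j]) = dw i w * var j +
    (if i = j then pm_scale (\<Prod>l\<leftarrow>w. p l i) (Poly_Mapping.single (FW w) 1) else 0)"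
  by (induction w) (auto simp: algebra_simps pm_scale_add pm_scale_scale single_Cons single_snoc)

text \<open>Removing the last letter collects the twists of the whole prefix; homogeneity of
  \<open>a\<close> makes this a single scalar.\<close>

lemma der_mult_X:
  assumes "finite A" "homog A a"
  shows "der i (a * var j) = der i a * var j + (if i = j then pm_scale (pp A {i}) a else 0)"
proof -
  have w: "(\<Prod>l\<leftarrow>letters w. p l i) = pp A {i}" if "w \<in> Poly_Mapping.keys a" for w
    using prod_list_homog[OF assms(2) that] by (simp add: pp_def)
  have "der i (lin (\<lambda>w. Poly_Mapping.single (FW (letters w)) 1) a * var j) =
      lin (\<lambda>w. dw i (letters w @ [j])) a"
    by (simp only: lin_mult_left der_lin single_snoc[symmetric] der_single)
  also have "\<dots> = lin (\<lambda>w. dw i (letters w) * var j +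
      (if i = j then pm_scale (pp A {i}) (Poly_Mapping.single w 1) else 0)) a"
    by (rule lin_cong) (auto simp: dw_snoc dest: w)
  also have "\<dots> = der i a * var j + (if i = j then pm_scale (pp A {i}) a else 0)"
    by (simp add: lin_fun_add lin_fun_scale lin_single_id lin_mult_left der_def)
  finally show ?thesis by (simp add: lin_single_id)
qed

lemma der_mult_X_neq: "i \<noteq> j \<Longrightarrow> der i (a * var j) = der i a * var j"
proof -
  assume ij: "i \<noteq> j"
  have "der i (lin (\<lambda>w. Poly_Mapping.single (FW (letters w)) 1) a * var j) =
      lin (\<lambda>w. dw i (letters w @ [j])) a"
    by (simp only: lin_mult_left der_lin single_snoc[symmetric] der_single)
  also have "\<dots> = der i a * var j"
    using ij by (simp add: dw_snoc der_def lin_mult_left)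
  finally show ?thesis by (simp add: lin_single_id)
qed

lemma der_homog_zero:
  assumes "finite A" "homog A a" "i \<notin> A"
  shows "der i a = 0"
proof -
  have d: "i \<notin> set w \<Longrightarrow> dw i w = 0" for w by (induction w) (auto simp: pm_scale_zero)
  have "set (letters w) = A" if "w \<in> Poly_Mapping.keys a" for w
    using set_letters_homog[OF assms(2) that assms(1)] .
  then have "der i a = lin (\<lambda>w. 0) a"
    unfolding der_def using assms(3) d by (intro lin_cong) auto
  then show ?thesis by simp
qed

definition D :: "nat list \<Rightarrow> 'k free \<Rightarrow> 'k free" where
  "D w = fold der w"

lemma D_simps [simp]: "D [] a = a" "D (i # w) a = D w (der i a)" "D (u @ w) a = D w (D u a)"
  by (simp_all add: D_def)

lemma D_diff: "D w (a - b) = D w a - D w b"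
  and D_add: "D w (a + b) = D w a + D w b"
  and D_scale: "D w (pm_scale c a) = pm_scale c (D w a)"
  and D_zero [simp]: "D w 0 = 0"
  by (induction w arbitrary: a b) (simp_all add: der_diff der_add der_scale)

lemma D_sum: "D w (\<Sum>i\<in>I. f i) = (\<Sum>i\<in>I. D w (f i))"
  by (induction I rule: infinite_finite_induct) (auto simp: D_add)

lemma D_mult_X: "j \<notin> set w \<Longrightarrow> D w (a * var j) = D w a * var j"
  by (induction w arbitrary: a) (auto simp: der_mult_X_neq)

lemma D_X_mult_list: "j \<notin> set w \<Longrightarrow> D w (var j * a) = pm_scale (\<Prod>i\<leftarrow>w. p j i) (var j * D w a)"
  by (induction w arbitrary: a) (auto simp: der_X_mult D_scale pm_scale_scale pm_scale_one mult_ac)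

lemma D_X_mult:
  assumes "j \<notin> A" "finite A" "mset w = mset_set A"
  shows "D w (var j * a) = pm_scale (pp {j} A) (var j * D w a)"
proof -
  have "set w = A" using assms by (metis finite_set_mset_mset_set set_mset_mset)
  moreover have "prod_mset (image_mset (p j) (mset w)) = pp {j} A"
    using assms by (simp add: pp_def prod_unfold_prod_mset)
  then have "(\<Prod>i\<leftarrow>w. p j i) = pp {j} A" by (metis mset_map prod_mset_prod_list)
  ultimately show ?thesis using D_X_mult_list[of j w a] assms by simp
qed

section \<open>The elements P(S, k, m)\<close>

definition br :: "nat set \<Rightarrow> nat set \<Rightarrow> 'k free \<Rightarrow> 'k free \<Rightarrow> 'k free" where
  "br A B a b = a * b - pm_scale (pp A B) (b * a)"

text \<open>
  \<open>P S k m\<close> is \<open>\<Psi>\<^sup>S(k, m)\<close> up to a nonzero scalar and modulo the commutation relations. Adding the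
  letters one at a time makes the action of the derivations exact in the free algebra.
\<close>

function P :: "nat set \<Rightarrow> nat \<Rightarrow> nat \<Rightarrow> 'k free" where
  "P S k m = (if k < m then
     if k \<in> S then br {Suc k..m} {k} (P S (Suc k) m) (var k) else br {k} {Suc k..m} (var k) (P S (Suc k) m)
     else var k)"
  by pat_completeness auto
termination by (relation "measure (\<lambda>(_, k, m). m - k)") auto

declare P.simps [simp del]

lemma P_self [simp]: "P S k k = var k"
  by (simp add: P.simps)

lemma P_in: "k < m \<Longrightarrow> k \<in> S \<Longrightarrow> P S k m = P S (Suc k) m * var k - pm_scale (pp {Suc k..m} {k}) (var k * P S (Suc k) m)"
  and P_notin: "k < m \<Longrightarrow> k \<notin> S \<Longrightarrow> P S k m = var k * P S (Suc k) m - pm_scale (pp {k} {Suc k..m}) (P S (Suc k) m * var k)"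
  by (subst P.simps, simp add: br_def)+

text \<open>\<open>P S k m\<close> sees only the part of \<open>S\<close> in \<open>{k..<m}\<close>,
  so sets are compared by their restrictions to intervals.\<close>

definition agree :: "nat \<Rightarrow> nat \<Rightarrow> nat set \<Rightarrow> nat set \<Rightarrow> bool" where
  "agree k i S T \<longleftrightarrow> S \<inter> {k..<i} = T \<inter> {k..<i}"

lemma agree_empty [simp]: "agree k k S T"
  by (simp add: agree_def)

lemma agree_split: "k < i \<Longrightarrow> agree k i S T \<longleftrightarrow> (k \<in> S \<longleftrightarrow> k \<in> T) \<and> agree (Suc k) i S T"
proof -
  assume "k < i"
  then have "{k..<i} = insert k {Suc k..<i}" by auto
  then show ?thesis by (auto simp: agree_def)
qed

lemma P_cong: "k \<le> m \<Longrightarrow> agree k m S T \<Longrightarrow> P S k m = P T k m"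
proof (induction k rule: inc_induct)
  case (step k)
  have "agree (Suc k) m S T" "k \<in> S \<longleftrightarrow> k \<in> T"
    using step.prems step.hyps agree_split[of k m S T] by auto
  then show ?case using step.IH step.hyps P.simps[of S k m] P.simps[of T k m] by simp
qed simp

lemma homog_P: "k \<le> m \<Longrightarrow> homog {k..m} (P S k m)"
proof (induction k rule: inc_induct)
  case (step k)
  have k: "{k} \<union> {Suc k..m} = {k..m}" "{k} \<inter> {Suc k..m} = {}" using step.hyps by auto
  have "homog {k..m} (var k * P S (Suc k) m)"
    using homog_mult[OF homog_X step.IH, of k] k by simp
  moreover have "homog {k..m} (P S (Suc k) m * var k)"
    using homog_mult[OF step.IH homog_X, of k] k by (simp add: Un_commute Int_commute)
  ultimately show ?case
    using step.hyps by (cases "k \<in> S") (auto simp: P_in P_notin intro!: homog_diff homog_scale)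
qed (simp add: homog_X)

text \<open>Removing x_k from x_k P' gives P', and from P' x_k gives the scalar R =
  \<open>pp {Suc k..m} {k}\<close> times P'. The second bracket order yields R - R = 0, the first
  yields 1 - 1/q by \<open>pp_adj\<close>.\<close>

lemma der_P:
  assumes "1 \<le> k" "k < m" "m \<le> n"
  shows "der k (P S k m) = (if k \<in> S then 0 else pm_scale \<kappa>\<^sub>0 (P S (Suc k) m))"
proof -
  have h: "homog {Suc k..m} (P S (Suc k) m)" using homog_P[of "Suc k" m S] assms by simp
  have z: "der k (P S (Suc k) m) = 0" using h by (rule der_homog_zero[rotated]) auto
  have 1: "der k (P S (Suc k) m * var k) = pm_scale (pp {Suc k..m} {k}) (P S (Suc k) m)"
    using der_mult_X[OF _ h, of k k] z by simp
  have 2: "der k (var k * P S (Suc k) m) = P S (Suc k) m"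
    using z by (simp add: der_X_mult pm_scale_zero)
  show ?thesis
    using pp_adj[OF assms] 1 2 assms
    by (auto simp: P_in P_notin der_diff der_scale pm_scale_scale \<kappa>\<^sub>0_def pm_scale_one
        pm_scale_diff_left)
qed

lemma mset_set_Icc: "(k::nat) \<le> i \<Longrightarrow> mset_set {k..i} = add_mset k (mset_set {Suc k..i})"
  using mset_set.insert[of "{Suc k..i}" k] atLeastAtMost_insertL[of k i] by simp

text \<open>The mirror image of \<open>der_P\<close>: if the letters other than k are removed first,
  only x_k is left, and now the order with x_k on the right survives while the other order
  cancels.\<close>

lemma D_full_step:
  assumes "1 \<le> k" "k < m" "m \<le> n" and w: "mset w = mset_set {Suc k..m}"
    and d: "D w (P S (Suc k) m) = pm_scale d 1"
  shows "D w (P S k m) = (if k \<in> S then pm_scale (d * \<kappa>\<^sub>0) (var k) else 0)"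
proof -
  have k: "k \<notin> set w" using w by (metis atLeastAtMost_iff finite_atLeastAtMost finite_set_mset_mset_set not_less_eq_eq order_refl set_mset_mset Suc_eq_plus1)
  have 1: "D w (P S (Suc k) m * var k) = pm_scale d (var k)"
    using d D_mult_X[OF k] by simp
  have 2: "D w (var k * P S (Suc k) m) = pm_scale (pp {k} {Suc k..m} * d) (var k)"
    using d w D_X_mult[of k "{Suc k..m}" w] by (simp add: pm_scale_scale)
  have "pp {Suc k..m} {k} * (pp {k} {Suc k..m} * d) = inverse q * d"
    using pp_adj[OF assms(1-3)] by (simp add: mult_ac)
  then show ?thesis
    using 1 2 assms
    by (auto simp: P_in P_notin D_diff D_scale pm_scale_scale \<kappa>\<^sub>0_def algebra_simps
        pm_scale_diff_left)
qed

text \<open>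
  The word \<open>w\<close> removes the letters in an order compatible with \<open>S\<^sub>0\<close>: \<open>j\<close> after \<open>j + 1\<close> exactly if
  \<open>j \<in> S\<^sub>0\<close>. It detects \<open>S\<^sub>0\<close> among all \<open>S\<close>.
\<close>

lemma D_full:
  assumes "1 \<le> k" "k \<le> m" "m \<le> n"
  shows "\<exists>w \<kappa>. \<kappa> \<noteq> 0 \<and> mset w = mset_set {k..m} \<and>
    (\<forall>S. D w (P S k m) = (if agree k m S S\<^sub>0 then pm_scale \<kappa> 1 else 0))"
  using assms(2,1)
proof (induction k rule: inc_induct)
  case base
  have "der m (var m * 1) = pm_scale 1 1"
    by (simp only: der_X_mult) (simp add: pm_scale_one der_def lin_def pm_scale_zero)
  then show ?case by (intro exI[of _ "[m]"] exI[of _ 1]) auto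
next
  case (step k)
  from step.IH[OF le_SucI[OF step.prems]] obtain w \<kappa> where w: "\<kappa> \<noteq> 0" "mset w = mset_set {Suc k..m}"
    "\<And>S. D w (P S (Suc k) m) = (if agree (Suc k) m S S\<^sub>0 then pm_scale \<kappa> 1 else 0)" by blast
  have km: "1 \<le> k" "k < m" using step.hyps step.prems by auto
  have mset: "mset_set {k..m} = add_mset k (mset w)"
    using mset_set_Icc[of k m] km w(2) by simp
  note split = agree_split[OF km(2), of _ S\<^sub>0]
  show ?case
  proof (cases "k \<in> S\<^sub>0")
    case False
    have "D (k # w) (P S k m) = (if agree k m S S\<^sub>0 then pm_scale (\<kappa>\<^sub>0 * \<kappa>) 1 else 0)" for S
      using False split[of S] km assms(3)
      by (auto simp: der_P[of k m] D_scale w(3) pm_scale_scale)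
    moreover have "\<kappa>\<^sub>0 * \<kappa> \<noteq> 0" "mset (k # w) = mset_set {k..m}" using w(1) \<kappa>\<^sub>0_nz mset by auto
    ultimately show ?thesis by blast
  next
    case True
    have dX: "der k (var k) = 1" using der_X_mult[of k k 1] by (simp add: der_def lin_def pm_scale_zero)
    have "D (w @ [k]) (P S k m) = (if agree k m S S\<^sub>0 then pm_scale (\<kappa> * \<kappa>\<^sub>0) 1 else 0)" for S
    proof (cases "agree (Suc k) m S S\<^sub>0")
      case c: True
      then have "D w (P S (Suc k) m) = pm_scale \<kappa> 1" using w(3) by simp
      from D_full_step[OF km assms(3) w(2) this] show ?thesis
        using c True split[of S] by (auto simp: der_scale dX)
    next
      case c: False
      then have "D w (P S (Suc k) m) = pm_scale 0 1" using w(3) by (simp add: pm_scale_zero)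
      from D_full_step[OF km assms(3) w(2) this] show ?thesis
        using c split[of S] by (auto simp: pm_scale_zero)
    qed
    moreover have "\<kappa> * \<kappa>\<^sub>0 \<noteq> 0" "mset (w @ [k]) = mset_set {k..m}" using w(1) \<kappa>\<^sub>0_nz mset by auto
    ultimately show ?thesis by blast
  qed
qed

text \<open>The left part can be removed only if it stands on the left, that is, if \<open>i\<close>
  is not in \<open>S\<close>. The order of removal encodes \<open>S\<^sub>0\<close> as in
  \<open>D_full\<close>, but a factor \<open>P S (Suc i) m\<close> stays behind. For k < i it is far
  from x_k, so it disturbs the scalars only by an invertible factor.\<close>

lemma D_left:
  assumes "1 \<le> k" "k \<le> i" "i < m" "m \<le> n"
  shows "\<exists>w \<kappa>. \<kappa> \<noteq> 0 \<and> mset w = mset_set {k..i} \<and>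
    (\<forall>S. D w (P S k m) = (if i \<notin> S \<and> agree k i S S\<^sub>0 then pm_scale \<kappa> (P S (Suc i) m) else 0))"
  using assms(2,1)
proof (induction k rule: inc_induct)
  case base
  have "D [i] (P S i m) = (if i \<notin> S then pm_scale \<kappa>\<^sub>0 (P S (Suc i) m) else 0)" for S
    using der_P[of i m S] base assms by simp
  then show ?case using \<kappa>\<^sub>0_nz by (intro exI[of _ "[i]"] exI[of _ \<kappa>\<^sub>0]) auto
next
  case (step k)
  from step.IH[OF le_SucI[OF step.prems]] obtain w \<kappa> where w: "\<kappa> \<noteq> 0" "mset w = mset_set {Suc k..i}"
    "\<And>S. D w (P S (Suc k) m) = (if i \<notin> S \<and> agree (Suc k) i S S\<^sub>0 then pm_scale \<kappa> (P S (Suc i) m) else 0)"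
    by blast
  have km: "1 \<le> k" "k < i" "k < m" using step.hyps step.prems assms by auto
  have mset: "mset_set {k..i} = add_mset k (mset w)"
    using mset_set_Icc[of k i] km w(2) by simp
  note split = agree_split[OF km(2), of _ S\<^sub>0]
  show ?case
  proof (cases "k \<in> S\<^sub>0")
    case False
    have "D (k # w) (P S k m) = (if i \<notin> S \<and> agree k i S S\<^sub>0 then pm_scale (\<kappa>\<^sub>0 * \<kappa>) (P S (Suc i) m) else 0)" for S
      using False split[of S] km assms(4)
      by (auto simp: der_P[of k m] D_scale w(3) pm_scale_scale)
    moreover have "\<kappa>\<^sub>0 * \<kappa> \<noteq> 0" "mset (k # w) = mset_set {k..i}" using w(1) \<kappa>\<^sub>0_nz mset by auto
    ultimately show ?thesis by blast
  next
    case True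
    \<comment> \<open>Capital letters belong to the part that stays, whose braiding with x_k
      cancels; small letters belong to the part that is removed, which contains the neighbour k+1
      and gives 1/q.\<close>
    let ?R = "pp {Suc i..m} {k}" and ?L = "pp {k} {Suc i..m}"
    let ?r = "pp {Suc k..i} {k}" and ?l = "pp {k} {Suc k..i}"
    have un: "{Suc k..m} = {Suc k..i} \<union> {Suc i..m}" using km assms by auto
    have Rr: "pp {Suc k..m} {k} = ?r * ?R" "pp {k} {Suc k..m} = ?l * ?L"
      unfolding un by (auto simp: pp_un_left pp_un_right)
    have LR: "?L * ?R = 1" using pp_far[of k "{Suc i..m}"] km assms by auto
    have lr: "?l * ?r = inverse q" using pp_adj[of k i] km assms by auto
    have R_nz: "?R \<noteq> 0" using LR by auto
    have kw: "k \<notin> set w" using w(2) by (metis atLeastAtMost_iff finite_atLeastAtMost finite_set_mset_mset_set not_less_eq_eq order_refl set_mset_mset Suc_eq_plus1)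
    have "D (w @ [k]) (P S k m) = (if i \<notin> S \<and> agree k i S S\<^sub>0 then
        pm_scale (\<kappa> * ?R * \<kappa>\<^sub>0) (P S (Suc i) m) else 0)" for S
    proof -
      let ?Q = "P S (Suc i) m"
      have h: "homog {Suc i..m} ?Q" using homog_P assms by simp
      have z: "der k ?Q = 0" using h km by (intro der_homog_zero[OF _ h]) auto
      define c where "c = (if i \<notin> S \<and> agree (Suc k) i S S\<^sub>0 then \<kappa> else 0)"
      have DP: "D w (P S (Suc k) m) = pm_scale c ?Q" by (simp add: w(3) c_def pm_scale_zero)
      have 1: "der k (D w (P S (Suc k) m * var k)) = pm_scale (c * ?R) ?Q"
        using der_mult_X[OF _ h, of k k] z by (simp add: D_mult_X[OF kw] DP der_scale pm_scale_scale)
      have 2: "der k (D w (var k * P S (Suc k) m)) = pm_scale (c * ?l) ?Q"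
        using w(2) by (simp add: D_X_mult[of k "{Suc k..i}"] DP der_scale der_X_mult z pm_scale_scale pm_scale_zero mult_ac)
      show ?thesis
      proof (cases "k \<in> S")
        case kS: True
        have "D (w @ [k]) (P S k m) = pm_scale (c * ?R) ?Q - pm_scale (?r * ?R * (c * ?l)) ?Q"
          using kS km by (simp add: P_in D_diff D_scale der_diff der_scale 1 2 pm_scale_scale Rr)
        also have "?r * ?R * (c * ?l) = c * ?R * inverse q" using lr by (simp add: mult_ac)
        finally have "D (w @ [k]) (P S k m) = pm_scale (c * ?R * \<kappa>\<^sub>0) ?Q"
          by (simp add: \<kappa>\<^sub>0_def right_diff_distrib pm_scale_diff_left)
        then show ?thesis using kS True split[of S] by (auto simp: c_def pm_scale_zero)
      next
        case kS: False
        have "D (w @ [k]) (P S k m) = pm_scale (c * ?l) ?Q - pm_scale (?l * ?L * (c * ?R)) ?Q"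
          using kS km by (simp add: P_notin D_diff D_scale der_diff der_scale 1 2 pm_scale_scale Rr)
        also have "?l * ?L * (c * ?R) = c * ?l" using LR by (simp add: mult_ac)
        finally show ?thesis using kS True split[of S] by auto
      qed
    qed
    moreover have "\<kappa> * ?R * \<kappa>\<^sub>0 \<noteq> 0" "mset (w @ [k]) = mset_set {k..i}" using w(1) \<kappa>\<^sub>0_nz R_nz mset by auto
    ultimately show ?thesis by blast
  qed
qed

text \<open>A word that removes the right part is taken from \<open>D_full\<close> and applied to
  longer and longer left parts. The scalar depends on \<open>S\<close>, because x_k is passed only
  when it stands on the left; only its being nonzero matters later.\<close>

lemma D_right:
  assumes "1 \<le> k" "k \<le> i" "i < m" "m \<le> n"
  shows "\<exists>w \<kappa>. (\<forall>S. \<kappa> S \<noteq> 0) \<and> mset w = mset_set {Suc i..m} \<and>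
    (\<forall>S. D w (P S k m) = (if i \<in> S \<and> agree (Suc i) m S S\<^sub>0 then pm_scale (\<kappa> S) (P S k i) else 0))"
proof -
  obtain w d where w: "d \<noteq> 0" "mset w = mset_set {Suc i..m}"
    "\<And>S. D w (P S (Suc i) m) = (if agree (Suc i) m S S\<^sub>0 then pm_scale d 1 else 0)"
    using D_full[of "Suc i" m S\<^sub>0] assms by auto
  have "\<exists>\<kappa>. (\<forall>S. \<kappa> S \<noteq> 0) \<and>
    (\<forall>S. D w (P S k m) = (if i \<in> S \<and> agree (Suc i) m S S\<^sub>0 then pm_scale (\<kappa> S) (P S k i) else 0))"
    using assms(2,1)
  proof (induction k rule: inc_induct)
    case base
    have "D w (P S i m) = (if i \<in> S \<and> agree (Suc i) m S S\<^sub>0 then pm_scale (d * \<kappa>\<^sub>0) (P S i i) else 0)" for S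
      using D_full_step[of i m w S "if agree (Suc i) m S S\<^sub>0 then d else 0"] w base assms
      by (auto simp: pm_scale_zero)
    then show ?case using \<kappa>\<^sub>0_nz w(1) by (intro exI[of _ "\<lambda>_. d * \<kappa>\<^sub>0"]) auto
  next
    case (step k)
    from step.IH[OF le_SucI[OF step.prems]] obtain \<kappa> where \<kappa>: "\<And>S. \<kappa> S \<noteq> 0"
      "\<And>S. D w (P S (Suc k) m) = (if i \<in> S \<and> agree (Suc i) m S S\<^sub>0 then pm_scale (\<kappa> S) (P S (Suc k) i) else 0)"
      by blast
    have km: "1 \<le> k" "k < i" "k < m" using step.hyps step.prems assms by auto
    let ?R = "pp {Suc i..m} {k}" and ?L = "pp {k} {Suc i..m}"
    let ?r = "pp {Suc k..i} {k}" and ?l = "pp {k} {Suc k..i}"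
    have un: "{Suc k..m} = {Suc k..i} \<union> {Suc i..m}" using km assms by auto
    have Rr: "pp {Suc k..m} {k} = ?r * ?R" "pp {k} {Suc k..m} = ?l * ?L"
      unfolding un by (auto simp: pp_un_left pp_un_right)
    have LR: "?L * ?R = 1" using pp_far[of k "{Suc i..m}"] km assms by auto
    have kw: "k \<notin> set w" using w(2) km by (metis atLeastAtMost_iff finite_atLeastAtMost finite_set_mset_mset_set not_less_eq_eq order_less_imp_le set_mset_mset Suc_eq_plus1)
    \<comment> \<open>Each k outside \<open>S\<close> contributes a factor \<open>?L\<close> for
      passing x_k; for k in \<open>S\<close> the twists cancel because
      \<open>?L * ?R = 1\<close>.\<close>
    have "D w (P S k m) = (if i \<in> S \<and> agree (Suc i) m S S\<^sub>0 then
        pm_scale (if k \<in> S then \<kappa> S else ?L * \<kappa> S) (P S k i) else 0)" for S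
    proof -
      define c where "c = (if i \<in> S \<and> agree (Suc i) m S S\<^sub>0 then \<kappa> S else 0)"
      let ?Q = "P S (Suc k) i"
      have DP: "D w (P S (Suc k) m) = pm_scale c ?Q" by (simp add: \<kappa>(2) c_def pm_scale_zero)
      have 1: "D w (P S (Suc k) m * var k) = pm_scale c (?Q * var k)"
        using DP by (simp add: D_mult_X[OF kw])
      have 2: "D w (var k * P S (Suc k) m) = pm_scale (?L * c) (var k * ?Q)"
        using w(2) DP km by (simp add: D_X_mult[of k "{Suc i..m}"] pm_scale_scale)
      show ?thesis
      proof (cases "k \<in> S")
        case kS: True
        have "D w (P S k m) = pm_scale c (?Q * var k) - pm_scale (?r * ?R * (?L * c)) (var k * ?Q)"
          using kS km by (simp add: P_in D_diff D_scale 1 2 pm_scale_scale Rr)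
        also have "?r * ?R * (?L * c) = c * ?r" using LR by (simp add: mult_ac)
        finally have "D w (P S k m) = pm_scale c (P S k i)"
          using kS km by (simp add: P_in pm_scale_diff pm_scale_scale)
        then show ?thesis using kS by (auto simp: c_def pm_scale_zero)
      next
        case kS: False
        have "D w (P S k m) = pm_scale (?L * c) (var k * ?Q) - pm_scale (?l * ?L * c) (?Q * var k)"
          using kS km by (simp add: P_notin D_diff D_scale 1 2 pm_scale_scale Rr)
        also have "\<dots> = pm_scale (?L * c) (P S k i)"
          using kS km by (simp add: P_notin pm_scale_diff pm_scale_scale mult_ac)
        finally show ?thesis using kS by (auto simp: c_def pm_scale_zero)
      qed
    qed
    moreover have "?L \<noteq> 0" using LR by auto
    ultimately show ?case using \<kappa>(1) by (intro exI[of _ "\<lambda>S. if k \<in> S then \<kappa> S else ?L * \<kappa> S"]) auto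
  qed
  then show ?thesis using w(2) by blast
qed

end

context braiding
begin

section \<open>The commutation ideal\<close>

text \<open>The two-sided ideal of the commutation relations inside the subalgebra on the letters
  \<open>1..n\<close>, given by its spanning elements.\<close>

inductive_set J :: "'k free set" where
  J_zero: "0 \<in> J"
| J_gen: "i \<in> {1..n} \<Longrightarrow> j \<in> {1..n} \<Longrightarrow> i + 1 < j \<or> j + 1 < i \<Longrightarrow> supp_in {1..n} a \<Longrightarrow> supp_in {1..n} b \<Longrightarrow>
    a * (var i * var j - pm_scale (p i j) (var j * var i)) * b \<in> J"
| J_add: "a \<in> J \<Longrightarrow> b \<in> J \<Longrightarrow> a + b \<in> J"
| J_scale: "a \<in> J \<Longrightarrow> pm_scale c a \<in> J"

lemma J_diff: "a \<in> J \<Longrightarrow> b \<in> J \<Longrightarrow> a - b \<in> J"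
  using J_add[OF _ J_scale[of b "-1"], of a]
  by (simp add: pm_scale_minus_left)

lemma J_mult_left: "a \<in> J \<Longrightarrow> supp_in {1..n} c \<Longrightarrow> c * a \<in> J"
proof (induction a rule: J.induct)
  case (J_gen i j a b)
  then have "(c * a) * (var i * var j - pm_scale (p i j) (var j * var i)) * b \<in> J"
    by (intro J.J_gen supp_in_mult) auto
  then show ?case by (simp add: mult.assoc)
qed (auto intro: J.intros simp: distrib_left)

lemma J_mult_right: "a \<in> J \<Longrightarrow> supp_in {1..n} c \<Longrightarrow> a * c \<in> J"
proof (induction a rule: J.induct)
  case (J_gen i j a b)
  then have "a * (var i * var j - pm_scale (p i j) (var j * var i)) * (b * c) \<in> J"
    by (intro J.J_gen supp_in_mult) auto
  then show ?case by (simp add: mult.assoc)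
qed (auto intro: J.intros simp: distrib_right)

lemma commute_word:
  assumes "1 \<le> k" "k \<le> n" "set w \<subseteq> {k+2..n}"
  shows "var k * Poly_Mapping.single (FW w) 1 - pm_scale (\<Prod>j\<leftarrow>w. p k j) (Poly_Mapping.single (FW w) 1 * var k) \<in> J"
  using assms(3)
proof (induction w)
  case Nil
  show ?case by (simp add: J_zero)
next
  case (Cons j w)
  let ?W = "Poly_Mapping.single (FW w) (1::'k)" and ?c = "\<Prod>j\<leftarrow>w. p k j"
  have "1 * (var k * var j - pm_scale (p k j) (var j * var k)) * ?W \<in> J"
    using Cons.prems assms by (intro J_gen supp_in_one supp_in_single) auto
  moreover have "pm_scale (p k j) (var j * (var k * ?W - pm_scale ?c (?W * var k))) \<in> J"
    using Cons assms by (intro J_scale J_mult_left supp_in_X) auto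
  ultimately have "1 * (var k * var j - pm_scale (p k j) (var j * var k)) * ?W
      + pm_scale (p k j) (var j * (var k * ?W - pm_scale ?c (?W * var k))) \<in> J"
    by (rule J_add)
  also have "1 * (var k * var j - pm_scale (p k j) (var j * var k)) * ?W
      + pm_scale (p k j) (var j * (var k * ?W - pm_scale ?c (?W * var k))) =
      var k * (var j * ?W) - pm_scale (p k j * ?c) (var j * ?W * var k)"
    by (simp add: left_diff_distrib right_diff_distrib pm_scale_diff pm_scale_scale mult.assoc)
  finally show ?case by (simp add: single_Cons)
qed

lemma commute_homog:
  assumes "1 \<le> k" "k \<le> n" "A \<subseteq> {k+2..n}" "homog A a"
  shows "var k * a - pm_scale (pp {k} A) (a * var k) \<in> J"
proof -
  have fin: "finite A" using assms(3) finite_subset by blast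
  let ?s = "\<lambda>w. Poly_Mapping.single w (1::'k)"
  have "lin (\<lambda>w. var k * ?s w + pm_scale (- pp {k} A) (?s w * var k)) a \<in> J"
  proof (rule lin_mem)
    fix w assume w: "w \<in> Poly_Mapping.keys a"
    have "(\<Prod>j\<leftarrow>letters w. p k j) = pp {k} A"
      using prod_list_homog[OF assms(4) w, of "p k"] by (simp add: pp_def)
    moreover have "set (letters w) \<subseteq> {k+2..n}"
      using set_letters_homog[OF assms(4) w fin] assms(3) by simp
    ultimately show "var k * ?s w + pm_scale (- pp {k} A) (?s w * var k) \<in> J"
      using commute_word[of k "letters w"] assms
      by (simp add: pm_scale_minus_left)
  qed (auto intro: J.intros)
  also have "lin (\<lambda>w. var k * ?s w + pm_scale (- pp {k} A) (?s w * var k)) a = var k * a - pm_scale (pp {k} A) (a * var k)"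
    unfolding lin_fun_add lin_fun_scale lin_mult_right[symmetric] lin_mult_left[symmetric] lin_single_id
    by (simp add: pm_scale_minus_left)
  finally show ?thesis .
qed

text \<open>Consecutive letters of an interval word differ by 1, so neither monomial of a far
  commutation relation can occur inside it.\<close>

lemma lookup_J_ascending: "a \<in> J \<Longrightarrow> Poly_Mapping.lookup a (FW [k..<m]) = 0"
proof (induction rule: J.induct)
  case (J_gen i j a b)
  let ?V = "{z :: 'k free. Poly_Mapping.lookup z (FW [k..<m]) = 0}"
  have V: "0 \<in> ?V" "\<And>x y. x \<in> ?V \<Longrightarrow> y \<in> ?V \<Longrightarrow> x + y \<in> ?V" "\<And>c x. x \<in> ?V \<Longrightarrow> pm_scale c x \<in> ?V"
    by (auto simp: lookup_add)
  have asc: "u @ i # j # v = [k..<m] \<Longrightarrow> j = Suc i" for i j u v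
  proof -
    assume e: "u @ i # j # v = [k..<m]"
    then have "length [k..<m] = length u + 2 + length v" by (metis length_append length_Cons add_Suc_right add_2_eq_Suc' add_Suc)
    then have l: "Suc (length u) < m - k" by simp
    have "[k..<m] ! length u = i" "[k..<m] ! Suc (length u) = j" unfolding e[symmetric] by (auto simp: nth_append)
    with l show ?thesis by simp
  qed
  let ?r = "var i * var j - pm_scale (p i j) (var j * var i) :: 'k free"
  let ?s = "\<lambda>w. Poly_Mapping.single w (1::'k)"
  have g: "?s u * ?r * ?s v \<in> ?V" for u v
  proof -
    have "?s u * ?r * ?s v = Poly_Mapping.single (FW (letters u @ i # j # letters v)) 1
        - pm_scale (p i j) (Poly_Mapping.single (FW (letters u @ j # i # letters v)) 1)"
      by (simp add: left_diff_distrib right_diff_distrib var_def mult_single plus_fword_def)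
    moreover have "letters u @ i # j # letters v \<noteq> [k..<m]" "letters u @ j # i # letters v \<noteq> [k..<m]"
      using asc J_gen.hyps(3) by fastforce+
    ultimately show ?thesis by (simp add: lookup_minus lookup_single when_def)
  qed
  \<comment> \<open>Expanding \<open>a\<close> and \<open>b\<close> into words reduces the generator
    \<open>a * ?r * b\<close> to the case of two words.\<close>
  have "lin (\<lambda>u. lin (\<lambda>v. ?s u * ?r * ?s v) b) a \<in> ?V"
    by (intro lin_mem[OF V] g)
  also have "lin (\<lambda>u. lin (\<lambda>v. ?s u * ?r * ?s v) b) a = a * ?r * b"
    unfolding lin_mult_right[symmetric] lin_mult_left[symmetric] lin_single_id ..
  finally show ?case by simp
qed (auto simp: lookup_add)

section \<open>The elements P(S, k, m) span\<close>

definition Sp :: "nat \<Rightarrow> nat \<Rightarrow> 'k free set" where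
  "Sp k m = {a. \<exists>\<alpha>. a - (\<Sum>S\<in>Pow {k..<m}. pm_scale (\<alpha> S) (P S k m)) \<in> J}"

lemma Sp_add: "a \<in> Sp k m \<Longrightarrow> b \<in> Sp k m \<Longrightarrow> a + b \<in> Sp k m"
proof -
  assume "a \<in> Sp k m" "b \<in> Sp k m"
  then obtain \<alpha> \<beta> where "a - (\<Sum>S\<in>Pow {k..<m}. pm_scale (\<alpha> S) (P S k m)) \<in> J"
    "b - (\<Sum>S\<in>Pow {k..<m}. pm_scale (\<beta> S) (P S k m)) \<in> J" by (auto simp: Sp_def)
  from J_add[OF this] have "a + b - (\<Sum>S\<in>Pow {k..<m}. pm_scale (\<alpha> S + \<beta> S) (P S k m)) \<in> J"
    by (simp add: pm_scale_add_left sum.distrib algebra_simps)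
  then show ?thesis unfolding Sp_def by (intro CollectI exI[of _ "\<lambda>S. \<alpha> S + \<beta> S"])
qed

lemma Sp_scale: "a \<in> Sp k m \<Longrightarrow> pm_scale c a \<in> Sp k m"
proof -
  assume "a \<in> Sp k m"
  then obtain \<alpha> where "a - (\<Sum>S\<in>Pow {k..<m}. pm_scale (\<alpha> S) (P S k m)) \<in> J" by (auto simp: Sp_def)
  from J_scale[OF this, of c] have "pm_scale c a - (\<Sum>S\<in>Pow {k..<m}. pm_scale (c * \<alpha> S) (P S k m)) \<in> J"
    by (simp add: pm_scale_diff pm_scale_sum pm_scale_scale)
  then show ?thesis unfolding Sp_def by (intro CollectI exI[of _ "\<lambda>S. c * \<alpha> S"])
qed

lemma J_subset_Sp: "a \<in> J \<Longrightarrow> a \<in> Sp k m"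
  unfolding Sp_def by (auto intro!: exI[of _ "\<lambda>_. 0"])

lemma Sp_sum: "(\<And>i. i \<in> I \<Longrightarrow> f i \<in> Sp k m) \<Longrightarrow> (\<Sum>i\<in>I. f i) \<in> Sp k m"
  by (induction I rule: infinite_finite_induct) (auto intro: Sp_add J_subset_Sp J_zero)

lemma P_in_Sp: "k \<le> m \<Longrightarrow> P S k m \<in> Sp k m"
proof -
  assume km: "k \<le> m"
  let ?S = "S \<inter> {k..<m}"
  have "(\<Sum>T\<in>Pow {k..<m}. pm_scale (if T = ?S then 1 else 0) (P T k m)) =
      (\<Sum>T\<in>Pow {k..<m}. if T = ?S then P T k m else 0)"
    by (intro sum.cong) auto
  also have "\<dots> = P ?S k m" by (subst sum.delta) auto
  also have "\<dots> = P S k m" using km by (intro P_cong) (auto simp: agree_def)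
  finally have "P S k m - (\<Sum>T\<in>Pow {k..<m}. pm_scale (if T = ?S then 1 else 0) (P T k m)) \<in> J"
    by (simp add: J_zero)
  then show ?thesis unfolding Sp_def by (intro CollectI exI[of _ "\<lambda>T. if T = ?S then 1 else 0"])
qed

text \<open>The sets \<open>S - {k}\<close> and \<open>insert k S\<close> give the two brackets of
  x_k with the same element. They form a linear system for the two products, with determinant 1 -
  \<open>?L * ?R\<close> = \<open>\<kappa>\<^sub>0\<close>.\<close>

lemma X_P_in_Sp:
  assumes "1 \<le> k" "k < m" "m \<le> n"
  shows "var k * P S (Suc k) m \<in> Sp k m" "P S (Suc k) m * var k \<in> Sp k m"
proof -
  let ?L = "pp {k} {Suc k..m}" and ?R = "pp {Suc k..m} {k}"
  have LR: "?L * ?R = inverse q" using pp_adj assms by auto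
  have c: "P (S - {k}) (Suc k) m = P S (Suc k) m" "P (insert k S) (Suc k) m = P S (Suc k) m"
    using assms by (auto intro!: P_cong simp: agree_def)
  have 1: "P (S - {k}) k m = var k * P S (Suc k) m - pm_scale ?L (P S (Suc k) m * var k)"
    using assms by (simp add: P_notin c)
  have 2: "P (insert k S) k m = P S (Suc k) m * var k - pm_scale ?R (var k * P S (Suc k) m)"
    using assms by (simp add: P_in c)
  have "pm_scale (inverse \<kappa>\<^sub>0) (P (S - {k}) k m + pm_scale ?L (P (insert k S) k m)) \<in> Sp k m"
    using assms by (intro Sp_scale Sp_add P_in_Sp) auto
  also have "P (S - {k}) k m + pm_scale ?L (P (insert k S) k m) = pm_scale \<kappa>\<^sub>0 (var k * P S (Suc k) m)"
    by (simp add: 1 2 pm_scale_diff pm_scale_scale LR \<kappa>\<^sub>0_def pm_scale_diff_left)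
  finally show "var k * P S (Suc k) m \<in> Sp k m"
    using \<kappa>\<^sub>0_nz by (simp add: pm_scale_scale)
  have "pm_scale (inverse \<kappa>\<^sub>0) (P (insert k S) k m + pm_scale ?R (P (S - {k}) k m)) \<in> Sp k m"
    using assms by (intro Sp_scale Sp_add P_in_Sp) auto
  also have "P (insert k S) k m + pm_scale ?R (P (S - {k}) k m) = pm_scale \<kappa>\<^sub>0 (P S (Suc k) m * var k)"
    using LR by (simp add: 1 2 pm_scale_diff pm_scale_scale mult.commute[of ?R] \<kappa>\<^sub>0_def pm_scale_diff_left)
  finally show "P S (Suc k) m * var k \<in> Sp k m"
    using \<kappa>\<^sub>0_nz by (simp add: pm_scale_scale)
qed

lemma X_Sp:
  assumes "1 \<le> k" "k < m" "m \<le> n" "a \<in> Sp (Suc k) m"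
  shows "var k * a \<in> Sp k m" "a * var k \<in> Sp k m"
proof -
  obtain \<alpha> where a: "a - (\<Sum>S\<in>Pow {Suc k..<m}. pm_scale (\<alpha> S) (P S (Suc k) m)) \<in> J" (is "a - ?s \<in> J")
    using assms(4) by (auto simp: Sp_def)
  have var: "supp_in {1..n} (var k)" using assms by (intro supp_in_X) auto
  have "var k * (a - ?s) \<in> Sp k m" "(a - ?s) * var k \<in> Sp k m"
    using J_mult_left[OF a var] J_mult_right[OF a var] by (auto intro: J_subset_Sp)
  moreover have "var k * ?s \<in> Sp k m" "?s * var k \<in> Sp k m"
    unfolding sum_distrib_left sum_distrib_right scale_mult_left scale_mult_right
    using X_P_in_Sp assms by (auto intro!: Sp_sum Sp_scale)
  ultimately have "var k * (a - ?s) + var k * ?s \<in> Sp k m" "(a - ?s) * var k + ?s * var k \<in> Sp k m"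
    by (auto intro: Sp_add)
  then show "var k * a \<in> Sp k m" "a * var k \<in> Sp k m" by (simp_all add: algebra_simps)
qed

text \<open>Modulo \<open>J\<close>, x_k passes every letter except x_(k+1). It can therefore be
  driven to that end of the word which x_(k+1) does not block, leaving a word on
  \<open>{Suc k..m}\<close> for the induction.\<close>

lemma word_in_Sp:
  assumes "1 \<le> k" "k \<le> m" "m \<le> n" "mset w = mset_set {k..m}"
  shows "Poly_Mapping.single (FW w) 1 \<in> Sp k m"
  using assms(2,1,4)
proof (induction k arbitrary: w rule: inc_induct)
  case base
  then have "w = [m]" by (simp)
  then show ?case using P_in_Sp[of m m "{}"] by (simp add: var_def)
next
  case (step k)
  have km: "1 \<le> k" "k < m" using step.hyps step.prems by auto
  have mk: "mset_set {k..m} = add_mset k (mset_set {Suc k..m})"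
    using mset_set_Icc[of k m] km by simp
  have "k \<in> set w" using step.prems(2) mk by (metis set_mset_mset union_single_eq_member)
  then obtain u v where w: "w = u @ k # v" by (meson split_list)
  have uv: "mset (u @ v) = mset_set {Suc k..m}" using step.prems(2) mk w by simp
  have suv: "set u \<union> set v = {Suc k..m}"
    using arg_cong[OF uv, of set_mset] by simp
  have dis: "distinct (u @ v)"
    using uv mset_eq_imp_distinct_iff[of "u @ v" "[Suc k..<Suc m]"]
    by (simp add: mset_upt atLeastLessThanSuc_atLeastAtMost del: upt_Suc)
  let ?U = "Poly_Mapping.single (FW u) (1::'k)" and ?V = "Poly_Mapping.single (FW v) (1::'k)"
  have UV: "?U * ?V \<in> Sp (Suc k) m"
    using step.IH[OF _ uv] by (simp add: single_append)
  have s: "Poly_Mapping.single (FW w) 1 = ?U * var k * ?V"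
    unfolding w by (simp add: single_append single_Cons mult.assoc)
  have supp: "supp_in {1..n} ?U" "supp_in {1..n} ?V"
    proof -
    have "set u \<union> set v \<subseteq> {1..n}" unfolding suv using km assms(3) by auto
    then show "supp_in {1..n} ?U" "supp_in {1..n} ?V" by (auto intro!: supp_in_single)
  qed
  show ?case
  proof (cases "Suc k \<in> set u")
    case False
    define c where "c = (\<Prod>j\<leftarrow>u. p k j)"
    have u: "set u \<subseteq> {k+2..n}"
    proof
      fix x assume "x \<in> set u"
      then have "x \<in> {Suc k..m}" "x \<noteq> Suc k" using suv False by auto
      then show "x \<in> {k+2..n}" using assms by auto
    qed
    \<comment> \<open>Driving x_k to the left expresses \<open>?U * var k * ?V\<close> through its
      counterpart by dividing by \<open>c\<close>.\<close>
    then have c: "c \<noteq> 0" unfolding c_def using p_nz[of k] km assms by (auto simp: prod_list_zero_iff)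
    have j: "(var k * ?U - pm_scale c (?U * var k)) * ?V \<in> J"
      unfolding c_def using u km assms by (intro J_mult_right supp commute_word) auto
    have "pm_scale (inverse c) (var k * (?U * ?V)) + pm_scale (- inverse c) ((var k * ?U - pm_scale c (?U * var k)) * ?V) \<in> Sp k m"
      using X_Sp[OF km assms(3) UV] J_subset_Sp[OF j, of k m] by (intro Sp_add Sp_scale)
    also have "pm_scale (inverse c) (var k * (?U * ?V)) + pm_scale (- inverse c) ((var k * ?U - pm_scale c (?U * var k)) * ?V)
        = ?U * var k * ?V"
      using c by (simp add: left_diff_distrib pm_scale_diff pm_scale_scale mult.assoc
          pm_scale_minus_left)
    finally show ?thesis unfolding s .
  next
    case True
    define c where "c = (\<Prod>j\<leftarrow>v. p k j)"
    have v: "set v \<subseteq> {k+2..n}"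
    proof
      fix x assume "x \<in> set v"
      then have "x \<in> {Suc k..m}" "x \<noteq> Suc k" using suv True dis by auto
      then show "x \<in> {k+2..n}" using assms by auto
    qed
    have j: "?U * (var k * ?V - pm_scale c (?V * var k)) \<in> J"
      unfolding c_def using v km assms by (intro J_mult_left supp commute_word) auto
    have "pm_scale c (?U * ?V * var k) + ?U * (var k * ?V - pm_scale c (?V * var k)) \<in> Sp k m"
      using X_Sp[OF km assms(3) UV] J_subset_Sp[OF j, of k m] by (intro Sp_add Sp_scale)
    then show ?thesis unfolding s by (simp add: right_diff_distrib mult.assoc)
  qed
qed

lemma homog_in_Sp:
  assumes "1 \<le> k" "k \<le> m" "m \<le> n" "homog {k..m} a"
  shows "a \<in> Sp k m"
proof -
  have "lin (\<lambda>w. Poly_Mapping.single (FW (letters w)) 1) a \<in> Sp k m"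
  proof (rule lin_mem)
    fix w assume "w \<in> Poly_Mapping.keys a"
    then show "Poly_Mapping.single (FW (letters w)) 1 \<in> Sp k m"
      using assms by (intro word_in_Sp) (auto simp: homog_def)
  qed (auto intro: Sp_add Sp_scale J_subset_Sp J_zero)
  then show ?thesis by (simp add: lin_single_id)
qed

section \<open>Splitting P(S, k, m) at an element of S\<close>

lemma br_J_left: "a \<in> J \<Longrightarrow> supp_in {1..n} b \<Longrightarrow> br A B a b \<in> J"
  and br_J_right: "a \<in> J \<Longrightarrow> supp_in {1..n} b \<Longrightarrow> br A B b a \<in> J"
  unfolding br_def by (simp_all only: J_diff J_scale J_mult_left J_mult_right)

lemma br_linear_left: "br A B (a - pm_scale c a') b = br A B a b - pm_scale c (br A B a' b)"
  and br_linear_right: "br A B b (a - pm_scale c a') = br A B b a - pm_scale c (br A B b a')"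
  by (simp_all add: br_def left_diff_distrib right_diff_distrib pm_scale_diff pm_scale_scale mult.commute)

lemma homog_br: "homog A a \<Longrightarrow> homog B b \<Longrightarrow> finite A \<Longrightarrow> finite B \<Longrightarrow> A \<inter> B = {} \<Longrightarrow> homog (A \<union> B) (br A B a b)"
  unfolding br_def using homog_mult[of B b A a] homog_mult[of A a B b]
  by (auto intro!: homog_diff homog_scale simp: Un_commute Int_commute)

end

context braiding
begin

text \<open>A Jacobi-type rule: because x skew-commutes with b modulo \<open>J\<close>, it can be
  pulled into the inner bracket, [x, [b, a]] = p(k, B) [b, [x, a]].\<close>

lemma br_nest_left:
  assumes A: "finite A" "finite B" "A \<inter> B = {}" "k \<notin> A" "k \<notin> B"
    and c: "x * b - pm_scale (pp {k} B) (b * x) \<in> J"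
    and pp: "pp {k} B * pp B {k} = 1" and a: "supp_in {1..n} a"
  shows "br {k} (B \<union> A) x (br B A b a) - pm_scale (pp {k} B) (br B ({k} \<union> A) b (br {k} A x a)) \<in> J"
proof -
  \<comment> \<open>Opaque, since the commutative laws would rewrite the partial application of \<open>*\<close> in \<open>pm_scale\<close>.\<close>
  define sc where "sc c z = pm_scale c z" for c :: 'k and z :: "'k free"
  have sc: "sc c (y - z) = sc c y - sc c z" "sc c (y + z) = sc c y + sc c z" "sc c (sc d z) = sc (c * d) z"
    "sc c y * z = sc c (y * z)" "y * sc c z = sc c (y * z)" for c d y z
    by (simp_all add: sc_def pm_scale_diff pm_scale_add pm_scale_scale)
  \<comment> \<open>Since the far factors cancel, \<open>pp B A\<close> equals \<open>l * e\<close>,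
    where \<open>e\<close> is the scalar of the outer bracket by \<open>b\<close>. The claim becomes
    an identity with the three scalars as parameters.\<close>
  define l e c where "l = pp {k} B" and "e = pp B {k} * pp B A" and "c = pp {k} A"
  have "l * e = l * pp B {k} * pp B A" by (simp add: e_def)
  then have le: "pp B A = l * e" using pp by (simp add: l_def)
  have p1: "pp {k} (B \<union> A) = l * c" using A by (subst pp_un_right) (auto simp: l_def c_def)
  have p2: "pp B ({k} \<union> A) = e" using A by (subst pp_un_right) (auto simp: e_def)
  let ?d = "x * b - sc l (b * x)"
  have d: "?d \<in> J" using c by (simp add: sc_def l_def)
  have "br {k} (B \<union> A) x (br B A b a) - pm_scale (pp {k} B) (br B ({k} \<union> A) b (br {k} A x a)) =
     (x * (b * a - sc (l * e) (a * b)) - sc (l * c) ((b * a - sc (l * e) (a * b)) * x))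
     - sc l (b * (x * a - sc c (a * x)) - sc e ((x * a - sc c (a * x)) * b))"
    unfolding br_def p1 p2 le sc_def l_def c_def ..
  \<comment> \<open>All triple products cancel except those in which x and b are neighbours; these
    combine to the commutator \<open>?d\<close> with \<open>a\<close> on one side.\<close>
  also have "\<dots> = ?d * a - sc (c * (l * e)) (a * ?d)"
    apply (simp only: sc left_diff_distrib right_diff_distrib mult.assoc)
    apply (simp only: mult.commute[of c] mult.left_commute[of c] mult.commute[of e l] mult.left_commute[of e l] mult.assoc)
    apply simp
    done
  finally have eq: "br {k} (B \<union> A) x (br B A b a) - pm_scale (pp {k} B) (br B ({k} \<union> A) b (br {k} A x a)) =
    ?d * a - sc (c * (l * e)) (a * ?d)" .
  show ?thesis unfolding eq sc_def[of "c * (l * e)"]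
    by (intro J_diff J_scale J_mult_right[OF d a] J_mult_left[OF d a])
qed

text \<open>The mirror rule [[b, a], x] = [b, [a, x]]; with x on the right no scalar is left
  over.\<close>

lemma br_nest_right:
  assumes A: "finite A" "finite B" "A \<inter> B = {}" "k \<notin> A" "k \<notin> B"
    and c: "x * b - pm_scale (pp {k} B) (b * x) \<in> J"
    and pp: "pp {k} B * pp B {k} = 1" and a: "supp_in {1..n} a"
  shows "br (B \<union> A) {k} (br B A b a) x - br B ({k} \<union> A) b (br A {k} a x) \<in> J"
proof -
  define sc where "sc c z = pm_scale c z" for c :: 'k and z :: "'k free"
  have sc: "sc c (y - z) = sc c y - sc c z" "sc c (y + z) = sc c y + sc c z" "sc c (sc d z) = sc (c * d) z"
    "sc c y * z = sc c (y * z)" "y * sc c z = sc c (y * z)" for c d y z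
    by (simp_all add: sc_def pm_scale_diff pm_scale_add pm_scale_scale)
  define l e r where "l = pp {k} B" and "e = pp B {k} * pp B A" and "r = pp B {k} * pp A {k}"
  have "l * e = l * pp B {k} * pp B A" by (simp add: e_def)
  then have le: "pp B A = l * e" using pp by (simp add: l_def)
  have "l * r = l * pp B {k} * pp A {k}" by (simp add: r_def)
  then have lr: "pp A {k} = l * r" using pp by (simp add: l_def)
  have p1: "pp (B \<union> A) {k} = r" using A by (subst pp_un_left) (auto simp: r_def)
  have p2: "pp B ({k} \<union> A) = e" using A by (subst pp_un_right) (auto simp: e_def)
  let ?d = "x * b - sc l (b * x)"
  have d: "?d \<in> J" using c by (simp add: sc_def l_def)
  have "br (B \<union> A) {k} (br B A b a) x - br B ({k} \<union> A) b (br A {k} a x) =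
     ((b * a - sc (l * e) (a * b)) * x - sc r (x * (b * a - sc (l * e) (a * b))))
     - (b * (a * x - sc (l * r) (x * a)) - sc e ((a * x - sc (l * r) (x * a)) * b))"
    unfolding br_def p1 p2 le lr sc_def ..
  also have "\<dots> = sc e (a * ?d) - sc r (?d * a)"
    apply (simp only: sc left_diff_distrib right_diff_distrib mult.assoc)
    apply (simp only: mult.commute[of r] mult.left_commute[of r] mult.commute[of e l] mult.left_commute[of e l] mult.assoc)
    apply simp
    done
  finally have eq: "br (B \<union> A) {k} (br B A b a) x - br B ({k} \<union> A) b (br A {k} a x) =
    sc e (a * ?d) - sc r (?d * a)" .
  show ?thesis unfolding eq sc_def[of e] sc_def[of r]
    by (intro J_diff J_scale J_mult_right[OF d a] J_mult_left[OF d a])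
qed

text \<open>For k = i this is the definition of \<open>P\<close>. A further letter x_k with k < i is
  far from the right part, so the nesting rules move it from the outside into the left part;
  \<open>\<kappa>\<close> collects the invertible scalars of \<open>br_nest_left\<close>.\<close>

lemma P_split:
  assumes "1 \<le> k" "k \<le> i" "i < m" "m \<le> n" "i \<in> S"
  shows "\<exists>\<kappa>. \<kappa> \<noteq> 0 \<and> P S k m - pm_scale \<kappa> (br {Suc i..m} {k..i} (P S (Suc i) m) (P S k i)) \<in> J"
  using assms(2,1)
proof (induction k rule: inc_induct)
  case base
  have "P S i m = br {Suc i..m} {i} (P S (Suc i) m) (var i)"
    using assms by (subst P.simps) simp
  then show ?case by (intro exI[of _ 1]) (simp add: J_zero)
next
  case (step k)
  have km: "1 \<le> k" "k < i" using step.hyps step.prems by auto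
  let ?B = "{Suc i..m}" and ?A = "{Suc k..i}"
  let ?b = "P S (Suc i) m" and ?a = "P S (Suc k) i"
  from step.IH[OF le_SucI[OF step.prems]] obtain \<kappa> where \<kappa>: "\<kappa> \<noteq> 0"
    and IH: "P S (Suc k) m - pm_scale \<kappa> (br ?B ?A ?b ?a) \<in> J" by blast
  have BA: "{Suc k..m} = ?B \<union> ?A" and kA: "{k..i} = {k} \<union> ?A" using km assms by auto
  have var: "supp_in {1..n} (var k)" using km assms by (intro supp_in_X) auto
  have c: "var k * ?b - pm_scale (pp {k} ?B) (?b * var k) \<in> J"
    using km assms by (intro commute_homog homog_P) auto
  have pp: "pp {k} ?B * pp ?B {k} = 1" using km assms by (intro pp_far) auto
  have a: "supp_in {1..n} ?a" using km assms by (intro homog_supp_in[OF homog_P]) auto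
  have fin: "finite ?A" "finite ?B" "?A \<inter> ?B = {}" "k \<notin> ?A" "k \<notin> ?B" using km by auto
  show ?case
  proof (cases "k \<in> S")
    case True
    have "br {Suc k..m} {k} (P S (Suc k) m) (var k) - pm_scale \<kappa> (br (?B \<union> ?A) {k} (br ?B ?A ?b ?a) (var k)) \<in> J"
      using br_J_left[OF IH var] BA by (simp add: br_linear_left)
    moreover note J_scale[OF br_nest_right[OF fin c pp a], of \<kappa>]
    ultimately have "br {Suc k..m} {k} (P S (Suc k) m) (var k) - pm_scale \<kappa> (br (?B \<union> ?A) {k} (br ?B ?A ?b ?a) (var k))
       + pm_scale \<kappa> (br (?B \<union> ?A) {k} (br ?B ?A ?b ?a) (var k) - br ?B ({k} \<union> ?A) ?b (br ?A {k} ?a (var k))) \<in> J"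
      by (rule J_add)
    moreover have "br {Suc k..m} {k} (P S (Suc k) m) (var k) = P S k m" "br ?A {k} ?a (var k) = P S k i"
      using True km assms by (simp_all add: P.simps[of S k])
    ultimately show ?thesis using \<kappa> kA by (intro exI[of _ \<kappa>]) (simp add: pm_scale_diff)
  next
    case False
    have "br {k} {Suc k..m} (var k) (P S (Suc k) m) - pm_scale \<kappa> (br {k} (?B \<union> ?A) (var k) (br ?B ?A ?b ?a)) \<in> J"
      using br_J_right[OF IH var] BA by (simp add: br_linear_right)
    moreover note J_scale[OF br_nest_left[OF fin c pp a], of \<kappa>]
    ultimately have "br {k} {Suc k..m} (var k) (P S (Suc k) m) - pm_scale \<kappa> (br {k} (?B \<union> ?A) (var k) (br ?B ?A ?b ?a))
       + pm_scale \<kappa> (br {k} (?B \<union> ?A) (var k) (br ?B ?A ?b ?a)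
          - pm_scale (pp {k} ?B) (br ?B ({k} \<union> ?A) ?b (br {k} ?A (var k) ?a))) \<in> J"
      by (rule J_add)
    moreover have "br {k} {Suc k..m} (var k) (P S (Suc k) m) = P S k m" "br {k} ?A (var k) ?a = P S k i"
      using False km assms by (simp_all add: P.simps[of S k])
    moreover have "\<kappa> * pp {k} ?B \<noteq> 0" using \<kappa> pp by auto
    ultimately show ?thesis using kA
      by (intro exI[of _ "\<kappa> * pp {k} ?B"]) (simp add: pm_scale_diff pm_scale_scale)
  qed
qed

text \<open>The literal nested bracket of Psi in the free algebra, with \<open>P {} k s\<close> in
  the role of u[k, s].\<close>

fun psi :: "nat \<Rightarrow> nat list \<Rightarrow> nat \<Rightarrow> 'k free" where
  "psi k [] m = P {} k m"
| "psi k (s # ss) m = br {Suc s..m} {k..s} (psi (Suc s) ss m) (P {} k s)"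

lemma homog_psi:
  "sorted_wrt (<) ss \<Longrightarrow> set ss \<subseteq> {k..<m} \<Longrightarrow> k \<le> m \<Longrightarrow> homog {k..m} (psi k ss m)"
proof (induction ss arbitrary: k)
  case (Cons s ss)
  have s: "k \<le> s" "s < m" and ss: "set ss \<subseteq> {Suc s..<m}" using Cons.prems by force+
  have "homog ({Suc s..m} \<union> {k..s}) (br {Suc s..m} {k..s} (psi (Suc s) ss m) (P {} k s))"
    using s ss Cons by (intro homog_br homog_P Cons.IH) auto
  moreover have "{Suc s..m} \<union> {k..s} = {k..m}" using s by auto
  ultimately show ?case by simp
qed (simp add: homog_P)

text \<open>Splitting at the smallest element leaves u[k, s] as left part, because no cut lies to
  its left; the right part is treated by induction.\<close>

lemma P_psi:
  assumes "1 \<le> k" "k \<le> m" "m \<le> n" "sorted_wrt (<) ss" "set ss \<subseteq> {k..<m}"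
  shows "\<exists>\<kappa>. \<kappa> \<noteq> 0 \<and> P (set ss) k m - pm_scale \<kappa> (psi k ss m) \<in> J"
  using assms
proof (induction ss arbitrary: k)
  case Nil
  then show ?case by (intro exI[of _ 1]) (simp add: J_zero)
next
  case (Cons s ss)
  have s: "k \<le> s" "s < m" and ss: "set ss \<subseteq> {Suc s..<m}" using Cons.prems by force+
  let ?S = "set (s # ss)"
  obtain \<kappa> where \<kappa>: "\<kappa> \<noteq> 0" "P ?S k m - pm_scale \<kappa> (br {Suc s..m} {k..s} (P ?S (Suc s) m) (P ?S k s)) \<in> J"
    using P_split[of k s m ?S] s Cons.prems by auto
  have 1: "P ?S (Suc s) m = P (set ss) (Suc s) m" using s by (intro P_cong) (auto simp: agree_def)
  have 2: "P ?S k s = P {} k s" using s ss by (intro P_cong) (auto simp: agree_def)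
  have supp: "supp_in {1..n} (P {} k s)" using s Cons.prems by (intro homog_supp_in[OF homog_P]) auto
  obtain \<mu> where \<mu>: "\<mu> \<noteq> 0" "P (set ss) (Suc s) m - pm_scale \<mu> (psi (Suc s) ss m) \<in> J"
    using Cons.IH[of "Suc s"] s ss Cons.prems by auto
  have "pm_scale \<kappa> (br {Suc s..m} {k..s} (P (set ss) (Suc s) m) (P {} k s) - pm_scale \<mu> (psi k (s # ss) m)) \<in> J"
    using J_scale[OF br_J_left[OF \<mu>(2) supp]] by (simp add: br_linear_left)
  from J_add[OF \<kappa>(2)[unfolded 1 2] this]
  have "P ?S k m - pm_scale (\<kappa> * \<mu>) (psi k (s # ss) m) \<in> J"
    by (simp add: pm_scale_diff pm_scale_scale)
  then show ?case using \<kappa>(1) \<mu>(1) by (intro exI[of _ "\<kappa> * \<mu>"]) simp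
qed

end

section \<open>The induction on derivation-stable subalgebras\<close>

section \<open>Derivation-stable subalgebras\<close>

text \<open>\<open>U\<close> models the preimage of the coideal subalgebra in the free algebra;
  \<open>J_U\<close> reflects that far commutators vanish in the quotient.\<close>

locale coideal = braiding p q n for p :: "nat \<Rightarrow> nat \<Rightarrow> 'k::field" and q n +
  fixes U :: "'k free set"
  assumes U_add: "a \<in> U \<Longrightarrow> b \<in> U \<Longrightarrow> a + b \<in> U"
    and U_mult: "a \<in> U \<Longrightarrow> b \<in> U \<Longrightarrow> a * b \<in> U"
    and U_scale: "a \<in> U \<Longrightarrow> pm_scale c a \<in> U"
    and U_der: "i \<in> {1..n} \<Longrightarrow> a \<in> U \<Longrightarrow> der i a \<in> U"
    and J_U: "a \<in> J \<Longrightarrow> a \<in> U"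
begin

lemma U_diff: "a \<in> U \<Longrightarrow> b \<in> U \<Longrightarrow> a - b \<in> U"
  using U_add[OF _ U_scale[of b "-1"], of a]
  by (simp add: pm_scale_minus_left)

lemma U_D: "set w \<subseteq> {1..n} \<Longrightarrow> a \<in> U \<Longrightarrow> D w a \<in> U"
  by (induction w arbitrary: a) (auto simp: U_der[simplified])

lemma U_unscale: "c \<noteq> 0 \<Longrightarrow> pm_scale c a \<in> U \<Longrightarrow> a \<in> U"
  using U_scale[of "pm_scale c a" "inverse c"] by (simp add: pm_scale_scale)

lemma U_cong: "a - b \<in> J \<Longrightarrow> b \<in> U \<Longrightarrow> a \<in> U"
  using U_add[OF J_U, of "a - b" b] by simp

lemma P_glue:
  assumes "1 \<le> k" "k \<le> i" "i < m" "m \<le> n" "P R (Suc i) m \<in> U" "P T k i \<in> U"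
  shows "\<exists>S. P S k m \<in> U"
proof -
  \<comment> \<open>The cut at \<open>i\<close> is forced in, so that \<open>P_split\<close> applies
    and exhibits the new element as the bracket of the two given ones.\<close>
  let ?S = "{i} \<union> (R \<inter> {Suc i..<m}) \<union> (T \<inter> {k..<i})"
  have "P ?S (Suc i) m = P R (Suc i) m" "P ?S k i = P T k i"
    using assms by (auto intro!: P_cong simp: agree_def)
  moreover obtain \<kappa> where "P ?S k m - pm_scale \<kappa> (br {Suc i..m} {k..i} (P ?S (Suc i) m) (P ?S k i)) \<in> J"
    using P_split[of k i m ?S] assms by auto
  moreover have "br {Suc i..m} {k..i} (P R (Suc i) m) (P T k i) \<in> U"
    unfolding br_def using assms by (intro U_diff U_mult U_scale)
  ultimately show ?thesis using U_cong U_scale by metis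
qed

text \<open>Induction on m - k with the invariant that the sets in \<open>F\<close> are pairwise
  inequivalent on \<open>{k..<m}\<close> and carry nonzero coefficients. Removing one side of a
  position \<open>i\<close> keeps the sets that agree with a chosen one on that side and have the
  same membership of \<open>i\<close>; hence they are inequivalent on the other side, and the
  invariant persists.\<close>

lemma P_in_U_if_combination:
  assumes "1 \<le> k" "k \<le> m" "m \<le> n" "finite F" "F \<noteq> {}"
    and "\<And>S T. S \<in> F \<Longrightarrow> T \<in> F \<Longrightarrow> agree k m S T \<Longrightarrow> S = T"
    and "\<And>S. S \<in> F \<Longrightarrow> \<alpha> S \<noteq> 0"
    and "(\<Sum>S\<in>F. pm_scale (\<alpha> S) (P S k m)) \<in> U"
  shows "\<exists>S. P S k m \<in> U"
  using assms
proof (induction "m - k" arbitrary: k m F \<alpha> rule: less_induct)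
  case less
  show ?case
  proof (cases "\<exists>S\<in>F. \<exists>T\<in>F. S \<noteq> T")
    case True
    then obtain S T where ST: "S \<in> F" "T \<in> F" "S \<noteq> T" by blast
    then have "S \<inter> {k..<m} \<noteq> T \<inter> {k..<m}" using less.prems(6) unfolding agree_def by blast
    then obtain i where "i \<in> {k..<m}" "i \<in> S \<longleftrightarrow> i \<notin> T" by blast
    then have i: "k \<le> i" "i < m" "i \<in> S \<longleftrightarrow> i \<notin> T" by auto
    \<comment> \<open>Orients the difference at \<open>i\<close>: \<open>S0\<close> makes the family
      for removing the left part nonempty, \<open>T0\<close> the one for removing the right
      part.\<close>
    then obtain S0 T0 where S0: "S0 \<in> F" "i \<notin> S0" and T0: "T0 \<in> F" "i \<in> T0" using ST by metis
    have ivl: "agree k m S T" if ivl: "agree k i S T" "agree (Suc i) m S T" "i \<in> S \<longleftrightarrow> i \<in> T" for S T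
    proof -
      have "x \<in> S \<longleftrightarrow> x \<in> T" if "x \<in> {k..<m}" for x
      proof -
        have "x \<in> {k..<i} \<or> x = i \<or> x \<in> {Suc i..<m}" using that by auto
        then show ?thesis using ivl unfolding agree_def by blast
      qed
      then show ?thesis unfolding agree_def by blast
    qed
    obtain w \<kappa> where w: "\<kappa> \<noteq> 0" "mset w = mset_set {k..i}"
      and Dw: "\<And>S. D w (P S k m) = (if i \<notin> S \<and> agree k i S S0 then pm_scale \<kappa> (P S (Suc i) m) else 0)"
      using D_left[OF less.prems(1) i(1,2) less.prems(3), of S0] by blast
    have "set w \<subseteq> {1..n}" using arg_cong[OF w(2), of set_mset] i(2) less.prems(1,3) by auto
    from U_D[OF this less.prems(8)]
    have "(\<Sum>S\<in>F. pm_scale (\<alpha> S) (D w (P S k m))) \<in> U" by (simp add: D_sum D_scale)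
    also have "(\<Sum>S\<in>F. pm_scale (\<alpha> S) (D w (P S k m))) =
        (\<Sum>S\<in>{S\<in>F. i \<notin> S \<and> agree k i S S0}. pm_scale (\<alpha> S * \<kappa>) (P S (Suc i) m))"
      using less.prems(4) by (intro sum.mono_neutral_cong_right) (auto simp: Dw pm_scale_scale)
    finally have U1: "(\<Sum>S\<in>{S\<in>F. i \<notin> S \<and> agree k i S S0}. pm_scale (\<alpha> S * \<kappa>) (P S (Suc i) m)) \<in> U" .
    have 1: "\<exists>R. P R (Suc i) m \<in> U"
    proof (rule less.hyps[OF _ _ _ _ _ _ _ _ U1])
      show "S = T" if "S \<in> {S\<in>F. i \<notin> S \<and> agree k i S S0}" "T \<in> {S\<in>F. i \<notin> S \<and> agree k i S S0}"
        "agree (Suc i) m S T" for S T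
      proof -
        have "agree k i S T" using that by (simp add: agree_def)
        then show ?thesis using that by (intro less.prems(6) ivl) simp_all
      qed
      show "{S\<in>F. i \<notin> S \<and> agree k i S S0} \<noteq> {}" using S0 by (auto simp: agree_def)
      show "\<alpha> S * \<kappa> \<noteq> 0" if "S \<in> {S\<in>F. i \<notin> S \<and> agree k i S S0}" for S
        using that less.prems(7) w(1) by simp
    qed (use i less.prems(1-4) in simp_all)
    obtain w' \<kappa>' where w': "\<And>S. \<kappa>' S \<noteq> 0" "mset w' = mset_set {Suc i..m}"
      and Dw': "\<And>S. D w' (P S k m) = (if i \<in> S \<and> agree (Suc i) m S T0 then pm_scale (\<kappa>' S) (P S k i) else 0)"
      using D_right[OF less.prems(1) i(1,2) less.prems(3), of T0] by blast
    have "set w' \<subseteq> {1..n}" using arg_cong[OF w'(2), of set_mset] i(2) less.prems(1,3) by auto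
    from U_D[OF this less.prems(8)]
    have "(\<Sum>S\<in>F. pm_scale (\<alpha> S) (D w' (P S k m))) \<in> U" by (simp add: D_sum D_scale)
    also have "(\<Sum>S\<in>F. pm_scale (\<alpha> S) (D w' (P S k m))) =
        (\<Sum>S\<in>{S\<in>F. i \<in> S \<and> agree (Suc i) m S T0}. pm_scale (\<alpha> S * \<kappa>' S) (P S k i))"
      using less.prems(4) by (intro sum.mono_neutral_cong_right) (auto simp: Dw' pm_scale_scale)
    finally have U2: "(\<Sum>S\<in>{S\<in>F. i \<in> S \<and> agree (Suc i) m S T0}. pm_scale (\<alpha> S * \<kappa>' S) (P S k i)) \<in> U" .
    have 2: "\<exists>R. P R k i \<in> U"
    proof (rule less.hyps[OF _ _ _ _ _ _ _ _ U2])
      show "S = T" if "S \<in> {S\<in>F. i \<in> S \<and> agree (Suc i) m S T0}" "T \<in> {S\<in>F. i \<in> S \<and> agree (Suc i) m S T0}"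
        "agree k i S T" for S T
      proof -
        have "agree (Suc i) m S T" using that by (simp add: agree_def)
        then show ?thesis using that by (intro less.prems(6) ivl) simp_all
      qed
      show "{S\<in>F. i \<in> S \<and> agree (Suc i) m S T0} \<noteq> {}" using T0 by (auto simp: agree_def)
      show "\<alpha> S * \<kappa>' S \<noteq> 0" if "S \<in> {S\<in>F. i \<in> S \<and> agree (Suc i) m S T0}" for S
        using that less.prems(7) w'(1) by simp
    qed (use i less.prems(1-4) in simp_all)
    show ?thesis using 1 2 P_glue[OF less.prems(1) i(1,2) less.prems(3)] by blast
  next
    case False
    then obtain S where "F = {S}" using less.prems(5) by blast
    then have "P S k m \<in> U" using less.prems(7,8) U_unscale[of "\<alpha> S" "P S k m"] by simp
    then show ?thesis by blast
  qed
qed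

text \<open>The coefficient hypothesis ensures that some \<open>P S k m\<close> occurs: otherwise
  \<open>c\<close> would lie in \<open>J\<close>, on which this coefficient vanishes.\<close>

theorem psi_in_U:
  assumes "1 \<le> k" "k \<le> m" "m \<le> n" "homog {k..m} c" "Poly_Mapping.lookup c (FW [k..<Suc m]) \<noteq> 0" "c \<in> U"
  shows "\<exists>S\<subseteq>{k..<m}. psi k (sorted_list_of_set S) m \<in> U"
proof -
  obtain \<alpha> where \<alpha>: "c - (\<Sum>S\<in>Pow {k..<m}. pm_scale (\<alpha> S) (P S k m)) \<in> J" (is "c - ?s \<in> J")
    using homog_in_Sp[OF assms(1-4)] by (auto simp: Sp_def)
  let ?F = "{S \<in> Pow {k..<m}. \<alpha> S \<noteq> 0}"
  have s: "?s = (\<Sum>S\<in>?F. pm_scale (\<alpha> S) (P S k m))"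
    by (intro sum.mono_neutral_right) auto
  have "?F \<noteq> {}"
  proof
    assume "?F = {}"
    then have "c \<in> J" using \<alpha> s by simp
    then show False using lookup_J_ascending assms(5) by blast
  qed
  moreover have "c - (c - ?s) \<in> U" using U_diff[OF assms(6) J_U[OF \<alpha>]] .
  then have "(\<Sum>S\<in>?F. pm_scale (\<alpha> S) (P S k m)) \<in> U" using s by simp
  moreover have "S = T" if "S \<in> ?F" "T \<in> ?F" "agree k m S T" for S T
  proof -
    have "S \<subseteq> {k..<m}" "T \<subseteq> {k..<m}" using that by auto
    then show ?thesis using that(3) unfolding agree_def by blast
  qed
  ultimately obtain T where T: "P T k m \<in> U"
    using P_in_U_if_combination[OF assms(1-3), of ?F \<alpha>] by fastforce
  \<comment> \<open>\<open>T\<close> may reach outside \<open>{k..<m}\<close>; the restriction has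
    the same \<open>P\<close> and can be listed in increasing order.\<close>
  let ?S = "T \<inter> {k..<m}"
  let ?l = "sorted_list_of_set ?S"
  have l: "sorted_wrt (<) ?l" "set ?l = ?S" by auto
  have "P ?S k m = P T k m" using assms by (intro P_cong) (auto simp: agree_def)
  then have "P (set ?l) k m \<in> U" using T l by simp
  moreover obtain \<kappa> where "\<kappa> \<noteq> 0" "P (set ?l) k m - pm_scale \<kappa> (psi k ?l m) \<in> J"
    using P_psi[of k m ?l] assms l by auto
  ultimately have "psi k ?l m \<in> U"
    using U_diff[OF _ J_U, of "P (set ?l) k m" "P (set ?l) k m - pm_scale \<kappa> (psi k ?l m)"]
      U_unscale[of \<kappa> "psi k ?l m"] by simp
  then show ?thesis by (intro exI[of _ ?S]) auto
qed

end

section \<open>The Hopf structure of the skew group algebra, computed on representatives\<close>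

section \<open>Tensor squares\<close>

lemmas span_pm_base = Modules.module.span_base[OF pm_scale_module]
  and span_pm_zero = Modules.module.span_zero[OF pm_scale_module]
  and span_pm_add = Modules.module.span_add[OF pm_scale_module]
  and span_pm_diff = Modules.module.span_diff[OF pm_scale_module]
  and span_pm_scale = Modules.module.span_scale[OF pm_scale_module]

lemma tensor_rel_zero: "0 \<in> tensor_rel M"
  and tensor_rel_add: "s \<in> tensor_rel M \<Longrightarrow> t \<in> tensor_rel M \<Longrightarrow> s + t \<in> tensor_rel M"
  and tensor_rel_diff: "s \<in> tensor_rel M \<Longrightarrow> t \<in> tensor_rel M \<Longrightarrow> s - t \<in> tensor_rel M"
  and tensor_rel_scale: "s \<in> tensor_rel M \<Longrightarrow> pm_scale c s \<in> tensor_rel M"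
  unfolding tensor_rel_def by (rule span_pm_zero span_pm_add span_pm_diff span_pm_scale; assumption)+

lemma tensor_rel_add_left: "x \<in> carrier M \<Longrightarrow> y \<in> carrier M \<Longrightarrow> z \<in> carrier M \<Longrightarrow>
    Poly_Mapping.single (x \<oplus>\<^bsub>M\<^esub> y, z) 1 - Poly_Mapping.single (x, z) 1 - Poly_Mapping.single (y, z) 1 \<in> tensor_rel M"
  and tensor_rel_add_right: "x \<in> carrier M \<Longrightarrow> y \<in> carrier M \<Longrightarrow> z \<in> carrier M \<Longrightarrow>
    Poly_Mapping.single (x, y \<oplus>\<^bsub>M\<^esub> z) 1 - Poly_Mapping.single (x, y) 1 - Poly_Mapping.single (x, z) 1 \<in> tensor_rel M"
  and tensor_rel_scale_left: "x \<in> carrier M \<Longrightarrow> y \<in> carrier M \<Longrightarrow>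
    Poly_Mapping.single (a \<odot>\<^bsub>M\<^esub> x, y) 1 - Poly_Mapping.single (x, y) a \<in> tensor_rel M"
  and tensor_rel_scale_right: "x \<in> carrier M \<Longrightarrow> y \<in> carrier M \<Longrightarrow>
    Poly_Mapping.single (x, a \<odot>\<^bsub>M\<^esub> y) 1 - Poly_Mapping.single (x, y) a \<in> tensor_rel M"
  unfolding tensor_rel_def by (rule span_pm_base; blast)+

text \<open>The universal property of the tensor square in relative form: a linear map on pairs that
  is balanced modulo \<open>V\<close> sends every bilinearity relation into
  \<open>V\<close>.\<close>

lemma tensor_rel_linear_image:
  assumes add: "\<And>s t. F (s + t) = F s + F t" and scale: "\<And>c s. F (pm_scale c s) = pm_scale c (F s)"
    and V: "0 \<in> V" "\<And>a b. a \<in> V \<Longrightarrow> b \<in> V \<Longrightarrow> a + b \<in> V" "\<And>c a. a \<in> V \<Longrightarrow> pm_scale c a \<in> V"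
    and 1: "\<And>x y z. x \<in> carrier M \<Longrightarrow> y \<in> carrier M \<Longrightarrow> z \<in> carrier M \<Longrightarrow>
      F (Poly_Mapping.single (x \<oplus>\<^bsub>M\<^esub> y, z) 1 - Poly_Mapping.single (x, z) 1 - Poly_Mapping.single (y, z) 1) \<in> V"
    and 2: "\<And>x y z. x \<in> carrier M \<Longrightarrow> y \<in> carrier M \<Longrightarrow> z \<in> carrier M \<Longrightarrow>
      F (Poly_Mapping.single (x, y \<oplus>\<^bsub>M\<^esub> z) 1 - Poly_Mapping.single (x, y) 1 - Poly_Mapping.single (x, z) 1) \<in> V"
    and 3: "\<And>a x y. x \<in> carrier M \<Longrightarrow> y \<in> carrier M \<Longrightarrow>
      F (Poly_Mapping.single (a \<odot>\<^bsub>M\<^esub> x, y) 1 - Poly_Mapping.single (x, y) a) \<in> V"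
    and 4: "\<And>a x y. x \<in> carrier M \<Longrightarrow> y \<in> carrier M \<Longrightarrow>
      F (Poly_Mapping.single (x, a \<odot>\<^bsub>M\<^esub> y) 1 - Poly_Mapping.single (x, y) a) \<in> V"
    and s: "s \<in> tensor_rel M"
  shows "F s \<in> V"
proof -
  have z: "F 0 = 0" using scale[of 0 0] by simp
  from s show ?thesis
    unfolding tensor_rel_def
  proof (induction rule: Modules.module.span_induct_alt[OF pm_scale_module, consumes 1, case_names base step])
    case base
    show ?case using z V by simp
  next
    case (step c x y)
    have "F x \<in> V" using step(1) 1 2 3 4 by blast
    then show ?case using add scale V step by simp
  qed
qed

lemma tensor_class_in_span_iff:
  "tensor_class M s \<in> tensor_span M Q \<longleftrightarrow> (\<exists>t. Poly_Mapping.keys t \<subseteq> Q \<and> s - t \<in> tensor_rel M)"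
proof
  assume "tensor_class M s \<in> tensor_span M Q"
  then obtain t where t: "tensor_class M s = tensor_class M t" "Poly_Mapping.keys t \<subseteq> Q"
    by (auto simp: tensor_span_def)
  have "s \<in> tensor_class M s" by (simp add: tensor_class_def tensor_rel_zero)
  then show "\<exists>t. Poly_Mapping.keys t \<subseteq> Q \<and> s - t \<in> tensor_rel M"
    using t unfolding tensor_class_def by blast
next
  assume "\<exists>t. Poly_Mapping.keys t \<subseteq> Q \<and> s - t \<in> tensor_rel M"
  then obtain t where t: "Poly_Mapping.keys t \<subseteq> Q" "s - t \<in> tensor_rel M" by blast
  have "r - s \<in> tensor_rel M \<longleftrightarrow> r - t \<in> tensor_rel M" for r
    using tensor_rel_add[OF _ t(2), of "r - s"] tensor_rel_diff[OF _ t(2), of "r - t"] by auto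
  then show "tensor_class M s \<in> tensor_span M Q"
    using t by (auto simp: tensor_span_def tensor_class_def)
qed

lemma tensor_rel_cong:
  "carrier M = carrier N \<Longrightarrow> add M = add N \<Longrightarrow> smult M = smult N \<Longrightarrow> tensor_rel M = tensor_rel N"
  by (simp add: tensor_rel_def)

section \<open>The skew group algebra as a ring\<close>

abbreviation skew_key_mult :: "('g::ab_group_add \<times> nat list) \<Rightarrow> ('g \<times> nat list) \<Rightarrow> ('g \<times> nat list)" where
  "skew_key_mult x y \<equiv> (fst x + fst y, snd x @ snd y)"

lemma skew_mult_twist: "skew_mult \<chi> = twist skew_key_mult (\<lambda>x y. chi_word \<chi> (snd x) (fst y))"
  by (intro ext) (simp add: skew_mult_def twist_def split_def)

abbreviation pair_key_mult where
  "pair_key_mult \<chi> x y \<equiv> (skew_mult \<chi> (fst x) (fst y), skew_mult \<chi> (snd x) (snd y))"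

lemma pair_mult_twist: "pair_mult \<chi> = twist (pair_key_mult \<chi>) (\<lambda>x y. 1)"
  by (intro ext) (simp add: pair_mult_def twist_def split_def)

lemma skew_mult_single: "skew_mult \<chi> (Poly_Mapping.single (g, u) c) (Poly_Mapping.single (h, v) d) =
    Poly_Mapping.single (g + h, u @ v) (c * d * chi_word \<chi> u h)"
  by (simp add: skew_mult_twist twist_single)

lemma pair_mult_single: "pair_mult \<chi> (Poly_Mapping.single (a, b) c) (Poly_Mapping.single (a', b') d) =
    Poly_Mapping.single (skew_mult \<chi> a a', skew_mult \<chi> b b') (c * d)"
  by (simp add: pair_mult_twist twist_single)

lemma skew_mult_linear:
  "skew_mult \<chi> (a + a') b = skew_mult \<chi> a b + skew_mult \<chi> a' b"
  "skew_mult \<chi> (a - a') b = skew_mult \<chi> a b - skew_mult \<chi> a' b"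
  "skew_mult \<chi> (- a) b = - skew_mult \<chi> a b"
  "skew_mult \<chi> (pm_scale c a) b = pm_scale c (skew_mult \<chi> a b)"
  "skew_mult \<chi> 0 b = 0"
  "skew_mult \<chi> b (a + a') = skew_mult \<chi> b a + skew_mult \<chi> b a'"
  "skew_mult \<chi> b (a - a') = skew_mult \<chi> b a - skew_mult \<chi> b a'"
  "skew_mult \<chi> b (- a) = - skew_mult \<chi> b a"
  "skew_mult \<chi> b (pm_scale c a) = pm_scale c (skew_mult \<chi> b a)"
  "skew_mult \<chi> b 0 = 0"
  by (simp_all add: skew_mult_twist twist_add_left twist_diff_left twist_uminus_left twist_scale_left
      twist_zero_left twist_add_right twist_diff_right twist_uminus_right twist_scale_right twist_zero_right)

lemma pair_mult_linear:
  "pair_mult \<chi> (s + s') t = pair_mult \<chi> s t + pair_mult \<chi> s' t"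
  "pair_mult \<chi> (s - s') t = pair_mult \<chi> s t - pair_mult \<chi> s' t"
  "pair_mult \<chi> (pm_scale c s) t = pm_scale c (pair_mult \<chi> s t)"
  "pair_mult \<chi> t (s + s') = pair_mult \<chi> t s + pair_mult \<chi> t s'"
  "pair_mult \<chi> t (s - s') = pair_mult \<chi> t s - pair_mult \<chi> t s'"
  "pair_mult \<chi> t (pm_scale c s) = pm_scale c (pair_mult \<chi> t s)"
  by (simp_all add: pair_mult_twist twist_add_left twist_diff_left twist_scale_left
      twist_add_right twist_diff_right twist_scale_right)

lemma pair_mult_lin_left: "pair_mult \<chi> (lin h a) b = lin (\<lambda>x. pair_mult \<chi> (h x) b) a"
  and pair_mult_lin_right: "pair_mult \<chi> b (lin h a) = lin (\<lambda>x. pair_mult \<chi> b (h x)) a"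
  by (simp_all add: pair_mult_twist twist_lin_left twist_lin_right)

lemma skew_mult_lin_left: "skew_mult \<chi> (lin h a) b = lin (\<lambda>x. skew_mult \<chi> (h x) b) a"
  and skew_mult_lin_right: "skew_mult \<chi> b (lin h a) = lin (\<lambda>x. skew_mult \<chi> b (h x)) a"
  by (simp_all add: skew_mult_twist twist_lin_left twist_lin_right)

locale skew_group_algebra =
  fixes n :: nat and \<chi> :: "nat \<Rightarrow> 'g::ab_group_add \<Rightarrow> 'k::field" and gs :: "nat \<Rightarrow> 'g"
  assumes chi_add: "i \<in> {1..n} \<Longrightarrow> \<chi> i (g + h) = \<chi> i g * \<chi> i h"
    and chi_nz: "i \<in> {1..n} \<Longrightarrow> \<chi> i g \<noteq> 0"
begin

abbreviation H :: "('k, ('g, 'k) skew) hopf_algebra" where "H \<equiv> skew_hopf n \<chi> gs"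
abbreviation mul (infixl "\<star>" 70) where "a \<star> b \<equiv> skew_mult \<chi> a b"
abbreviation pmul (infixl "\<star>\<star>" 70) where "s \<star>\<star> t \<equiv> pair_mult \<chi> s t"
abbreviation x :: "nat \<Rightarrow> ('g, 'k) skew" where "x i \<equiv> skew_var i"
abbreviation grp :: "'g \<Rightarrow> ('g, 'k) skew" where "grp g \<equiv> skew_grp g"

definition C :: "('g, 'k) skew set" where
  "C = {a. \<forall>y\<in>Poly_Mapping.keys a. set (snd y) \<subseteq> {1..n}}"

definition \<Delta> :: "('g, 'k) skew \<Rightarrow> ((('g, 'k) skew \<times> ('g, 'k) skew) \<Rightarrow>\<^sub>0 'k)" where
  "\<Delta> = lin (\<lambda>(g, w). Poly_Mapping.single (grp g, grp g) 1 \<star>\<star> comult_word \<chi> gs w)"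

definition S :: "('g, 'k) skew \<Rightarrow> ('g, 'k) skew" where
  "S = lin (\<lambda>(g, w). antipode_word \<chi> gs w \<star> grp (- g))"

lemma skew_algebra_simps:
  "carrier (skew_algebra n \<chi>) = C" "monoid.mult (skew_algebra n \<chi>) = skew_mult \<chi>"
  "one (skew_algebra n \<chi>) = grp 0" "zero (skew_algebra n \<chi>) = 0" "add (skew_algebra n \<chi>) = (+)"
  "smult (skew_algebra n \<chi>) = pm_scale"
  by (simp_all add: skew_algebra_def C_def split_def)

lemma H_simps:
  "carrier H = C" "monoid.mult H = skew_mult \<chi>"
  "one H = grp 0" "zero H = 0" "add H = (+)"
  "smult H = pm_scale" "comult H a = tensor_class (skew_algebra n \<chi>) (\<Delta> a)" "antipode H = S"
  using skew_algebra_simps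
  by (simp_all add: skew_hopf_def module.extend_def hopf_algebra.fields_def \<Delta>_def S_def)

lemma counit_H: "counit H a = (\<Sum>(g, w)\<in>Poly_Mapping.keys a. if w = [] then Poly_Mapping.lookup a (g, w) else 0)"
  by (simp add: skew_hopf_def module.extend_def hopf_algebra.fields_def)

lemma chi_zero: "i \<in> {1..n} \<Longrightarrow> \<chi> i 0 = 1"
  using chi_add[of i 0 0] chi_nz[of i 0] by simp

lemma chi_uminus: "i \<in> {1..n} \<Longrightarrow> \<chi> i (- g) = inverse (\<chi> i g)"
  using chi_add[of i g "- g"] chi_zero[of i] by (simp add: inverse_unique)

lemma chi_word_append: "chi_word \<chi> (u @ v) g = chi_word \<chi> u g * chi_word \<chi> v g"
  by (simp add: chi_word_def)

lemma chi_word_Nil [simp]: "chi_word \<chi> [] g = 1"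
  and chi_word_Cons: "chi_word \<chi> (i # w) g = \<chi> i g * chi_word \<chi> w g"
  by (simp_all add: chi_word_def)

lemma chi_word_zero: "set u \<subseteq> {1..n} \<Longrightarrow> chi_word \<chi> u 0 = 1"
  by (induction u) (auto simp: chi_word_Cons chi_zero)

lemma chi_word_add: "set u \<subseteq> {1..n} \<Longrightarrow> chi_word \<chi> u (g + h) = chi_word \<chi> u g * chi_word \<chi> u h"
  by (induction u) (auto simp: chi_word_Cons chi_add)

lemma C_keys: "a \<in> C \<Longrightarrow> (g, w) \<in> Poly_Mapping.keys a \<Longrightarrow> set w \<subseteq> {1..n}"
  by (force simp: C_def)

lemma C_zero: "0 \<in> C"
  and C_add: "a \<in> C \<Longrightarrow> b \<in> C \<Longrightarrow> a + b \<in> C"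
  and C_scale: "a \<in> C \<Longrightarrow> pm_scale c a \<in> C"
  using keys_add[of a b] keys_pm_scale[of c a] by (auto simp: C_def)

lemma C_uminus: "a \<in> C \<Longrightarrow> - a \<in> C"
  by (simp add: C_def in_keys_iff)

lemma C_mult: "a \<in> C \<Longrightarrow> b \<in> C \<Longrightarrow> a \<star> b \<in> C"
  unfolding C_def skew_mult_twist using keys_twist by fastforce

lemma C_grp: "grp g \<in> C"
  by (simp add: C_def skew_grp_def)

lemma C_x: "i \<in> {1..n} \<Longrightarrow> x i \<in> C"
  by (simp add: C_def skew_var_def)

lemma C_single: "set w \<subseteq> {1..n} \<Longrightarrow> Poly_Mapping.single (g, w) c \<in> C"
  by (simp add: C_def)

lemma mul_assoc: "a \<in> C \<Longrightarrow> b \<in> C \<Longrightarrow> c \<in> C \<Longrightarrow> (a \<star> b) \<star> c = a \<star> (b \<star> c)"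
  unfolding skew_mult_twist
  by (rule twist_assoc[where C = "{y. set (snd y) \<subseteq> {1..n}}"])
    (auto simp: C_def chi_word_append chi_word_add add.assoc mult_ac)

lemma grp_zero_mul [simp]: "grp 0 \<star> a = a"
proof -
  have "grp 0 \<star> lin (\<lambda>y. Poly_Mapping.single y 1) a = lin (\<lambda>y. Poly_Mapping.single y 1) a"
    unfolding skew_mult_lin_right by (intro lin_cong) (auto simp: skew_grp_def skew_mult_single)
  then show ?thesis by (simp add: lin_single_id)
qed

lemma mul_grp_zero [simp]: "a \<in> C \<Longrightarrow> a \<star> grp 0 = a"
proof -
  assume a: "a \<in> C"
  have "lin (\<lambda>y. Poly_Mapping.single y 1) a \<star> grp 0 = lin (\<lambda>y. Poly_Mapping.single y 1) a"
    unfolding skew_mult_lin_left using a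
    by (intro lin_cong) (auto simp: skew_grp_def skew_mult_single C_def chi_word_zero)
  then show ?thesis by (simp add: lin_single_id)
qed

lemma grp_mul_grp: "grp g \<star> grp h = grp (g + h)"
  by (simp add: skew_grp_def skew_mult_single)

lemma x_mul_grp: "x i \<star> grp g = pm_scale (\<chi> i g) (grp g \<star> x i)"
  by (simp add: skew_grp_def skew_var_def skew_mult_single pm_scale_single chi_word_def)

lemma ring_H: "ring H"
proof (intro ringI abelian_groupI monoidI)
  show "\<exists>y\<in>carrier H. y \<oplus>\<^bsub>H\<^esub> a = \<zero>\<^bsub>H\<^esub>" if "a \<in> carrier H" for a
    using that C_uminus[of a] by (auto simp: H_simps intro: bexI[of _ "- a"])
qed (auto simp: H_simps C_zero C_add C_mult C_grp mul_assoc skew_mult_linear add_ac)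

lemma ideal_H_iff: "ideal I H \<longleftrightarrow> I \<subseteq> C \<and> 0 \<in> I \<and> (\<forall>a\<in>I. \<forall>b\<in>I. a + b \<in> I) \<and>
    (\<forall>a\<in>I. \<forall>c\<in>C. c \<star> a \<in> I \<and> a \<star> c \<in> I)"
proof
  assume "ideal I H"
  then interpret ideal I H .
  show "I \<subseteq> C \<and> 0 \<in> I \<and> (\<forall>a\<in>I. \<forall>b\<in>I. a + b \<in> I) \<and> (\<forall>a\<in>I. \<forall>c\<in>C. c \<star> a \<in> I \<and> a \<star> c \<in> I)"
    using a_subset additive_subgroup.zero_closed[OF is_additive_subgroup]
      additive_subgroup.a_closed[OF is_additive_subgroup] I_l_closed I_r_closed by (auto simp: H_simps)
next
  assume I: "I \<subseteq> C \<and> 0 \<in> I \<and> (\<forall>a\<in>I. \<forall>b\<in>I. a + b \<in> I) \<and> (\<forall>a\<in>I. \<forall>c\<in>C. c \<star> a \<in> I \<and> a \<star> c \<in> I)"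
  interpret ring H by (rule ring_H)
  have neg: "- a \<in> I" if "a \<in> I" for a
  proof -
    \<comment> \<open>Negatives come from absorption, since minus the unit lies in
      \<open>C\<close>.\<close>
    have "pm_scale (-1) (grp 0) \<star> a \<in> I" using I that C_scale[OF C_grp] by blast
    then show ?thesis by (simp add: skew_mult_linear pm_scale_minus_left)
  qed
  show "ideal I H"
  proof (rule idealI[OF ring_H])
    show "subgroup I (add_monoid H)"
    proof (rule add.subgroupI)
      show "\<ominus>\<^bsub>H\<^esub> a \<in> I" if "a \<in> I" for a
      proof -
        have "\<ominus>\<^bsub>H\<^esub> a = - a"
          using that I C_uminus[of a] by (intro minus_equality) (auto simp: H_simps)
        then show ?thesis using neg that by simp
      qed
    qed (use I in \<open>auto simp: H_simps\<close>)
  qed (use I in \<open>auto simp: H_simps\<close>)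
qed

lemma ideal_H_scale: "ideal I H \<Longrightarrow> a \<in> I \<Longrightarrow> pm_scale c a \<in> I"
proof -
  assume I: "ideal I H" "a \<in> I"
  then have "pm_scale c (grp 0) \<star> a \<in> I" using C_scale[OF C_grp] by (auto simp: ideal_H_iff)
  then show ?thesis by (simp add: skew_mult_linear)
qed

lemma ideal_H_diff: "ideal I H \<Longrightarrow> a \<in> I \<Longrightarrow> b \<in> I \<Longrightarrow> a - b \<in> I"
  using ideal_H_scale[of I b "-1"] by (auto simp: ideal_H_iff pm_scale_minus_left)

section \<open>Multiplicativity of the comultiplication\<close>

abbreviation R where "R \<equiv> tensor_rel (skew_algebra n \<chi>)"

lemma tensor_rel_H: "tensor_rel H = R"
  by (rule tensor_rel_cong) (simp_all add: H_simps skew_algebra_simps)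

lemmas R_add_left = tensor_rel_add_left[of _ "skew_algebra n \<chi>", unfolded skew_algebra_simps]
  and R_add_right = tensor_rel_add_right[of _ "skew_algebra n \<chi>", unfolded skew_algebra_simps]
  and R_scale_left = tensor_rel_scale_left[of _ "skew_algebra n \<chi>", unfolded skew_algebra_simps]
  and R_scale_right = tensor_rel_scale_right[of _ "skew_algebra n \<chi>", unfolded skew_algebra_simps]

definition CC where "CC = {s. Poly_Mapping.keys s \<subseteq> C \<times> C}"

lemma CC_add: "s \<in> CC \<Longrightarrow> t \<in> CC \<Longrightarrow> s + t \<in> CC"
  and CC_zero: "0 \<in> CC"
  and CC_scale: "s \<in> CC \<Longrightarrow> pm_scale c s \<in> CC"
  and CC_single: "a \<in> C \<Longrightarrow> b \<in> C \<Longrightarrow> Poly_Mapping.single (a, b) c \<in> CC"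
  using keys_add[of s t] keys_pm_scale[of c s] by (auto simp: CC_def)

lemma CC_mult: "s \<in> CC \<Longrightarrow> t \<in> CC \<Longrightarrow> s \<star>\<star> t \<in> CC"
  unfolding CC_def pair_mult_twist using keys_twist[of "pair_key_mult \<chi>" "\<lambda>x y. 1" s t] C_mult by fastforce

lemma pmul_assoc: "s \<in> CC \<Longrightarrow> t \<in> CC \<Longrightarrow> r \<in> CC \<Longrightarrow> (s \<star>\<star> t) \<star>\<star> r = s \<star>\<star> (t \<star>\<star> r)"
  unfolding pair_mult_twist
  by (rule twist_assoc[where C = "C \<times> C"]) (auto simp: CC_def mul_assoc)

text \<open>Multiplication by a fixed pair carries each bilinearity relation to another one. With
  the left-hand version, \<open>R\<close> behaves like a two-sided ideal for
  \<open>\<star>\<star>\<close>, so products may be computed on representatives.\<close>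

lemma R_mult_right:
  assumes "s \<in> R" "t \<in> CC"
  shows "s \<star>\<star> t \<in> R"
proof -
  have "s \<star>\<star> Poly_Mapping.single (c, d) 1 \<in> R" if "c \<in> C" "d \<in> C" for c d
    by (rule tensor_rel_linear_image[OF _ _ tensor_rel_zero tensor_rel_add tensor_rel_scale _ _ _ _ assms(1)])
      (auto simp: skew_algebra_simps pair_mult_linear pair_mult_single skew_mult_linear that
        intro!: R_add_left R_add_right R_scale_left R_scale_right C_mult)
  then have "lin (\<lambda>y. s \<star>\<star> Poly_Mapping.single y 1) t \<in> R"
    using assms(2) by (intro lin_mem tensor_rel_zero tensor_rel_add tensor_rel_scale) (auto simp: CC_def)
  then show ?thesis by (simp add: pair_mult_lin_right[symmetric] lin_single_id)
qed

lemma R_mult_left: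
  assumes "s \<in> R" "t \<in> CC"
  shows "t \<star>\<star> s \<in> R"
proof -
  have "Poly_Mapping.single (c, d) 1 \<star>\<star> s \<in> R" if "c \<in> C" "d \<in> C" for c d
    by (rule tensor_rel_linear_image[OF _ _ tensor_rel_zero tensor_rel_add tensor_rel_scale _ _ _ _ assms(1)])
      (auto simp: skew_algebra_simps pair_mult_linear pair_mult_single skew_mult_linear that
        intro!: R_add_left R_add_right R_scale_left R_scale_right C_mult)
  then have "lin (\<lambda>y. Poly_Mapping.single y 1 \<star>\<star> s) t \<in> R"
    using assms(2) by (intro lin_mem tensor_rel_zero tensor_rel_add tensor_rel_scale) (auto simp: CC_def)
  then show ?thesis by (simp add: pair_mult_lin_left[symmetric] lin_single_id)
qed

end

context skew_group_algebra
begin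

abbreviation cw where "cw w \<equiv> comult_word \<chi> gs w"
abbreviation GG :: "'g \<Rightarrow> _" where "GG g \<equiv> Poly_Mapping.single (grp g, grp g) (1::'k)"
abbreviation xx where
  "xx i \<equiv> Poly_Mapping.single (x i, grp 0) (1::'k) + Poly_Mapping.single (grp (gs i), x i) 1"

lemma CC_GG: "GG g \<in> CC"
  by (intro CC_single C_grp)

lemma CC_xx: "i \<in> {1..n} \<Longrightarrow> xx i \<in> CC"
  by (intro CC_add CC_single C_grp C_x)

lemma CC_cw: "set w \<subseteq> {1..n} \<Longrightarrow> cw w \<in> CC"
  by (induction w) (auto intro!: CC_mult CC_xx CC_GG simp del: atLeastAtMost_iff)

lemma GG_zero_mul [simp]: "GG 0 \<star>\<star> s = s"
proof -
  have "GG 0 \<star>\<star> lin (\<lambda>y. Poly_Mapping.single y 1) s = lin (\<lambda>y. Poly_Mapping.single y 1) s"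
    unfolding pair_mult_lin_right by (intro lin_cong) (auto simp: pair_mult_single)
  then show ?thesis by (simp add: lin_single_id)
qed

lemma mul_GG_zero [simp]: "s \<in> CC \<Longrightarrow> s \<star>\<star> GG 0 = s"
proof -
  assume s: "s \<in> CC"
  have "lin (\<lambda>y. Poly_Mapping.single y 1) s \<star>\<star> GG 0 = lin (\<lambda>y. Poly_Mapping.single y 1) s"
    unfolding pair_mult_lin_left using s
    by (intro lin_cong) (auto simp: pair_mult_single CC_def)
  then show ?thesis by (simp add: lin_single_id)
qed

lemma GG_mul_GG: "GG g \<star>\<star> GG h = GG (g + h)"
  by (simp add: pair_mult_single grp_mul_grp)

lemma \<Delta>_single: "\<Delta> (Poly_Mapping.single (g, w) c) = pm_scale c (GG g \<star>\<star> cw w)"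
  by (simp add: \<Delta>_def lin_single)

lemma \<Delta>_add: "\<Delta> (a + b) = \<Delta> a + \<Delta> b"
  and \<Delta>_diff: "\<Delta> (a - b) = \<Delta> a - \<Delta> b"
  and \<Delta>_scale: "\<Delta> (pm_scale c a) = pm_scale c (\<Delta> a)"
  and \<Delta>_lin: "\<Delta> (lin f d) = lin (\<lambda>y. \<Delta> (f y)) d"
  by (simp_all add: \<Delta>_def lin_add lin_diff lin_scale lin_lin)

lemma \<Delta>_zero [simp]: "\<Delta> 0 = 0"
  by (simp add: \<Delta>_def)

lemma CC_\<Delta>: "a \<in> C \<Longrightarrow> \<Delta> a \<in> CC"
  unfolding \<Delta>_def
  by (rule lin_mem) (auto simp: CC_zero simp del: atLeastAtMost_iff dest: C_keys intro!: CC_add CC_scale CC_mult CC_GG CC_cw)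

lemma cw_append: "set u \<subseteq> {1..n} \<Longrightarrow> set v \<subseteq> {1..n} \<Longrightarrow> cw (u @ v) = cw u \<star>\<star> cw v"
proof (induction u)
  case (Cons i u)
  then have "xx i \<in> CC" "cw u \<in> CC" "cw v \<in> CC" by (auto intro!: CC_xx CC_cw simp del: atLeastAtMost_iff)
  then show ?case using Cons by (simp add: pmul_assoc)
qed simp

text \<open>The scalar from moving x_i past h sits inside one tensor factor of a pair; taking it out
  is a bilinearity relation, hence the equality only modulo \<open>R\<close>.\<close>

lemma xx_mul_GG: "i \<in> {1..n} \<Longrightarrow> xx i \<star>\<star> GG h - pm_scale (\<chi> i h) (GG h \<star>\<star> xx i) \<in> R"
proof -
  assume i: "i \<in> {1..n}"
  have 1: "Poly_Mapping.single (pm_scale (\<chi> i h) (grp h \<star> x i), grp h) 1 - Poly_Mapping.single (grp h \<star> x i, grp h) (\<chi> i h) \<in> R"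
    using i by (intro R_scale_left C_mult C_grp C_x)
  have 2: "Poly_Mapping.single (grp (h + gs i), pm_scale (\<chi> i h) (grp h \<star> x i)) 1 - Poly_Mapping.single (grp (h + gs i), grp h \<star> x i) (\<chi> i h) \<in> R"
    using i by (intro R_scale_right C_mult C_grp C_x)
  have "xx i \<star>\<star> GG h - pm_scale (\<chi> i h) (GG h \<star>\<star> xx i) =
     (Poly_Mapping.single (pm_scale (\<chi> i h) (grp h \<star> x i), grp h) 1 - Poly_Mapping.single (grp h \<star> x i, grp h) (\<chi> i h))
     + (Poly_Mapping.single (grp (h + gs i), pm_scale (\<chi> i h) (grp h \<star> x i)) 1 - Poly_Mapping.single (grp (h + gs i), grp h \<star> x i) (\<chi> i h))"
    by (simp add: pair_mult_linear pair_mult_single x_mul_grp grp_mul_grp C_grp pm_scale_add pm_scale_single add.commute[of h])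
  then show ?thesis using tensor_rel_add[OF 1 2] by simp
qed

lemma cw_mul_GG: "set u \<subseteq> {1..n} \<Longrightarrow> cw u \<star>\<star> GG h - pm_scale (chi_word \<chi> u h) (GG h \<star>\<star> cw u) \<in> R"
proof (induction u)
  case Nil
  show ?case by (simp add: CC_GG tensor_rel_zero)
next
  case (Cons i u)
  then have i: "i \<in> {1..n}" and u: "set u \<subseteq> {1..n}" by auto
  let ?c = "chi_word \<chi> u h"
  have CC: "xx i \<in> CC" "cw u \<in> CC" "GG h \<in> CC" by (rule CC_xx[OF i] CC_cw[OF u] CC_GG)+
  have "xx i \<star>\<star> (cw u \<star>\<star> GG h - pm_scale ?c (GG h \<star>\<star> cw u)) \<in> R"
    using Cons.IH[OF u] CC(1) by (rule R_mult_left)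
  moreover have "pm_scale ?c ((xx i \<star>\<star> GG h - pm_scale (\<chi> i h) (GG h \<star>\<star> xx i)) \<star>\<star> cw u) \<in> R"
    using xx_mul_GG[OF i] CC(2) by (intro tensor_rel_scale R_mult_right)
  ultimately have "xx i \<star>\<star> (cw u \<star>\<star> GG h - pm_scale ?c (GG h \<star>\<star> cw u))
     + pm_scale ?c ((xx i \<star>\<star> GG h - pm_scale (\<chi> i h) (GG h \<star>\<star> xx i)) \<star>\<star> cw u) \<in> R" by (rule tensor_rel_add)
  moreover have "X \<star>\<star> (cw u \<star>\<star> GG h - pm_scale ?c (GG h \<star>\<star> cw u))
     + pm_scale ?c ((X \<star>\<star> GG h - pm_scale (\<chi> i h) (GG h \<star>\<star> X)) \<star>\<star> cw u)
     = (X \<star>\<star> cw u) \<star>\<star> GG h - pm_scale (\<chi> i h * ?c) (GG h \<star>\<star> (X \<star>\<star> cw u))" if "X \<in> CC" for X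
    using that CC by (simp add: pmul_assoc pair_mult_linear(2,3,5,6) pm_scale_diff pm_scale_scale mult.commute)
  ultimately show ?case using CC(1) by (simp add: chi_word_Cons)
qed

text \<open>On basis elements \<open>(g, u)\<close> and \<open>(h, v)\<close> the only discrepancy
  is that h must be moved past the coproduct of \<open>u\<close>, which \<open>cw_mul_GG\<close>
  does modulo \<open>R\<close>; bilinearity gives the rest.\<close>

lemma \<Delta>_mult: "a \<in> C \<Longrightarrow> b \<in> C \<Longrightarrow> \<Delta> (a \<star> b) - \<Delta> a \<star>\<star> \<Delta> b \<in> R"
proof -
  assume ab: "a \<in> C" "b \<in> C"
  let ?s = "\<lambda>y. Poly_Mapping.single y (1::'k)"
  have basis: "\<Delta> (?s y \<star> ?s z) - \<Delta> (?s y) \<star>\<star> \<Delta> (?s z) \<in> R"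
    if "set (snd y) \<subseteq> {1..n}" "set (snd z) \<subseteq> {1..n}" for y z
  proof -
    obtain g u h v where yz: "y = (g, u)" "z = (h, v)" by (metis prod.collapse)
    have u: "set u \<subseteq> {1..n}" and v: "set v \<subseteq> {1..n}" using that yz by auto
    let ?c = "chi_word \<chi> u h"
    have CC: "GG g \<in> CC" "cw u \<in> CC" "GG h \<in> CC" "cw v \<in> CC"
      by (rule CC_cw[OF u] CC_cw[OF v] CC_GG)+
    have "pm_scale (-1) (GG g \<star>\<star> ((cw u \<star>\<star> GG h - pm_scale ?c (GG h \<star>\<star> cw u)) \<star>\<star> cw v)) \<in> R"
      using cw_mul_GG[OF u] CC by (intro tensor_rel_scale R_mult_left R_mult_right)
    moreover have "pm_scale (-1) (GG g \<star>\<star> ((cw u \<star>\<star> GG h - pm_scale ?c (GG h \<star>\<star> cw u)) \<star>\<star> cw v)) =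
        pm_scale ?c ((GG g \<star>\<star> GG h) \<star>\<star> (cw u \<star>\<star> cw v)) - (GG g \<star>\<star> cw u) \<star>\<star> (GG h \<star>\<star> cw v)"
      using CC by (simp only: pmul_assoc pair_mult_linear(2,3,5,6) pm_scale_diff pm_scale_scale CC_mult)
        (simp add: pm_scale_minus_left)
    ultimately show ?thesis
      unfolding yz skew_mult_single \<Delta>_single GG_mul_GG by (simp add: cw_append[OF u v])
  qed
  have eq: "\<Delta> (a \<star> b) - \<Delta> a \<star>\<star> \<Delta> b = lin (\<lambda>y. lin (\<lambda>z. \<Delta> (?s y \<star> ?s z) - \<Delta> (?s y) \<star>\<star> \<Delta> (?s z)) b) a"
  proof -
    have "\<Delta> (lin ?s a \<star> lin ?s b) + pm_scale (-1) (\<Delta> (lin ?s a) \<star>\<star> \<Delta> (lin ?s b)) =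
        lin (\<lambda>y. lin (\<lambda>z. \<Delta> (?s y \<star> ?s z) + pm_scale (-1) (\<Delta> (?s y) \<star>\<star> \<Delta> (?s z))) b) a"
      unfolding lin_fun_add lin_fun_scale
      by (simp only: skew_mult_lin_left skew_mult_lin_right \<Delta>_lin pair_mult_lin_left pair_mult_lin_right lin_swap[of _ b])
    then show ?thesis by (simp add: lin_single_id pm_scale_minus_left)
  qed
  show ?thesis
    unfolding eq
    by (rule lin_mem[OF tensor_rel_zero tensor_rel_add tensor_rel_scale], assumption+,
        rule lin_mem[OF tensor_rel_zero tensor_rel_add tensor_rel_scale], assumption+, rule basis)
      (use ab in \<open>auto simp: C_def\<close>)
qed

section \<open>Anti-multiplicativity of the antipode\<close>

abbreviation aw where "aw w \<equiv> antipode_word \<chi> gs w"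

lemma C_aw: "set w \<subseteq> {1..n} \<Longrightarrow> aw w \<in> C"
  by (induction w) (auto intro!: C_mult C_grp C_x C_uminus simp del: atLeastAtMost_iff)

lemma aw_append: "set u \<subseteq> {1..n} \<Longrightarrow> set v \<subseteq> {1..n} \<Longrightarrow> aw (u @ v) = aw v \<star> aw u"
proof (induction u)
  case (Cons i u)
  then have "aw u \<in> C" "aw v \<in> C" "- (grp (- gs i) \<star> x i) \<in> C"
    by (auto intro!: C_aw C_uminus C_mult C_grp C_x simp del: atLeastAtMost_iff)
  then show ?case using Cons by (simp add: mul_assoc)
qed (simp add: C_aw)

lemma aw_mul_grp: "set u \<subseteq> {1..n} \<Longrightarrow> aw u \<star> grp h = pm_scale (chi_word \<chi> u h) (grp h \<star> aw u)"
proof (induction u)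
  case Nil
  show ?case by (simp add: C_grp)
next
  case (Cons i u)
  then have i: "i \<in> {1..n}" and u: "set u \<subseteq> {1..n}" by auto
  let ?y = "grp (- gs i) \<star> x i"
  have C: "aw u \<in> C" "?y \<in> C" "grp h \<in> C" "grp (- gs i) \<in> C" "x i \<in> C" using C_aw[OF u] C_mult[OF C_grp C_x[OF i]] C_grp C_x[OF i] by auto
  have y: "?y \<star> grp h = pm_scale (\<chi> i h) (grp h \<star> ?y)"
    using C by (simp add: mul_assoc x_mul_grp skew_mult_linear mul_assoc[symmetric] grp_mul_grp add.commute)
  have "(aw u \<star> ?y) \<star> grp h = pm_scale (\<chi> i h) ((aw u \<star> grp h) \<star> ?y)"
    using C y by (simp add: mul_assoc skew_mult_linear)
  also have "\<dots> = pm_scale (\<chi> i h * chi_word \<chi> u h) (grp h \<star> (aw u \<star> ?y))"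
    using C Cons.IH[OF u] by (simp add: mul_assoc skew_mult_linear pm_scale_scale)
  finally show ?case by (simp add: skew_mult_linear chi_word_Cons pm_scale_uminus)
qed

lemma S_single: "S (Poly_Mapping.single (g, w) c) = pm_scale c (aw w \<star> grp (- g))"
  by (simp add: S_def lin_single)

lemma S_add: "S (a + b) = S a + S b"
  and S_diff: "S (a - b) = S a - S b"
  and S_zero [simp]: "S 0 = 0"
  and S_lin: "S (lin f a) = lin (\<lambda>y. S (f y)) a"
  by (simp_all add: S_def lin_add lin_diff lin_lin)

lemma C_S: "a \<in> C \<Longrightarrow> S a \<in> C"
  unfolding S_def
  by (rule lin_mem) (auto simp: C_zero simp del: atLeastAtMost_iff dest: C_keys intro!: C_add C_scale C_mult C_grp C_aw)

lemma S_mult: "a \<in> C \<Longrightarrow> b \<in> C \<Longrightarrow> S (a \<star> b) = S b \<star> S a"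
proof -
  assume ab: "a \<in> C" "b \<in> C"
  let ?s = "\<lambda>y. Poly_Mapping.single y (1::'k)"
  have basis: "S (?s y \<star> ?s z) = S (?s z) \<star> S (?s y)"
    if "set (snd y) \<subseteq> {1..n}" "set (snd z) \<subseteq> {1..n}" for y z
  proof -
    obtain g u h v where yz: "y = (g, u)" "z = (h, v)" by (metis prod.collapse)
    have u: "set u \<subseteq> {1..n}" and v: "set v \<subseteq> {1..n}" using that yz by auto
    have C: "aw u \<in> C" "aw v \<in> C" "grp (- h) \<in> C" "grp (- g) \<in> C" by (rule C_aw[OF u] C_aw[OF v] C_grp)+
    have c: "chi_word \<chi> u h * chi_word \<chi> u (- h) = 1"
      using chi_word_add[OF u, of h "- h"] chi_word_zero[OF u] by simp
    have "aw u \<star> grp (- h) = pm_scale (chi_word \<chi> u (- h)) (grp (- h) \<star> aw u)"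
      by (rule aw_mul_grp[OF u])
    then have hu: "grp (- h) \<star> aw u = pm_scale (chi_word \<chi> u h) (aw u \<star> grp (- h))"
      using c by (simp add: pm_scale_scale)
    have "(aw v \<star> grp (- h)) \<star> (aw u \<star> grp (- g)) = aw v \<star> ((grp (- h) \<star> aw u) \<star> grp (- g))"
      using C by (simp add: mul_assoc C_mult)
    also have "\<dots> = pm_scale (chi_word \<chi> u h) (aw v \<star> (aw u \<star> (grp (- h) \<star> grp (- g))))"
      using C unfolding hu by (simp add: mul_assoc skew_mult_linear)
    also have "\<dots> = pm_scale (chi_word \<chi> u h) ((aw v \<star> aw u) \<star> grp (- (g + h)))"
      using C by (simp only: mul_assoc grp_mul_grp C_grp minus_add)
    finally show ?thesis
      unfolding yz skew_mult_single S_single by (simp add: aw_append[OF u v])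
  qed
  have "S (lin ?s a \<star> lin ?s b) = lin (\<lambda>y. lin (\<lambda>z. S (?s y \<star> ?s z)) b) a"
    by (simp only: skew_mult_lin_left skew_mult_lin_right S_lin) (rule lin_swap)
  also have "\<dots> = lin (\<lambda>y. lin (\<lambda>z. S (?s z) \<star> S (?s y)) b) a"
    by (intro lin_cong basis) (use ab in \<open>auto simp: C_def\<close>)
  also have "\<dots> = S (lin ?s b) \<star> S (lin ?s a)"
    by (simp only: skew_mult_lin_left skew_mult_lin_right S_lin lin_swap[of _ b])
  finally show ?thesis by (simp add: lin_single_id)
qed

section \<open>Ideals generated by coideal elements\<close>

text \<open>Representatives of the elements of I \<otimes> C + C \<otimes> I.\<close>

definition coideal_pairs :: "('g, 'k) skew set \<Rightarrow> ((('g, 'k) skew \<times> ('g, 'k) skew) \<Rightarrow>\<^sub>0 'k) set" where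
  "coideal_pairs I = {s. \<exists>t. Poly_Mapping.keys t \<subseteq> I \<times> C \<union> C \<times> I \<and> s - t \<in> R}"

lemma coideal_pairs_mono: "I \<subseteq> I' \<Longrightarrow> coideal_pairs I \<subseteq> coideal_pairs I'"
  unfolding coideal_pairs_def by blast

lemma coideal_pairs_R: "s \<in> R \<Longrightarrow> s \<in> coideal_pairs I"
  unfolding coideal_pairs_def by (auto intro!: exI[of _ 0])

lemma coideal_pairs_add: "s \<in> coideal_pairs I \<Longrightarrow> s' \<in> coideal_pairs I \<Longrightarrow> s + s' \<in> coideal_pairs I"
proof -
  assume "s \<in> coideal_pairs I" "s' \<in> coideal_pairs I"
  then obtain t t' where t: "Poly_Mapping.keys t \<subseteq> I \<times> C \<union> C \<times> I" "s - t \<in> R"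
    "Poly_Mapping.keys t' \<subseteq> I \<times> C \<union> C \<times> I" "s' - t' \<in> R" unfolding coideal_pairs_def by blast
  have "Poly_Mapping.keys (t + t') \<subseteq> I \<times> C \<union> C \<times> I" using t keys_add[of t t'] by blast
  moreover have "(s + s') - (t + t') \<in> R" using tensor_rel_add[OF t(2,4)] by (simp add: algebra_simps)
  ultimately show ?thesis unfolding coideal_pairs_def by blast
qed

lemma coideal_pairs_single:
  "(a, b) \<in> I \<times> C \<union> C \<times> I \<Longrightarrow> Poly_Mapping.single (a, b) c \<in> coideal_pairs I"
  unfolding coideal_pairs_def
  by (intro CollectI exI[of _ "Poly_Mapping.single (a, b) c"]) (auto simp: tensor_rel_zero)

lemma coideal_pairs_mult:
  assumes I: "ideal I H" and s: "s \<in> coideal_pairs I" and r: "r \<in> CC"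
  shows "s \<star>\<star> r \<in> coideal_pairs I" "r \<star>\<star> s \<in> coideal_pairs I"
proof -
  obtain t where t: "Poly_Mapping.keys t \<subseteq> I \<times> C \<union> C \<times> I" "s - t \<in> R"
    using s unfolding coideal_pairs_def by blast
  have IC: "a \<in> I \<Longrightarrow> a \<in> C" "a \<in> I \<Longrightarrow> c \<in> C \<Longrightarrow> c \<star> a \<in> I" "a \<in> I \<Longrightarrow> c \<in> C \<Longrightarrow> a \<star> c \<in> I" for a c
    using I by (auto simp: ideal_H_iff)
  have r': "Poly_Mapping.keys r \<subseteq> C \<times> C" using r by (simp add: CC_def)
  have "Poly_Mapping.keys (t \<star>\<star> r) \<subseteq> I \<times> C \<union> C \<times> I"
  proof
    fix z assume "z \<in> Poly_Mapping.keys (t \<star>\<star> r)"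
    then obtain y1 y2 where z: "z = pair_key_mult \<chi> y1 y2" "y1 \<in> Poly_Mapping.keys t" "y2 \<in> Poly_Mapping.keys r"
      using keys_twist[of "pair_key_mult \<chi>" "\<lambda>x y. 1" t r] unfolding pair_mult_twist by blast
    have "y1 \<in> I \<times> C \<union> C \<times> I" "y2 \<in> C \<times> C" using z t(1) r' by auto
    then show "z \<in> I \<times> C \<union> C \<times> I" using z(1) by (auto intro: IC C_mult)
  qed
  moreover have "s \<star>\<star> r - t \<star>\<star> r \<in> R" using R_mult_right[OF t(2) r] by (simp add: pair_mult_linear)
  ultimately show "s \<star>\<star> r \<in> coideal_pairs I" unfolding coideal_pairs_def by blast
  have "Poly_Mapping.keys (r \<star>\<star> t) \<subseteq> I \<times> C \<union> C \<times> I"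
  proof
    fix z assume "z \<in> Poly_Mapping.keys (r \<star>\<star> t)"
    then obtain y1 y2 where z: "z = pair_key_mult \<chi> y1 y2" "y1 \<in> Poly_Mapping.keys r" "y2 \<in> Poly_Mapping.keys t"
      using keys_twist[of "pair_key_mult \<chi>" "\<lambda>x y. 1" r t] unfolding pair_mult_twist by blast
    have "y2 \<in> I \<times> C \<union> C \<times> I" "y1 \<in> C \<times> C" using z t(1) r' by auto
    then show "z \<in> I \<times> C \<union> C \<times> I" using z(1) by (auto intro: IC C_mult)
  qed
  moreover have "r \<star>\<star> s - r \<star>\<star> t \<in> R" using R_mult_left[OF t(2) r] by (simp add: pair_mult_linear)
  ultimately show "r \<star>\<star> s \<in> coideal_pairs I" unfolding coideal_pairs_def by blast
qed

lemma comult_in_span_iff: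
  "comult H a \<in> tensor_span H (I \<times> carrier H \<union> carrier H \<times> I) \<longleftrightarrow> \<Delta> a \<in> coideal_pairs I"
proof -
  have "tensor_class (skew_algebra n \<chi>) s = tensor_class H s" for s
    by (simp add: tensor_class_def tensor_rel_H)
  then show ?thesis
    by (simp add: H_simps tensor_class_in_span_iff tensor_rel_H coideal_pairs_def)
qed

definition K2 :: "('g, 'k) skew set" where
  "K2 = {a \<in> C. \<forall>y\<in>Poly_Mapping.keys a. 2 \<le> length (snd y)}"

lemma counit_K2: "a \<in> K2 \<Longrightarrow> counit H a = 0"
  unfolding counit_H by (intro sum.neutral) (force simp: K2_def)

lemma ideal_K2: "ideal K2 H"
proof -
  have "a + b \<in> K2" if ab: "a \<in> K2" "b \<in> K2" for a b
  proof -
    have "2 \<le> length (snd y)" if "y \<in> Poly_Mapping.keys (a + b)" for y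
      using subsetD[OF keys_add that] ab by (auto simp: K2_def)
    then show ?thesis using ab C_add by (simp add: K2_def)
  qed
  moreover have "c \<star> a \<in> K2" "a \<star> c \<in> K2" if ac: "a \<in> K2" "c \<in> C" for a c
  proof -
    have "2 \<le> length (snd y)" if "y \<in> Poly_Mapping.keys (c \<star> a)" for y
      using subsetD[OF keys_twist that[unfolded skew_mult_twist]] ac by (auto simp: K2_def intro: trans_le_add2)
    moreover have "2 \<le> length (snd y)" if "y \<in> Poly_Mapping.keys (a \<star> c)" for y
      using subsetD[OF keys_twist that[unfolded skew_mult_twist]] ac by (auto simp: K2_def intro: trans_le_add1)
    ultimately show "c \<star> a \<in> K2" "a \<star> c \<in> K2" using ac C_mult by (auto simp: K2_def)
  qed
  moreover have "K2 \<subseteq> C" "0 \<in> K2" by (auto simp: K2_def C_zero)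
  ultimately show ?thesis unfolding ideal_H_iff by blast
qed

text \<open>The elements of the generated ideal that satisfy the coproduct and antipode conditions
  form an ideal, as \<Delta> is multiplicative modulo \<open>R\<close> and \<open>S\<close> reverses
  products; so generators suffice. The counit vanishes on \<open>K2\<close>.\<close>

lemma hopf_ideal_genideal:
  assumes X: "X \<subseteq> C" "Idl\<^bsub>H\<^esub> X \<subseteq> K2"
    and \<Delta>X: "\<And>a. a \<in> X \<Longrightarrow> \<Delta> a \<in> coideal_pairs (Idl\<^bsub>H\<^esub> X)"
    and SX: "\<And>a. a \<in> X \<Longrightarrow> S a \<in> Idl\<^bsub>H\<^esub> X"
  shows "hopf_ideal (Idl\<^bsub>H\<^esub> X) H"
proof -
  interpret ring H by (rule ring_H)
  let ?I = "Idl\<^bsub>H\<^esub> X"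
  have I: "ideal ?I H" using X by (intro genideal_ideal) (simp add: H_simps)
  have sub: "X \<subseteq> ?I" using X by (intro genideal_self) (simp add: H_simps)
  have IC: "?I \<subseteq> C" using I by (auto simp: ideal_H_iff)
  define V where "V = {a \<in> ?I. \<Delta> a \<in> coideal_pairs ?I \<and> S a \<in> ?I}"
  have "ideal V H"
    unfolding ideal_H_iff
  proof (intro conjI ballI)
    show "V \<subseteq> C" using IC by (auto simp: V_def)
    show "0 \<in> V" using I by (auto simp: V_def ideal_H_iff intro!: coideal_pairs_R tensor_rel_zero)
    show "a + b \<in> V" if "a \<in> V" "b \<in> V" for a b
      using that I by (auto simp: V_def ideal_H_iff \<Delta>_add S_add intro!: coideal_pairs_add)
  next
    fix a c assume a: "a \<in> V" and c: "c \<in> C"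
    have aC: "a \<in> C" using a IC by (auto simp: V_def)
    have "\<Delta> c \<star>\<star> \<Delta> a \<in> coideal_pairs ?I" "\<Delta> a \<star>\<star> \<Delta> c \<in> coideal_pairs ?I"
      using a coideal_pairs_mult[OF I _ CC_\<Delta>[OF c], of "\<Delta> a"] by (simp_all add: V_def)
    then have "(\<Delta> (c \<star> a) - \<Delta> c \<star>\<star> \<Delta> a) + \<Delta> c \<star>\<star> \<Delta> a \<in> coideal_pairs ?I"
      "(\<Delta> (a \<star> c) - \<Delta> a \<star>\<star> \<Delta> c) + \<Delta> a \<star>\<star> \<Delta> c \<in> coideal_pairs ?I"
      using coideal_pairs_add[OF coideal_pairs_R[OF \<Delta>_mult[OF c aC]]]
        coideal_pairs_add[OF coideal_pairs_R[OF \<Delta>_mult[OF aC c]]] by blast+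
    then show "c \<star> a \<in> V" "a \<star> c \<in> V"
      using a c aC I C_S[OF c] by (auto simp: V_def ideal_H_iff S_mult)
  qed
  moreover have "X \<subseteq> V" using sub \<Delta>X SX by (auto simp: V_def)
  ultimately have "?I \<subseteq> V" by (rule genideal_minimal)
  then show ?thesis
    unfolding hopf_ideal_def comult_in_span_iff
    using I X(2) counit_K2 by (auto simp only: V_def H_simps)
qed

section \<open>The two defining ideals and their far commutators\<close>

section \<open>The largest Hopf ideal\<close>

definition K where "K = Idl\<^bsub>H\<^esub> {x i \<star> x j | i j. i \<in> {1..n} \<and> j \<in> {1..n}}"

lemma K_gens: "{x i \<star> x j | i j. i \<in> {1..n} \<and> j \<in> {1..n}} \<subseteq> C"
  using C_mult C_x by blast

lemma ideal_K: "ideal K H"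
  unfolding K_def using K_gens by (intro ring.genideal_ideal ring_H) (simp add: H_simps)

lemma xx_in_K: "i \<in> {1..n} \<Longrightarrow> j \<in> {1..n} \<Longrightarrow> x i \<star> x j \<in> K"
proof -
  assume ij: "i \<in> {1..n}" "j \<in> {1..n}"
  have "{x i \<star> x j | i j. i \<in> {1..n} \<and> j \<in> {1..n}} \<subseteq> K"
    unfolding K_def using K_gens by (intro ring.genideal_self[OF ring_H]) (simp only: H_simps)
  then show ?thesis using ij by blast
qed

lemma K_subset: "K \<subseteq> K2"
proof -
  have "x i \<star> x j \<in> K2" if "i \<in> {1..n}" "j \<in> {1..n}" for i j
    using that by (auto simp: skew_var_def skew_mult_single K2_def C_def)
  then show ?thesis
    unfolding K_def by (intro ring.genideal_minimal[OF ring_H] ideal_K2) blast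
qed

text \<open>The \<open>GREATEST\<close> ideal exists: the ideal generated by the union of all
  admissible Hopf ideals is Hopf, because each of its generators already satisfies the conditions
  inside a smaller Hopf ideal, and it stays inside \<open>K\<close>.\<close>

lemma hopf_ideal_Lambda: "hopf_ideal (Lambda_ideal n \<chi> gs) H" (is ?A)
  and Lambda_subset: "Lambda_ideal n \<chi> gs \<subseteq> K" (is ?B)
  and Lambda_greatest: "hopf_ideal I H \<Longrightarrow> I \<subseteq> K \<Longrightarrow> I \<subseteq> Lambda_ideal n \<chi> gs"
proof -
  interpret ring H by (rule ring_H)
  define F where "F = \<Union>{I. hopf_ideal I H \<and> I \<subseteq> K}"
  let ?M = "Idl\<^bsub>H\<^esub> F"
  have FK: "F \<subseteq> K" by (auto simp: F_def)
  then have FC: "F \<subseteq> C" using ideal_K by (auto simp: ideal_H_iff)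
  have MK: "?M \<subseteq> K" using ideal_K FK by (rule genideal_minimal)
  have FM: "F \<subseteq> ?M" using FC by (intro genideal_self) (simp add: H_simps)
  have M: "hopf_ideal ?M H"
  proof (rule hopf_ideal_genideal[OF FC])
    show "?M \<subseteq> K2" using MK K_subset by blast
    fix a assume "a \<in> F"
    then obtain I where I: "hopf_ideal I H" "I \<subseteq> F" "a \<in> I" unfolding F_def by blast
    then have "\<Delta> a \<in> coideal_pairs I" "S a \<in> I"
      unfolding hopf_ideal_def comult_in_span_iff H_simps(8) by blast+
    then show "\<Delta> a \<in> coideal_pairs ?M" "S a \<in> ?M"
      using coideal_pairs_mono[of I ?M] I FM by blast+
  qed
  have eq: "Lambda_ideal n \<chi> gs = ?M"
    unfolding Lambda_ideal_def K_def[symmetric]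
  proof (rule Greatest_equality)
    show "hopf_ideal ?M H \<and> ?M \<subseteq> K" using M MK by simp
    show "I \<le> ?M" if "hopf_ideal I H \<and> I \<subseteq> K" for I
      using that FM unfolding F_def by blast
  qed
  show ?A unfolding eq by (rule M)
  show ?B unfolding eq by (rule MK)
  show "I \<subseteq> Lambda_ideal n \<chi> gs" if "hopf_ideal I H" "I \<subseteq> K"
    unfolding eq using that FM unfolding F_def by blast
qed

end

lemma bracket_single: "bracket \<chi> gs (Poly_Mapping.single (g, u) c) (Poly_Mapping.single (h, v) d) =
    pm_scale (c * d) (skew_mult \<chi> (Poly_Mapping.single (g, u) 1) (Poly_Mapping.single (h, v) 1)
      - pm_scale (chi_word \<chi> u (g_word gs v)) (skew_mult \<chi> (Poly_Mapping.single (h, v) 1) (Poly_Mapping.single (g, u) 1)))"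
  by (simp add: bracket_def lin_single pm_scale_scale)

context skew_group_algebra
begin

definition K1 :: "('g, 'k) skew set" where
  "K1 = {a \<in> C. \<forall>y\<in>Poly_Mapping.keys a. 1 \<le> length (snd y)}"

lemma K2_K1: "a \<in> K2 \<Longrightarrow> a \<in> K1"
  unfolding K1_def K2_def by force

lemma x_K1: "i \<in> {1..n} \<Longrightarrow> x i \<in> K1"
  using C_x[of i] by (simp add: K1_def skew_var_def)

lemma bracket_K1: "a \<in> K1 \<Longrightarrow> b \<in> K1 \<Longrightarrow> bracket \<chi> gs a b \<in> K2"
proof -
  assume ab: "a \<in> K1" "b \<in> K1"
  have K2: "0 \<in> K2" "\<And>a b. a \<in> K2 \<Longrightarrow> b \<in> K2 \<Longrightarrow> a + b \<in> K2" "\<And>c a. a \<in> K2 \<Longrightarrow> pm_scale c a \<in> K2"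
    "\<And>a b. a \<in> K2 \<Longrightarrow> b \<in> K2 \<Longrightarrow> a - b \<in> K2"
    using ideal_K2 ideal_H_scale[OF ideal_K2] ideal_H_diff[OF ideal_K2] unfolding ideal_H_iff by blast+
  have s: "Poly_Mapping.single (g, u @ v) c \<in> K2"
    if "set u \<subseteq> {1..n}" "set v \<subseteq> {1..n}" "1 \<le> length u" "1 \<le> length v" for g u v c
    using that by (auto simp: K2_def C_def)
  show ?thesis
    unfolding bracket_def
  proof (rule lin_mem[OF K2(1-3)], assumption+)
    fix y assume y: "y \<in> Poly_Mapping.keys a"
    obtain g u where yy: "y = (g, u)" by (metis prod.collapse)
    have u: "set u \<subseteq> {1..n}" "1 \<le> length u" using y ab(1) by (force simp: yy K1_def C_def)+
    show "(case y of (g, u) \<Rightarrow> lin (\<lambda>(h, v). skew_mult \<chi> (Poly_Mapping.single (g, u) 1) (Poly_Mapping.single (h, v) 1)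
        - pm_scale (chi_word \<chi> u (g_word gs v)) (skew_mult \<chi> (Poly_Mapping.single (h, v) 1) (Poly_Mapping.single (g, u) 1))) b) \<in> K2"
      unfolding yy prod.case
    proof (rule lin_mem[OF K2(1-3)], assumption+)
      fix z assume z: "z \<in> Poly_Mapping.keys b"
      obtain h v where zz: "z = (h, v)" by (metis prod.collapse)
      have v: "set v \<subseteq> {1..n}" "1 \<le> length v" using z ab(2) by (force simp: zz K1_def C_def)+
      show "(case z of (h, v) \<Rightarrow> skew_mult \<chi> (Poly_Mapping.single (g, u) 1) (Poly_Mapping.single (h, v) 1)
        - pm_scale (chi_word \<chi> u (g_word gs v)) (skew_mult \<chi> (Poly_Mapping.single (h, v) 1) (Poly_Mapping.single (g, u) 1))) \<in> K2"
        unfolding zz prod.case skew_mult_single by (intro K2(3,4) s u v)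
    qed
  qed
qed

abbreviation comm where "comm i j \<equiv> bracket \<chi> gs (x i) (x j)"

lemma comm_eq: "i \<in> {1..n} \<Longrightarrow> j \<in> {1..n} \<Longrightarrow> comm i j = x i \<star> x j - pm_scale (\<chi> i (gs j)) (x j \<star> x i)"
  by (simp add: skew_var_def bracket_single g_word_def chi_word_def)

lemma \<Delta>_x: "i \<in> {1..n} \<Longrightarrow> \<Delta> (x i) = xx i"
  using CC_xx[of i] by (simp add: skew_var_def \<Delta>_single)

lemma R_diff_scale_left:
  assumes "a \<in> C" "b \<in> C" "z \<in> C"
  shows "Poly_Mapping.single (a, z) 1 - pm_scale c (Poly_Mapping.single (b, z) 1)
     - Poly_Mapping.single (a - pm_scale c b, z) 1 \<in> R"
proof -
  have d: "a - pm_scale c b \<in> C"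
    using C_add[OF assms(1) C_uminus[OF C_scale[OF assms(2)]], of c] by simp
  have "Poly_Mapping.single (a - pm_scale c b + pm_scale c b, z) 1 - Poly_Mapping.single (a - pm_scale c b, z) 1
      - Poly_Mapping.single (pm_scale c b, z) 1 \<in> R"
    using d assms by (intro R_add_left C_scale)
  moreover have "Poly_Mapping.single (pm_scale c b, z) 1 - Poly_Mapping.single (b, z) c \<in> R"
    using assms by (intro R_scale_left)
  ultimately have "(Poly_Mapping.single (a - pm_scale c b + pm_scale c b, z) 1 - Poly_Mapping.single (a - pm_scale c b, z) 1
      - Poly_Mapping.single (pm_scale c b, z) 1) + (Poly_Mapping.single (pm_scale c b, z) 1 - Poly_Mapping.single (b, z) c) \<in> R"
    by (rule tensor_rel_add)
  then show ?thesis by (simp add: pm_scale_single algebra_simps)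
qed

lemma R_diff_scale_right:
  assumes "a \<in> C" "b \<in> C" "z \<in> C"
  shows "Poly_Mapping.single (z, a) 1 - pm_scale c (Poly_Mapping.single (z, b) 1)
     - Poly_Mapping.single (z, a - pm_scale c b) 1 \<in> R"
proof -
  have d: "a - pm_scale c b \<in> C"
    using C_add[OF assms(1) C_uminus[OF C_scale[OF assms(2)]], of c] by simp
  have "Poly_Mapping.single (z, a - pm_scale c b + pm_scale c b) 1 - Poly_Mapping.single (z, a - pm_scale c b) 1
      - Poly_Mapping.single (z, pm_scale c b) 1 \<in> R"
    using d assms by (intro R_add_right C_scale)
  moreover have "Poly_Mapping.single (z, pm_scale c b) 1 - Poly_Mapping.single (z, b) c \<in> R"
    using assms by (intro R_scale_right)
  ultimately have "(Poly_Mapping.single (z, a - pm_scale c b + pm_scale c b) 1 - Poly_Mapping.single (z, a - pm_scale c b) 1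
      - Poly_Mapping.single (z, pm_scale c b) 1) + (Poly_Mapping.single (z, pm_scale c b) 1 - Poly_Mapping.single (z, b) c) \<in> R"
    by (rule tensor_rel_add)
  then show ?thesis by (simp add: pm_scale_single algebra_simps)
qed

lemma comm_C: "i \<in> {1..n} \<Longrightarrow> j \<in> {1..n} \<Longrightarrow> comm i j \<in> C"
  using bracket_K1[OF x_K1 x_K1, of i j] by (simp add: K2_def)

text \<open>The mixed terms of the coproduct cancel because \<open>p\<^sub>i\<^sub>j p\<^sub>j\<^sub>i = 1\<close>.\<close>

lemma \<Delta>_comm:
  assumes ij: "i \<in> {1..n}" "j \<in> {1..n}" and pp: "\<chi> i (gs j) * \<chi> j (gs i) = 1" and I: "comm i j \<in> I"
  shows "\<Delta> (comm i j) \<in> coideal_pairs I"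
proof -
  let ?p = "\<chi> i (gs j)" and ?p' = "\<chi> j (gs i)"
  let ?s = "\<lambda>a b. Poly_Mapping.single (a, b) (1::'k)"
  have C: "x i \<in> C" "x j \<in> C" "grp g \<in> C" for g using ij by (auto intro: C_x C_grp simp del: atLeastAtMost_iff)
  have 0: "\<Delta> (comm i j) - (xx i \<star>\<star> xx j - pm_scale ?p (xx j \<star>\<star> xx i)) \<in> R"
    using tensor_rel_diff[OF \<Delta>_mult[OF C(1,2)] tensor_rel_scale[OF \<Delta>_mult[OF C(2,1)], of ?p]]
    by (simp add: comm_eq[OF ij] \<Delta>_diff \<Delta>_scale \<Delta>_x[OF ij(1)] \<Delta>_x[OF ij(2)] pm_scale_diff algebra_simps)
  have 1: "?s (x i \<star> x j) (grp 0) - pm_scale ?p (?s (x j \<star> x i) (grp 0)) - ?s (comm i j) (grp 0) \<in> R" (is "?r1 \<in> R")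
    unfolding comm_eq[OF ij] using C by (intro R_diff_scale_left C_mult)
  have 2: "?s (grp (gs i + gs j)) (x i \<star> x j) - pm_scale ?p (?s (grp (gs i + gs j)) (x j \<star> x i))
      - ?s (grp (gs i + gs j)) (comm i j) \<in> R" (is "?r2 \<in> R")
    unfolding comm_eq[OF ij] using C by (intro R_diff_scale_right C_mult)
  have 3: "?s (pm_scale ?p (grp (gs j) \<star> x i)) (x j) - Poly_Mapping.single (grp (gs j) \<star> x i, x j) ?p \<in> R" (is "?r3 \<in> R")
    using C by (intro R_scale_left C_mult)
  have 4: "pm_scale ?p (?s (pm_scale ?p' (grp (gs i) \<star> x j)) (x i) - Poly_Mapping.single (grp (gs i) \<star> x j, x i) ?p') \<in> R" (is "?r4 \<in> R")
    using C by (intro tensor_rel_scale R_scale_left C_mult)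
  \<comment> \<open>\<open>?r1\<close> and \<open>?r2\<close> collect the outer terms into
    commutators. \<open>?r3\<close> and \<open>?r4\<close> account for the mixed terms: those with
    x_j on the right agree at once, those with x_i on the right because the two characters multiply
    to 1.\<close>
  have eq: "xx i \<star>\<star> xx j - pm_scale ?p (xx j \<star>\<star> xx i) =
      (?r1 + ?r2 + ?r3 - ?r4) + (?s (comm i j) (grp 0) + ?s (grp (gs i + gs j)) (comm i j))"
    using C pp chi_zero[OF ij(1)] chi_zero[OF ij(2)]
    by (simp add: pair_mult_linear pair_mult_single grp_mul_grp x_mul_grp pm_scale_diff pm_scale_add
        pm_scale_single add.commute[of "gs j"] algebra_simps)
  have "?r1 + ?r2 + ?r3 - ?r4 \<in> R"
    by (rule tensor_rel_diff[OF tensor_rel_add[OF tensor_rel_add[OF 1 2] 3] 4])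
  then have "?r1 + ?r2 + ?r3 - ?r4 \<in> coideal_pairs I" by (rule coideal_pairs_R)
  moreover have "?s (comm i j) (grp 0) + ?s (grp (gs i + gs j)) (comm i j) \<in> coideal_pairs I"
    using I C by (intro coideal_pairs_add coideal_pairs_single) auto
  ultimately have "xx i \<star>\<star> xx j - pm_scale ?p (xx j \<star>\<star> xx i) \<in> coideal_pairs I"
    unfolding eq by (rule coideal_pairs_add)
  from coideal_pairs_add[OF coideal_pairs_R[OF 0] this] show ?thesis by simp
qed

text \<open>Reversal turns the commutator of x_i, x_j into a multiple of that of x_j, x_i, and the
  two are proportional because \<open>\<chi> i (gs j) * \<chi> j (gs i) = 1\<close>.\<close>

lemma S_comm:
  assumes ij: "i \<in> {1..n}" "j \<in> {1..n}" and pp: "\<chi> i (gs j) * \<chi> j (gs i) = 1"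
  shows "S (comm i j) = pm_scale (-1) (grp (- gs i - gs j)) \<star> comm i j"
proof -
  have inv: "inverse (\<chi> j (gs i)) = \<chi> i (gs j)" "inverse (\<chi> i (gs j)) = \<chi> j (gs i)"
    using pp by (metis inverse_unique mult.commute)+
  have z: "\<chi> i 0 = 1" "\<chi> j 0 = 1" "\<chi> i (- gs j) = \<chi> j (gs i)" "\<chi> j (- gs i) = \<chi> i (gs j)"
    using ij by (simp_all add: chi_zero chi_uminus inv del: atLeastAtMost_iff)
  have e: "comm i j = Poly_Mapping.single (0, [i, j]) 1 - Poly_Mapping.single (0, [j, i]) (\<chi> i (gs j))"
    unfolding comm_eq[OF ij] by (simp add: skew_var_def skew_mult_single chi_word_def z pm_scale_single)
  show ?thesis
    unfolding e using pp
    by (simp add: S_diff S_single skew_grp_def skew_var_def skew_mult_linear skew_mult_single chi_word_def z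
        pm_scale_single pm_scale_diff single_uminus add.commute)
qed

definition comm_gens where
  "comm_gens = {comm i j | i j. i \<in> {1..n} \<and> j \<in> {1..n} \<and> (i + 1 < j \<or> j + 1 < i)}"

text \<open>By \<open>\<Delta>_comm\<close> and \<open>S_comm\<close> the far commutators generate a
  Hopf ideal, which lies in \<open>K\<close> and is therefore contained in the greatest one.\<close>

lemma comm_in_Lambda:
  assumes far: "\<And>i j. i \<in> {1..n} \<Longrightarrow> j \<in> {1..n} \<Longrightarrow> i + 1 < j \<or> j + 1 < i \<Longrightarrow> \<chi> i (gs j) * \<chi> j (gs i) = 1"
    and ij: "i \<in> {1..n}" "j \<in> {1..n}" "i + 1 < j \<or> j + 1 < i"
  shows "comm i j \<in> Lambda_ideal n \<chi> gs"
proof -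
  interpret ring H by (rule ring_H)
  let ?I = "Idl\<^bsub>H\<^esub> comm_gens"
  have sub: "comm_gens \<subseteq> C" unfolding comm_gens_def using comm_C by blast
  have gI: "comm_gens \<subseteq> ?I" using sub by (intro genideal_self) (simp only: H_simps)
  have I: "ideal ?I H" using sub by (intro genideal_ideal) (simp only: H_simps)
  have "comm i j \<in> K" if "i \<in> {1..n}" "j \<in> {1..n}" for i j
    unfolding comm_eq[OF that] using that by (intro ideal_H_diff[OF ideal_K] ideal_H_scale[OF ideal_K] xx_in_K)
  then have "comm_gens \<subseteq> K" unfolding comm_gens_def by blast
  then have IK: "?I \<subseteq> K" by (intro genideal_minimal ideal_K)
  have "hopf_ideal ?I H"
  proof (rule hopf_ideal_genideal[OF sub])
    show "?I \<subseteq> K2" using IK K_subset by blast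
    fix a assume a: "a \<in> comm_gens"
    then obtain i j where ij: "i \<in> {1..n}" "j \<in> {1..n}" "i + 1 < j \<or> j + 1 < i" "a = comm i j"
      unfolding comm_gens_def by blast
    have aI: "comm i j \<in> ?I" using a gI ij by blast
    show "\<Delta> a \<in> coideal_pairs ?I"
      unfolding ij(4) using ij aI far by (intro \<Delta>_comm)
    show "S a \<in> ?I"
      unfolding ij(4) S_comm[OF ij(1,2) far[OF ij(1-3)]] using I aI C_scale[OF C_grp] unfolding ideal_H_iff by blast
  qed
  then have "?I \<subseteq> Lambda_ideal n \<chi> gs" using IK by (rule Lambda_greatest)
  then show ?thesis using gI ij unfolding comm_gens_def by blast
qed

lemma serre_ideal_props:
  shows "ideal (serre_ideal n \<chi> gs) H" "serre_ideal n \<chi> gs \<subseteq> K2"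
    and "i \<in> {1..n} \<Longrightarrow> j \<in> {1..n} \<Longrightarrow> i + 1 < j \<or> j + 1 < i \<Longrightarrow> comm i j \<in> serre_ideal n \<chi> gs"
proof -
  interpret ring H by (rule ring_H)
  define G where "G = {bracket \<chi> gs (comm i (i + 1)) (x (i + 1)) | i. 1 \<le> i \<and> i < n}
    \<union> {bracket \<chi> gs (x i) (comm i (i + 1)) | i. 1 \<le> i \<and> i < n} \<union> comm_gens"
  have eq: "serre_ideal n \<chi> gs = Idl\<^bsub>H\<^esub> G" by (simp add: serre_ideal_def G_def comm_gens_def)
  have "comm i j \<in> K2" if "i \<in> {1..n}" "j \<in> {1..n}" for i j
    using that by (intro bracket_K1 x_K1)
  moreover have "bracket \<chi> gs (comm i (i + 1)) (x (i + 1)) \<in> K2" "bracket \<chi> gs (x i) (comm i (i + 1)) \<in> K2"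
    if "1 \<le> i" "i < n" for i
    using that by (auto intro!: bracket_K1 K2_K1 x_K1)
  ultimately have GK: "G \<subseteq> K2" unfolding G_def comm_gens_def by blast
  then have GC: "G \<subseteq> carrier H" by (auto simp: K2_def H_simps)
  show "ideal (serre_ideal n \<chi> gs) H" unfolding eq using GC by (rule genideal_ideal)
  show "serre_ideal n \<chi> gs \<subseteq> K2" unfolding eq using ideal_K2 GK by (rule genideal_minimal)
  show "comm i j \<in> serre_ideal n \<chi> gs" if "i \<in> {1..n}" "j \<in> {1..n}" "i + 1 < j \<or> j + 1 < i"
    using genideal_self[OF GC] that unfolding eq G_def comm_gens_def by blast
qed

end

section \<open>Passage to the quotient\<close>

section \<open>Quotients and skew derivations\<close>

locale skew_quotient = skew_group_algebra n \<chi> gs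
  for n and \<chi> :: "nat \<Rightarrow> 'g::ab_group_add \<Rightarrow> 'k::field" and gs +
  fixes I :: "('g, 'k) skew set"
  assumes I: "ideal I H" and I_K2: "I \<subseteq> K2"
begin

abbreviation A where "A \<equiv> quot_hopf H I"
definition coset where "coset a = I +>\<^bsub>H\<^esub> a"

lemma coset_image: "coset a = (\<lambda>h. h + a) ` I"
  by (auto simp: coset_def a_r_coset_def' H_simps)

lemma I_zero: "0 \<in> I" and I_add: "a \<in> I \<Longrightarrow> b \<in> I \<Longrightarrow> a + b \<in> I" and I_C: "a \<in> I \<Longrightarrow> a \<in> C"
  and I_mult: "a \<in> I \<Longrightarrow> c \<in> C \<Longrightarrow> c \<star> a \<in> I" "a \<in> I \<Longrightarrow> c \<in> C \<Longrightarrow> a \<star> c \<in> I"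
  using I unfolding ideal_H_iff by blast+

lemmas I_scale = ideal_H_scale[OF I] and I_diff = ideal_H_diff[OF I]

lemma coset_eq_iff: "coset a = coset b \<longleftrightarrow> a - b \<in> I"
proof
  assume "coset a = coset b"
  moreover have "a \<in> coset a" using I_zero by (force simp: coset_image)
  ultimately obtain h where "h \<in> I" "a = h + b" by (auto simp: coset_image)
  then show "a - b \<in> I" by simp
next
  assume d: "a - b \<in> I"
  have "h + a \<in> coset b" if "h \<in> I" for h
    using I_add[OF that d] by (force simp: coset_image intro: image_eqI[of _ _ "h + (a - b)"])
  moreover have "h + b \<in> coset a" if "h \<in> I" for h
    using I_diff[OF that d] by (force simp: coset_image intro: image_eqI[of _ _ "h - (a - b)"])
  ultimately show "coset a = coset b" unfolding coset_image by blast
qed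

lemma coset_self: "a \<in> coset a"
  using I_zero by (force simp: coset_image)

lemma A_simps:
  "carrier A = coset ` C" "monoid.mult A = rcoset_mult H I" "one A = coset (grp 0)" "zero A = I"
  "add A = set_add H" "smult A c X = (\<Union>x\<in>X. coset (pm_scale c x))"
  "comult A X = (\<Union>x\<in>X. \<Union>s\<in>comult H x. tensor_class A
     (lin (\<lambda>(a, b). Poly_Mapping.single (coset a, coset b) 1) s))"
proof -
  have q: "carrier (quot_algebra H I) = carrier A" "add (quot_algebra H I) = add A" "smult (quot_algebra H I) = smult A"
    by (simp_all add: quot_hopf_def quot_algebra_def FactRing_def ring.extend_def module.fields_def
        module.extend_def hopf_algebra.fields_def)
  have t: "tensor_class (quot_algebra H I) = tensor_class A"
    by (intro ext) (simp add: tensor_class_def tensor_rel_cong[OF q])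
  show "carrier A = coset ` C" "monoid.mult A = rcoset_mult H I" "one A = coset (grp 0)" "zero A = I"
    "add A = set_add H" "smult A c X = (\<Union>x\<in>X. coset (pm_scale c x))"
    by (auto simp: quot_hopf_def quot_algebra_def FactRing_def ring.extend_def module.fields_def
        module.extend_def hopf_algebra.fields_def H_simps coset_def A_RCOSETS_def')
  show "comult A X = (\<Union>x\<in>X. \<Union>s\<in>comult H x. tensor_class A
     (lin (\<lambda>(a, b). Poly_Mapping.single (coset a, coset b) 1) s))"
    unfolding t[symmetric] coset_def
    by (simp add: quot_hopf_def module.extend_def hopf_algebra.fields_def)
qed

lemma coset_zero: "coset 0 = I"
  by (simp add: coset_image)

lemma coset_mult: "a \<in> C \<Longrightarrow> b \<in> C \<Longrightarrow> coset a \<otimes>\<^bsub>A\<^esub> coset b = coset (a \<star> b)"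
  using ideal.rcoset_mult_add[OF I, of a b] unfolding H_simps A_simps(2) coset_def by blast

lemma coset_add: "a \<in> C \<Longrightarrow> b \<in> C \<Longrightarrow> coset a \<oplus>\<^bsub>A\<^esub> coset b = coset (a + b)"
  using abelian_subgroup.a_rcos_sum[OF abelian_subgroupI3[OF ideal.axioms(1)[OF I] ring.is_abelian_group[OF ring_H]], of a b]
  unfolding H_simps A_simps(5) coset_def by blast

lemma coset_smult: "c \<odot>\<^bsub>A\<^esub> coset a = coset (pm_scale c a)"
proof -
  have "coset (pm_scale c y) = coset (pm_scale c a)" if "y \<in> coset a" for y
  proof -
    have "y - a \<in> I" using that by (auto simp: coset_image)
    then show ?thesis using I_scale[of "y - a" c] by (simp add: coset_eq_iff pm_scale_diff)
  qed
  then have "(\<Union>y\<in>coset a. coset (pm_scale c y)) = coset (pm_scale c a)" using coset_self[of a] by blast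
  then show ?thesis by (simp only: A_simps(6))
qed

text \<open>Allows the finite sum in the definition of a leading term to be evaluated term by
  term.\<close>

lemma abelian_monoid_A: "abelian_monoid A"
proof (rule abelian_monoidI)
  show "X \<oplus>\<^bsub>A\<^esub> Y \<in> carrier A" if "X \<in> carrier A" "Y \<in> carrier A" for X Y
    using that by (auto simp: A_simps(1) coset_add C_add)
  show "\<zero>\<^bsub>A\<^esub> \<in> carrier A" unfolding A_simps(1,4) using coset_zero C_zero by blast
  show "(X \<oplus>\<^bsub>A\<^esub> Y) \<oplus>\<^bsub>A\<^esub> Z = X \<oplus>\<^bsub>A\<^esub> (Y \<oplus>\<^bsub>A\<^esub> Z)"
    if "X \<in> carrier A" "Y \<in> carrier A" "Z \<in> carrier A" for X Y Z
    using that by (auto simp: A_simps(1) coset_add C_add add.assoc)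
  show "\<zero>\<^bsub>A\<^esub> \<oplus>\<^bsub>A\<^esub> X = X" if "X \<in> carrier A" for X
    using that coset_add[OF C_zero] by (auto simp: A_simps(1,4) coset_zero)
  show "X \<oplus>\<^bsub>A\<^esub> Y = Y \<oplus>\<^bsub>A\<^esub> X" if "X \<in> carrier A" "Y \<in> carrier A" for X Y
    using that by (auto simp: A_simps(1) coset_add add.commute)
qed

text \<open>The map id \<otimes> f on representatives.\<close>

definition contract :: "(('g, 'k) skew \<Rightarrow> 'k) \<Rightarrow> ((('g, 'k) skew \<times> ('g, 'k) skew) \<Rightarrow>\<^sub>0 'k) \<Rightarrow> ('g, 'k) skew" where
  "contract f = lin (\<lambda>(a, b). pm_scale (f b) a)"

lemma contract_add: "contract f (s + t) = contract f s + contract f t"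
  and contract_lin: "contract f (lin F a) = lin (\<lambda>y. contract f (F y)) a"
  and contract_scale: "contract f (pm_scale c s) = pm_scale c (contract f s)"
  by (simp_all add: contract_def lin_add lin_lin lin_scale)

lemma contract_single: "contract f (Poly_Mapping.single (a, b) c) = pm_scale (c * f b) a"
  by (simp add: contract_def lin_single pm_scale_scale)

end

locale coideal_subalgebra = skew_quotient n \<chi> gs I
  for n and \<chi> :: "nat \<Rightarrow> 'g::ab_group_add \<Rightarrow> 'k::field" and gs I +
  fixes U :: "('g, 'k) skew set set"
  assumes U: "right_coideal_subalgebra U A"
    and grp_U: "\<And>g. coset (grp g) \<in> U"
begin

definition U' where "U' = {a \<in> C. coset a \<in> U}"

lemma U_carrier: "X \<in> U \<Longrightarrow> X \<in> coset ` C"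
  using U subringE(1)[of U A] by (auto simp: right_coideal_subalgebra_def A_simps)

lemma U'_C: "a \<in> U' \<Longrightarrow> a \<in> C"
  and U'_grp: "grp g \<in> U'"
  using grp_U by (auto simp: U'_def C_grp)

lemma I_U': "a \<in> I \<Longrightarrow> a \<in> U'"
proof -
  assume a: "a \<in> I"
  then have "coset a = \<zero>\<^bsub>A\<^esub>" using coset_eq_iff[of a 0] by (simp add: coset_zero A_simps)
  moreover have "\<zero>\<^bsub>A\<^esub> \<in> U" using U subringE(2)[of U A] by (simp add: right_coideal_subalgebra_def)
  ultimately show ?thesis using a by (simp add: U'_def I_C)
qed

lemma U'_add: "a \<in> U' \<Longrightarrow> b \<in> U' \<Longrightarrow> a + b \<in> U'"
  using U subringE(7)[of U A "coset a" "coset b"] coset_add[of a b]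
  by (simp add: right_coideal_subalgebra_def U'_def C_add)

lemma U'_mult: "a \<in> U' \<Longrightarrow> b \<in> U' \<Longrightarrow> a \<star> b \<in> U'"
  using U subringE(6)[of U A "coset a" "coset b"] coset_mult[of a b]
  by (simp add: right_coideal_subalgebra_def U'_def C_mult)

lemma U'_scale: "a \<in> U' \<Longrightarrow> pm_scale c a \<in> U'"
proof -
  assume a: "a \<in> U'"
  then have "c \<odot>\<^bsub>A\<^esub> coset a \<in> U" using U unfolding right_coideal_subalgebra_def U'_def by blast
  then show ?thesis using a by (simp add: coset_smult U'_def C_scale)
qed

text \<open>
  Contracting the right tensor factor with a functional that vanishes on \<open>I\<close>. The comparison
  takes place upstairs: \<open>rep\<close> chooses representatives, and the contraction of a bilinearity
  relation of the quotient lies in \<open>I\<close>.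
\<close>

lemma contraction_in_U':
  assumes f_add: "\<And>a b. f (a + b) = f a + f b" and f_scale: "\<And>c a. f (pm_scale c a) = c * f a"
    and f_I: "\<And>a. a \<in> I \<Longrightarrow> f a = 0" and a: "a \<in> U'"
  shows "contract f (\<Delta> a) \<in> U'"
proof -
  define rep where "rep X = (SOME b. b \<in> C \<and> coset b = X)" for X
  have rep: "rep X \<in> C" "coset (rep X) = X" if "X \<in> carrier A" for X
  proof -
    have "\<exists>b. b \<in> C \<and> coset b = X" using that unfolding A_simps(1) by blast
    from someI_ex[OF this] show "rep X \<in> C" "coset (rep X) = X" unfolding rep_def by blast+
  qed
  have cosetA: "coset b \<in> carrier A" if "b \<in> C" for b
    using that unfolding A_simps(1) by blast
  have f_diff: "f (b - c) = f b - f c" for b c using f_add[of "b - c" c] by simp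
  have f_cong: "f b = f c" if "b - c \<in> I" for b c using f_I[OF that] f_diff[of b c] by simp
  \<comment> \<open>\<open>E\<close> is id \<otimes> f for the quotient with values lifted back. The
    choice \<open>rep\<close> is linear only modulo \<open>I\<close>, so \<open>E\<close> respects
    the tensor relations only modulo \<open>I\<close>.\<close>
  define E where "E = lin (\<lambda>(X, Y). pm_scale (f (rep Y)) (rep X))"
  have E_single: "E (Poly_Mapping.single (X, Y) c) = pm_scale (c * f (rep Y)) (rep X)" for X Y c
    by (simp add: E_def lin_single pm_scale_scale)
  have E_diff: "E (s - t) = E s - E t" for s t by (simp add: E_def lin_diff)
  have rep_add: "rep (X \<oplus>\<^bsub>A\<^esub> Y) - rep X - rep Y \<in> I" if XY: "X \<in> carrier A" "Y \<in> carrier A" for X Y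
  proof -
    have e: "X \<oplus>\<^bsub>A\<^esub> Y = coset (rep X + rep Y)"
      using coset_add[OF rep(1)[OF XY(1)] rep(1)[OF XY(2)]] unfolding rep(2)[OF XY(1)] rep(2)[OF XY(2)] .
    have "coset (rep (X \<oplus>\<^bsub>A\<^esub> Y)) = coset (rep X + rep Y)"
      unfolding e by (rule rep(2)[OF cosetA[OF C_add[OF rep(1)[OF XY(1)] rep(1)[OF XY(2)]]]])
    then show ?thesis unfolding coset_eq_iff by (simp only: diff_diff_eq)
  qed
  have rep_scale: "rep (c \<odot>\<^bsub>A\<^esub> X) - pm_scale c (rep X) \<in> I" if X: "X \<in> carrier A" for c X
  proof -
    have e: "c \<odot>\<^bsub>A\<^esub> X = coset (pm_scale c (rep X))"
      using coset_smult[of c "rep X"] unfolding rep(2)[OF X] .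
    have "coset (rep (c \<odot>\<^bsub>A\<^esub> X)) = coset (pm_scale c (rep X))"
      unfolding e by (rule rep(2)[OF cosetA[OF C_scale[OF rep(1)[OF X]]]])
    then show ?thesis unfolding coset_eq_iff .
  qed
  have E_rel: "E s \<in> I" if "s \<in> tensor_rel A" for s
  proof (rule tensor_rel_linear_image[OF _ _ I_zero I_add I_scale _ _ _ _ that])
    fix X Y Z assume XYZ: "X \<in> carrier A" "Y \<in> carrier A" "Z \<in> carrier A"
    show "E (Poly_Mapping.single (X \<oplus>\<^bsub>A\<^esub> Y, Z) 1 - Poly_Mapping.single (X, Z) 1 - Poly_Mapping.single (Y, Z) 1) \<in> I"
      using I_scale[OF rep_add[OF XYZ(1,2)], of "f (rep Z)"] by (simp add: E_diff E_single pm_scale_diff)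
    have "f (rep (Y \<oplus>\<^bsub>A\<^esub> Z)) = f (rep Y) + f (rep Z)"
      using f_cong[of "rep (Y \<oplus>\<^bsub>A\<^esub> Z)" "rep Y + rep Z"] rep_add[OF XYZ(2,3)] by (simp add: diff_diff_eq f_add)
    then show "E (Poly_Mapping.single (X, Y \<oplus>\<^bsub>A\<^esub> Z) 1 - Poly_Mapping.single (X, Y) 1 - Poly_Mapping.single (X, Z) 1) \<in> I"
      by (simp add: E_diff E_single pm_scale_add_left I_zero)
  next
    fix c X Y assume XY: "X \<in> carrier A" "Y \<in> carrier A"
    show "E (Poly_Mapping.single (c \<odot>\<^bsub>A\<^esub> X, Y) 1 - Poly_Mapping.single (X, Y) c) \<in> I"
      using I_scale[OF rep_scale[OF XY(1)], of "f (rep Y)" c]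
      by (simp add: E_diff E_single pm_scale_diff pm_scale_scale mult.commute)
    have "f (rep (c \<odot>\<^bsub>A\<^esub> Y)) = c * f (rep Y)"
      using f_cong[OF rep_scale[OF XY(2)]] by (simp add: f_scale)
    then show "E (Poly_Mapping.single (X, c \<odot>\<^bsub>A\<^esub> Y) 1 - Poly_Mapping.single (X, Y) c) \<in> I"
      by (simp add: E_diff E_single I_zero)
  qed (simp_all add: E_def lin_add lin_scale)
  have aC: "a \<in> C" and aU: "coset a \<in> U" using a by (auto simp: U'_def)
  define t where "t = lin (\<lambda>(a, b). Poly_Mapping.single (coset a, coset b) (1::'k)) (\<Delta> a)"
  have "comult A (coset a) \<in> tensor_span A (U \<times> carrier A)"
    using U aU by (simp add: right_coideal_subalgebra_def)
  then obtain s' where s': "comult A (coset a) = tensor_class A s'" "Poly_Mapping.keys s' \<subseteq> U \<times> carrier A"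
    by (auto simp: tensor_span_def)
  have "\<Delta> a \<in> comult H a" "t \<in> tensor_class A t"
    by (simp_all add: H_simps tensor_class_def tensor_rel_zero)
  \<comment> \<open>\<open>t\<close> and \<open>s'\<close> represent the same tensor:
    \<open>t\<close> comes from the coproduct upstairs, while \<open>s'\<close> has its left factors
    in \<open>U\<close>.\<close>
  then have "t \<in> comult A (coset a)" unfolding A_simps(7) t_def using coset_self by blast
  then have "t - s' \<in> tensor_rel A" unfolding s'(1) by (simp add: tensor_class_def)
  then have 1: "E t - E s' \<in> I" using E_rel[of "t - s'"] by (simp add: E_diff)
  have 2: "E s' \<in> U'"
    unfolding E_def
  proof (rule lin_mem)
    fix y assume "y \<in> Poly_Mapping.keys s'"
    then obtain X Y where y: "y = (X, Y)" "X \<in> U" using s'(2) by auto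
    then have "X \<in> carrier A" using U_carrier unfolding A_simps(1) by blast
    then have "rep X \<in> U'" using rep[of X] y(2) unfolding U'_def by simp
    then show "(case y of (X, Y) \<Rightarrow> pm_scale (f (rep Y)) (rep X)) \<in> U'" using y U'_scale by simp
  qed (auto intro: U'_add U'_scale I_U' I_zero)
  have "E t = lin (\<lambda>(a, b). pm_scale (f (rep (coset b))) (rep (coset a))) (\<Delta> a)"
    unfolding t_def E_def lin_lin by (intro lin_cong) (auto simp: lin_single)
  then have "E t - contract f (\<Delta> a) = lin (\<lambda>y. (\<lambda>(a, b). pm_scale (f (rep (coset b))) (rep (coset a))) y +
      pm_scale (-1) ((\<lambda>(a, b). pm_scale (f b) a) y)) (\<Delta> a)"
    unfolding lin_fun_add lin_fun_scale contract_def by (simp add: pm_scale_minus_left)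
  also have "\<dots> \<in> I"
  proof (rule lin_mem[OF I_zero I_add I_scale], assumption+)
    fix y assume "y \<in> Poly_Mapping.keys (\<Delta> a)"
    then obtain b c where y: "y = (b, c)" "b \<in> C" "c \<in> C" using CC_\<Delta>[OF aC] by (auto simp: CC_def)
    have bc: "rep (coset b) - b \<in> I" "rep (coset c) - c \<in> I" using rep(2)[OF cosetA[OF y(2)]] rep(2)[OF cosetA[OF y(3)]] unfolding coset_eq_iff by blast+
    have "f (rep (coset c)) = f c" using f_cong bc by blast
    then show "(\<lambda>(a, b). pm_scale (f (rep (coset b))) (rep (coset a))) y + pm_scale (-1) ((\<lambda>(a, b). pm_scale (f b) a) y) \<in> I"
      using I_scale[OF bc(1), of "f c"] by (simp add: y pm_scale_diff pm_scale_minus_left)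
  qed
  finally have 3: "E t - contract f (\<Delta> a) \<in> I" .
  \<comment> \<open>\<open>E s'\<close> lies in \<open>U'\<close> by the coideal property, and
    \<open>E t\<close> ties it to the contraction upstairs; both differences lie in
    \<open>I\<close>.\<close>
  have "(E t - E s') - (E t - contract f (\<Delta> a)) \<in> U'" using I_diff[OF 1 3] by (rule I_U')
  from U'_add[OF this 2] show ?thesis by simp
qed

end

section \<open>Transfer between the free algebra and the skew group algebra\<close>

section \<open>Embedding the free algebra\<close>

definition \<iota> :: "'k::field free \<Rightarrow> ('g::ab_group_add, 'k) skew" where
  "\<iota> = lin (\<lambda>w. Poly_Mapping.single (0, letters w) 1)"

lemma \<iota>_add: "\<iota> (a + b) = \<iota> a + \<iota> b"
  and \<iota>_diff: "\<iota> (a - b) = \<iota> a - \<iota> b"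
  and \<iota>_scale: "\<iota> (pm_scale c a) = pm_scale c (\<iota> a)"
  and \<iota>_lin: "\<iota> (lin f d) = lin (\<lambda>y. \<iota> (f y)) d"
  and \<iota>_zero [simp]: "\<iota> 0 = 0"
  and \<iota>_single: "\<iota> (Poly_Mapping.single w 1) = Poly_Mapping.single (0, letters w) 1"
  by (simp_all add: \<iota>_def lin_add lin_diff lin_scale lin_lin lin_single)

lemma \<iota>_apply: "\<iota> a = lin (\<lambda>w. Poly_Mapping.single (0, letters w) 1) a"
  by (simp add: \<iota>_def)

lemma \<iota>_var: "\<iota> (var i) = skew_var i"
  by (simp add: var_def \<iota>_single skew_var_def)

lemma \<iota>_one: "\<iota> 1 = skew_grp 0"
  using \<iota>_single[of "FW []"] by (simp add: skew_grp_def)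

lemma supp_in_add: "supp_in A a \<Longrightarrow> supp_in A b \<Longrightarrow> supp_in A (a + b)"
  unfolding supp_in_def using keys_add[of a b] by blast

lemma supp_in_scale: "supp_in A a \<Longrightarrow> supp_in A (pm_scale c a)"
  unfolding supp_in_def using keys_pm_scale[of c a] by blast

lemma supp_in_zero: "supp_in A 0"
  by (simp add: supp_in_def)

lemma supp_in_power: "supp_in A a \<Longrightarrow> supp_in A (a ^ e)"
  by (induction e) (auto intro: supp_in_mult supp_in_one)

context skew_group_algebra
begin

lemma \<iota>_C: "supp_in {1..n} a \<Longrightarrow> \<iota> a \<in> C"
  unfolding \<iota>_def supp_in_def
  by (rule lin_mem[OF C_zero C_add C_scale], assumption+) (rule C_single, blast)

lemma \<iota>_mult: "supp_in {1..n} a \<Longrightarrow> \<iota> (a * b) = \<iota> a \<star> \<iota> b"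
proof -
  assume a: "supp_in {1..n} a"
  let ?s = "\<lambda>w. Poly_Mapping.single w (1::'k)" and ?t = "\<lambda>w. Poly_Mapping.single (0::'g, letters w) (1::'k)"
  have "\<iota> (lin ?s a * lin ?s b) = lin (\<lambda>u. lin (\<lambda>v. \<iota> (?s u * ?s v)) b) a"
    by (simp only: lin_mult_left lin_mult_right \<iota>_lin) (rule lin_swap)
  also have "\<dots> = lin (\<lambda>u. lin (\<lambda>v. ?t u \<star> ?t v) b) a"
  proof (intro lin_cong)
    fix u v assume "u \<in> Poly_Mapping.keys a"
    then have "chi_word \<chi> (letters u) 0 = 1" using a by (intro chi_word_zero) (simp add: supp_in_def)
    then show "\<iota> (?s u * ?s v) = ?t u \<star> ?t v" by (simp add: mult_single \<iota>_single skew_mult_single)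
  qed
  also have "\<dots> = \<iota> a \<star> \<iota> b"
    unfolding \<iota>_def skew_mult_lin_left skew_mult_lin_right by (rule lin_swap)
  finally show ?thesis by (simp add: lin_single_id)
qed

lemma chi_word_g_word: "set u \<subseteq> {1..n} \<Longrightarrow> chi_word \<chi> u (g_word gs v) = (\<Prod>i\<leftarrow>u. \<Prod>j\<leftarrow>v. \<chi> i (gs j))"
proof -
  have *: "\<chi> i (g_word gs v) = (\<Prod>j\<leftarrow>v. \<chi> i (gs j))" if "i \<in> {1..n}" for i
    using that by (induction v) (simp_all add: g_word_def chi_add chi_zero del: atLeastAtMost_iff)
  show "set u \<subseteq> {1..n} \<Longrightarrow> ?thesis"
    by (induction u) (simp_all add: chi_word_Cons * del: atLeastAtMost_iff)
qed

end

locale quantum_plane = skew_group_algebra n \<chi> gs + B: braiding "\<lambda>i j. \<chi> i (gs j)" q n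
  for n and \<chi> :: "nat \<Rightarrow> 'g::ab_group_add \<Rightarrow> 'k::field" and gs and q :: 'k
begin

text \<open>The bracket chooses its scalar word by word; on homogeneous arguments all choices equal
  \<open>B.pp A B\<close>.\<close>

lemma bracket_\<iota>:
  assumes a: "homog A a" "finite A" "A \<subseteq> {1..n}" and b: "homog B b" "finite B" "B \<subseteq> {1..n}"
  shows "bracket \<chi> gs (\<iota> a) (\<iota> b) = \<iota> (B.br A B a b)"
proof -
  let ?t = "\<lambda>w. Poly_Mapping.single (0::'g, letters w) (1::'k)"
  have "bracket \<chi> gs (\<iota> a) (\<iota> b) = lin (\<lambda>u. lin (\<lambda>v. bracket \<chi> gs (?t u) (?t v)) b) a"
    unfolding bracket_single unfolding bracket_def \<iota>_def lin_lin by (simp add: lin_single)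
  also have "\<dots> = lin (\<lambda>u. lin (\<lambda>v. ?t u \<star> ?t v + pm_scale (- B.pp A B) (?t v \<star> ?t u)) b) a"
  proof (intro lin_cong)
    fix u v assume uv: "u \<in> Poly_Mapping.keys a" "v \<in> Poly_Mapping.keys b"
    have "set (letters u) \<subseteq> {1..n}" using set_letters_homog[OF a(1) uv(1) a(2)] a(3) by simp
    then have "chi_word \<chi> (letters u) (g_word gs (letters v)) = B.pp A B"
      by (simp add: chi_word_g_word prod_list_homog[OF a(1) uv(1)] prod_list_homog[OF b(1) uv(2)] B.pp_def)
    then show "bracket \<chi> gs (?t u) (?t v) = ?t u \<star> ?t v + pm_scale (- B.pp A B) (?t v \<star> ?t u)"
      by (simp add: bracket_single pm_scale_minus_left)
  qed
  also have "\<dots> = \<iota> a \<star> \<iota> b + pm_scale (- B.pp A B) (\<iota> b \<star> \<iota> a)"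
    unfolding lin_fun_add lin_fun_scale \<iota>_def skew_mult_lin_left skew_mult_lin_right
    by (simp only: lin_swap[of _ b])
  also have "\<dots> = \<iota> (B.br A B a b)"
    using homog_supp_in[OF a] homog_supp_in[OF b]
    by (simp add: B.br_def \<iota>_diff \<iota>_scale \<iota>_mult pm_scale_minus_left)
  finally show ?thesis .
qed

text \<open>For the empty set every letter is bracketed from the left, which is the recursion of
  u[k, m].\<close>

lemma \<iota>_P: "1 \<le> k \<Longrightarrow> k \<le> m \<Longrightarrow> m \<le> n \<Longrightarrow> \<iota> (B.P {} k m) = ubr \<chi> gs k m"
proof -
  assume m: "m \<le> n"
  show "1 \<le> k \<Longrightarrow> k \<le> m \<Longrightarrow> ?thesis"
  proof (induction "m - k" arbitrary: k)
    case 0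
    then have "k = m" by simp
    then show ?case by (simp add: ubr.simps[of _ _ m m] \<iota>_var)
  next
    case (Suc d)
    then have km: "k < m" "1 \<le> k" by auto
    have IH: "\<iota> (B.P {} (Suc k) m) = ubr \<chi> gs (Suc k) m" using Suc.hyps(2) km by (intro Suc.hyps(1)) auto
    have "bracket \<chi> gs (\<iota> (var k)) (\<iota> (B.P {} (Suc k) m)) = \<iota> (B.br {k} {Suc k..m} (var k) (B.P {} (Suc k) m))"
      using km m by (intro bracket_\<iota> homog_X B.homog_P) auto
    then show ?case
      using km by (simp add: ubr.simps[of _ _ k m] B.P.simps[of "{}" k m] \<iota>_var IH)
  qed
qed

lemma psi_list_\<iota>:
  "1 \<le> k \<Longrightarrow> k \<le> m \<Longrightarrow> m \<le> n \<Longrightarrow> sorted_wrt (<) ss \<Longrightarrow> set ss \<subseteq> {k..<m} \<Longrightarrow>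
    psi_list \<chi> gs k ss m = \<iota> (B.psi k ss m)"
proof (induction ss arbitrary: k)
  case Nil
  then show ?case by (simp add: \<iota>_P)
next
  case (Cons s ss)
  have s: "k \<le> s" "s < m" "1 \<le> s" and ss: "set ss \<subseteq> {Suc s..<m}" "sorted_wrt (<) ss"
    using Cons.prems by force+
  have IH: "psi_list \<chi> gs (Suc s) ss m = \<iota> (B.psi (Suc s) ss m)"
    using s ss Cons.prems by (intro Cons.IH) auto
  have u: "ubr \<chi> gs k s = \<iota> (B.P {} k s)" using s Cons.prems by (intro \<iota>_P[symmetric]) auto
  have "bracket \<chi> gs (\<iota> (B.psi (Suc s) ss m)) (\<iota> (B.P {} k s)) =
      \<iota> (B.br {Suc s..m} {k..s} (B.psi (Suc s) ss m) (B.P {} k s))"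
    using s ss Cons.prems by (intro bracket_\<iota> B.homog_psi B.homog_P) auto
  then show ?case by (simp add: IH u)
qed

end

section \<open>The contraction with a variable is the skew derivation\<close>

text \<open>A linear functional given on the basis, encoded as a linear extension into a
  one-dimensional space so that the rules for \<open>lin\<close> apply.\<close>

definition functional :: "('b \<Rightarrow> 'k::field) \<Rightarrow> ('b \<Rightarrow>\<^sub>0 'k) \<Rightarrow> 'k" where
  "functional \<phi> a = Poly_Mapping.lookup (lin (\<lambda>y. Poly_Mapping.single () (\<phi> y)) a) ()"

lemma functional_add: "functional \<phi> (a + b) = functional \<phi> a + functional \<phi> b"
  and functional_scale: "functional \<phi> (pm_scale c a) = c * functional \<phi> a"
  and functional_single: "functional \<phi> (Poly_Mapping.single y c) = c * \<phi> y"
  by (simp_all add: functional_def lin_add lin_scale lookup_add lin_single)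

lemma functional_zero: "(\<And>y. y \<in> Poly_Mapping.keys a \<Longrightarrow> \<phi> y = 0) \<Longrightarrow> functional \<phi> a = 0"
  unfolding functional_def by (subst lin_cong[of a _ "\<lambda>_. 0"]) auto

lemma functional_lin: "functional \<phi> (lin h b) = functional (\<lambda>y. functional \<phi> (h y)) b"
proof -
  have "lin (\<lambda>y. Poly_Mapping.single () (\<phi> y)) (h z) = Poly_Mapping.single () (functional \<phi> (h z))" for z
    by (rule poly_mapping_eqI) (simp add: functional_def)
  then show ?thesis by (simp add: functional_def lin_lin)
qed

locale quantum_coideal = coideal_subalgebra n \<chi> gs I U + quantum_plane n \<chi> gs q
  for n and \<chi> :: "nat \<Rightarrow> 'g::ab_group_add \<Rightarrow> 'k::field" and gs I U q +
  assumes comm_I: "i \<in> {1..n} \<Longrightarrow> j \<in> {1..n} \<Longrightarrow> i + 1 < j \<or> j + 1 < i \<Longrightarrow> comm i j \<in> I"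
begin

text \<open>
  The group factor stands on the left of a basis element; the inverse in \<open>\<phi>\<close> compensates for moving
  it past \<open>x\<^sub>i\<close>, so that the functional of \<open>x\<^sub>j b\<close> is \<open>\<delta>\<^sub>i\<^sub>j \<epsilon>(b)\<close> for all \<open>b\<close>.
\<close>

definition \<phi> :: "nat \<Rightarrow> 'g \<times> nat list \<Rightarrow> 'k" where
  "\<phi> i y = (if snd y = [i] then inverse (\<chi> i (fst y)) else 0)"

definition \<epsilon> :: "'g \<times> nat list \<Rightarrow> 'k" where
  "\<epsilon> y = (if snd y = [] then 1 else 0)"

lemma functional_x:
  assumes f: "\<And>h v. \<psi> (h, j # v) * \<chi> j h = \<psi>' (h, v)"
  shows "functional \<psi> (x j \<star> b) = functional \<psi>' b"
proof -
  have "functional \<psi> (x j \<star> lin (\<lambda>y. Poly_Mapping.single y 1) b) = functional \<psi>' b"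
    unfolding skew_mult_lin_right functional_lin
  proof -
    have "functional \<psi> (x j \<star> Poly_Mapping.single y 1) = \<psi>' y" for y
      using f[of "snd y" "fst y" for y] f
      by (cases y) (simp add: skew_var_def skew_mult_single functional_single chi_word_def mult.commute)
    then show "functional (\<lambda>y. functional \<psi> (x j \<star> Poly_Mapping.single y 1)) b = functional \<psi>' b" by simp
  qed
  then show ?thesis by (simp add: lin_single_id)
qed

text \<open>The two summands of the coproduct of x_j: the first leaves the right factor alone, the
  second puts x_j in front of it and is absorbed into the functional.\<close>

lemma contract_xx: "contract f (xx j \<star>\<star> t) = x j \<star> contract f t + grp (gs j) \<star> contract (\<lambda>b. f (x j \<star> b)) t"
proof -
  let ?s = "\<lambda>y. Poly_Mapping.single y (1::'k)"
  have "contract f (xx j \<star>\<star> lin ?s t) = lin (\<lambda>y. contract f (xx j \<star>\<star> ?s y)) t"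
    by (simp only: pair_mult_lin_right contract_lin)
  also have "\<dots> = lin (\<lambda>y. x j \<star> contract f (?s y) + grp (gs j) \<star> contract (\<lambda>b. f (x j \<star> b)) (?s y)) t"
  proof (rule lin_cong)
    fix y :: "('g, 'k) skew \<times> ('g, 'k) skew"
    show "contract f (xx j \<star>\<star> ?s y) = x j \<star> contract f (?s y) + grp (gs j) \<star> contract (\<lambda>b. f (x j \<star> b)) (?s y)"
      by (cases y) (simp add: pair_mult_linear pair_mult_single contract_add contract_single skew_mult_linear)
  qed
  also have "\<dots> = x j \<star> contract f (lin ?s t) + grp (gs j) \<star> contract (\<lambda>b. f (x j \<star> b)) (lin ?s t)"
    by (simp only: lin_fun_add contract_lin skew_mult_lin_right)
  finally show ?thesis by (simp add: lin_single_id)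
qed

lemma contract_zero: "contract (\<lambda>b. 0) t = 0"
  by (simp add: contract_def split_def)

text \<open>The counit axiom for words.\<close>

lemma contract_\<epsilon>: "set w \<subseteq> {1..n} \<Longrightarrow> contract (functional \<epsilon>) (cw w) = Poly_Mapping.single (0, w) 1"
proof (induction w)
  case Nil
  show ?case by (simp add: contract_single skew_grp_def functional_single \<epsilon>_def)
next
  case (Cons j w)
  have "functional \<epsilon> (x j \<star> b) = 0" for b
    by (subst functional_x[of _ _ "\<lambda>_. 0"]) (auto simp: \<epsilon>_def functional_zero)
  moreover have "x j \<star> Poly_Mapping.single (0, w) 1 = Poly_Mapping.single (0, j # w) 1"
    using Cons.prems by (simp add: skew_var_def skew_mult_single chi_word_def chi_zero)
  ultimately show ?case using Cons by (simp add: contract_xx contract_zero skew_mult_linear)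
qed

lemma supp_in_dw: "set w \<subseteq> T \<Longrightarrow> supp_in T (B.dw i w)"
  by (induction w) (auto intro!: supp_in_add supp_in_scale supp_in_mult supp_in_X supp_in_single supp_in_zero)

text \<open>Moving g_i to the front of x_j g_i produces exactly the twist in the recursion of
  \<open>B.dw\<close>; the summand for i = j comes from the counit.\<close>

lemma contract_\<phi>: "i \<in> {1..n} \<Longrightarrow> set w \<subseteq> {1..n} \<Longrightarrow> contract (functional (\<phi> i)) (cw w) = grp (gs i) \<star> \<iota> (B.dw i w)"
proof (induction w)
  case Nil
  show ?case by (simp add: contract_single skew_grp_def functional_single \<phi>_def skew_mult_linear)
next
  case (Cons j w)
  have j: "j \<in> {1..n}" and w: "set w \<subseteq> {1..n}" using Cons.prems by auto
  have f: "functional (\<phi> i) (x j \<star> b) = (if i = j then functional \<epsilon> b else 0)" for b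
  proof (cases "i = j")
    case True
    then show ?thesis
      using chi_nz[OF Cons.prems(1)] by (subst functional_x[of _ _ \<epsilon>]) (auto simp: \<phi>_def \<epsilon>_def)
  next
    case False
    then show ?thesis
      by (subst functional_x[of _ _ "\<lambda>_. 0"]) (auto simp: \<phi>_def functional_zero)
  qed
  have C: "x j \<in> C" "\<iota> (B.dw i w) \<in> C" "grp (gs i) \<in> C"
    using C_x[OF j] \<iota>_C[OF supp_in_dw[OF w]] C_grp by auto
  have "x j \<star> (grp (gs i) \<star> \<iota> (B.dw i w)) = pm_scale (\<chi> j (gs i)) (grp (gs i) \<star> (x j \<star> \<iota> (B.dw i w)))"
    using C by (simp add: mul_assoc[symmetric] x_mul_grp skew_mult_linear)
  moreover have "x j \<star> \<iota> (B.dw i w) = \<iota> (var j * B.dw i w)"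
    using j by (simp add: \<iota>_mult supp_in_X \<iota>_var del: atLeastAtMost_iff)
  ultimately have "x j \<star> (grp (gs i) \<star> \<iota> (B.dw i w)) = grp (gs i) \<star> \<iota> (pm_scale (\<chi> j (gs i)) (var j * B.dw i w))"
    by (simp add: \<iota>_scale skew_mult_linear)
  then show ?case
    using Cons.IH[OF Cons.prems(1) w] contract_\<epsilon>[OF w]
    by (auto simp: contract_xx f contract_zero \<iota>_add skew_mult_linear \<iota>_single)
qed

lemma supp_in_der: "supp_in {1..n} a \<Longrightarrow> supp_in {1..n} (B.der i a)"
proof -
  assume a: "supp_in {1..n} a"
  have "lin (\<lambda>w. B.dw i (letters w)) a \<in> Collect (supp_in {1..n})"
  proof (rule lin_mem)
    fix w assume "w \<in> Poly_Mapping.keys a"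
    then show "B.dw i (letters w) \<in> Collect (supp_in {1..n})"
      using a supp_in_dw unfolding supp_in_def[of _ a] by blast
  qed (auto intro: supp_in_zero supp_in_add supp_in_scale)
  then show ?thesis by (simp add: B.der_def)
qed

text \<open>The contraction of the coproduct of \<open>a\<close> is g_i times its derivative, and
  the factor g_i can be cancelled since \<open>U'\<close> contains all group elements.\<close>

lemma der_in_U':
  assumes i: "i \<in> {1..n}" and a: "supp_in {1..n} a" "\<iota> a \<in> U'"
  shows "\<iota> (B.der i a) \<in> U'"
proof -
  have "contract (functional (\<phi> i)) (\<Delta> (\<iota> a)) \<in> U'"
  proof (rule contraction_in_U'[OF functional_add functional_scale _ a(2)])
    show "functional (\<phi> i) b = 0" if "b \<in> I" for b
    proof (rule functional_zero)
      fix y assume "y \<in> Poly_Mapping.keys b"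
      \<comment> \<open>\<open>\<phi>\<close> is supported on words of length 1, whereas
        \<open>I\<close> has only longer words.\<close>
      then have "2 \<le> length (snd y)" using that I_K2 by (auto simp: K2_def)
      then show "\<phi> i y = 0" by (auto simp: \<phi>_def)
    qed
  qed
  also have "contract (functional (\<phi> i)) (\<Delta> (\<iota> a)) = lin (\<lambda>w. grp (gs i) \<star> \<iota> (B.dw i (letters w))) a"
    unfolding \<iota>_apply[of a] \<Delta>_lin contract_lin
  proof (rule lin_cong)
    fix w assume "w \<in> Poly_Mapping.keys a"
    then have w: "set (letters w) \<subseteq> {1..n}" using a(1) by (simp add: supp_in_def)
    show "contract (functional (\<phi> i)) (\<Delta> (Poly_Mapping.single (0, letters w) 1)) = grp (gs i) \<star> \<iota> (B.dw i (letters w))"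
      using contract_\<phi>[OF i w] by (simp add: \<Delta>_single)
  qed
  also have "\<dots> = grp (gs i) \<star> \<iota> (B.der i a)"
    unfolding B.der_def \<iota>_lin skew_mult_lin_right ..
  finally have "grp (- gs i) \<star> (grp (gs i) \<star> \<iota> (B.der i a)) \<in> U'"
    by (rule U'_mult[OF U'_grp])
  moreover note supp_in_der[OF a(1), of i]
  ultimately show ?thesis by (simp add: mul_assoc[symmetric] \<iota>_C C_grp grp_mul_grp)
qed

end

section \<open>Lifting an element with a leading term\<close>

section \<open>Leading terms\<close>

text \<open>Multisets replace sets here because powers inside a PBW monomial need not be multilinear
  a priori.\<close>

definition mdeg :: "nat multiset \<Rightarrow> 'k::field free \<Rightarrow> bool" where
  "mdeg M a \<longleftrightarrow> (\<forall>w\<in>Poly_Mapping.keys a. mset (letters w) = M)"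

lemma homog_mdeg: "homog A a \<longleftrightarrow> mdeg (mset_set A) a"
  by (simp add: homog_def mdeg_def)

lemma mdeg_one: "mdeg {#} 1"
  by (simp add: mdeg_def)

lemma mdeg_add: "mdeg M a \<Longrightarrow> mdeg M b \<Longrightarrow> mdeg M (a + b)"
  unfolding mdeg_def using keys_add[of a b] by blast

lemma mdeg_scale: "mdeg M a \<Longrightarrow> mdeg M (pm_scale c a)"
  unfolding mdeg_def using keys_pm_scale[of c a] by blast

lemma mdeg_zero: "mdeg M 0"
  by (simp add: mdeg_def)

lemma mdeg_sum: "(\<And>i. i \<in> J \<Longrightarrow> mdeg M (f i)) \<Longrightarrow> mdeg M (\<Sum>i\<in>J. f i)"
  by (induction J rule: infinite_finite_induct) (auto intro: mdeg_add mdeg_zero)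

lemma mdeg_mult: "mdeg M a \<Longrightarrow> mdeg N b \<Longrightarrow> mdeg (M + N) (a * b)"
  unfolding mdeg_def using keys_mult[of a b] by fastforce

lemma mdeg_power: "mdeg M a \<Longrightarrow> mdeg (repeat_mset e M) (a ^ e)"
  by (induction e) (auto simp: mdeg_one intro: mdeg_mult)

definition pbw :: "(nat \<Rightarrow> nat \<Rightarrow> 'k::field free) \<Rightarrow> pbw_exponents \<Rightarrow> 'k free" where
  "pbw u ws = foldr (\<lambda>((k, m), e) a. u k m ^ e * a) ws 1"

lemma pbw_Nil: "pbw u [] = 1"
  and pbw_Cons: "pbw u (((k, m), e) # ws) = u k m ^ e * pbw u ws"
  by (simp_all add: pbw_def)

lemma mdeg_pbw:
  assumes "\<And>k m. k \<le> m \<Longrightarrow> homog {k..m} (u k m)"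
  shows "(\<And>k m e. ((k, m), e) \<in> set ws \<Longrightarrow> k \<le> m) \<Longrightarrow> mdeg (pbw_degree ws) (pbw u ws)"
proof (induction ws)
  case Nil
  show ?case by (simp add: pbw_degree_def pbw_Nil mdeg_one)
next
  case (Cons y ws)
  obtain k m e where y: "y = ((k, m), e)" by (metis prod.collapse)
  have "k \<le> m" using Cons.prems y by auto
  then have "mdeg (repeat_mset e (mset_set {k..m})) (u k m ^ e)"
    using assms by (intro mdeg_power) (simp add: homog_mdeg)
  moreover have "mdeg (pbw_degree ws) (pbw u ws)" using Cons by auto
  ultimately show ?case
    unfolding y pbw_Cons by (simp add: pbw_degree_def mdeg_mult)
qed

lemma hd_mult_homog:
  assumes "homog A a" "finite A" "A \<noteq> {}" "w \<in> Poly_Mapping.keys (a * b)"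
  shows "letters w \<noteq> []" "hd (letters w) \<in> A"
proof -
  obtain u v where w: "w = u + v" "u \<in> Poly_Mapping.keys a" using assms(4) keys_mult[of a b] by blast
  have "set (letters u) = A" using set_letters_homog[OF assms(1) w(2) assms(2)] .
  then have "letters u \<noteq> []" "set (letters u) = A" using assms(3) by auto
  then show "letters w \<noteq> []" "hd (letters w) \<in> A" unfolding w(1) by auto
qed

lemma lookup_mult_homog_zero:
  assumes "homog A a" "finite A" "A \<noteq> {}" "k \<notin> A"
  shows "Poly_Mapping.lookup (a * b) (FW (k # w)) = 0"
  using hd_mult_homog(2)[OF assms(1-3), of "FW (k # w)" b] assms(4) by (auto simp: in_keys_iff)

lemma lookup_lin: "Poly_Mapping.lookup (lin f a) y = (\<Sum>b\<in>Poly_Mapping.keys a. Poly_Mapping.lookup a b * Poly_Mapping.lookup (f b) y)"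
  by (simp add: lin_def lookup_sum)

lemma lookup_var_mult: "Poly_Mapping.lookup (var k * a) (FW (k # w)) = Poly_Mapping.lookup a (FW w)"
proof -
  let ?s = "\<lambda>w. Poly_Mapping.single w (1::'a)"
  have "var k * lin ?s a = lin (\<lambda>w. Poly_Mapping.single (FW (k # letters w)) 1) a"
    unfolding lin_mult_right by (simp add: var_def mult_single plus_fword_def)
  moreover have e: "(FW (k # letters b) = FW (k # w)) = (b = FW w)" for b
    by (cases b) simp
  ultimately have "Poly_Mapping.lookup (var k * lin ?s a) (FW (k # w)) = Poly_Mapping.lookup (lin ?s a) (FW w)"
    by (simp only: lookup_lin lookup_single when_def e)
  then show ?thesis by (simp add: lin_single_id)
qed

context quantum_coideal
begin

text \<open>Of the two terms of the outer bracket only x_k u[k+1, m] has words beginning with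
  x_k.\<close>

lemma lookup_P: "k \<le> m \<Longrightarrow> Poly_Mapping.lookup (B.P {} k m) (FW [k..<Suc m]) = 1"
proof (induction "m - k" arbitrary: k)
  case 0
  then have "k = m" by simp
  then show ?case by (simp add: var_def)
next
  case (Suc d)
  then have km: "k < m" by auto
  have IH: "Poly_Mapping.lookup (B.P {} (Suc k) m) (FW [Suc k..<Suc m]) = 1"
    using Suc.hyps(2) km by (intro Suc.hyps(1)) auto
  have l: "[k..<Suc m] = k # [Suc k..<Suc m]" using km by (simp add: upt_conv_Cons del: upt_Suc)
  have "Poly_Mapping.lookup (B.P {} (Suc k) m * var k) (FW (k # [Suc k..<Suc m])) = 0"
    using km by (intro lookup_mult_homog_zero[OF B.homog_P]) auto
  then show ?case
    unfolding l using km by (simp add: B.P_notin lookup_minus lookup_var_mult IH del: upt_Suc)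
qed

lemma coset_power: "supp_in {1..n} a \<Longrightarrow> coset (\<iota> a) [^]\<^bsub>A\<^esub> (e::nat) = coset (\<iota> (a ^ e))"
proof (induction e)
  case 0
  show ?case by (simp only: nat_pow_def nat.rec A_simps(3) power_0 \<iota>_one)
next
  case (Suc e)
  have "coset (\<iota> a) [^]\<^bsub>A\<^esub> (Suc e) = (coset (\<iota> a) [^]\<^bsub>A\<^esub> e) \<otimes>\<^bsub>A\<^esub> coset (\<iota> a)" by (simp only: nat_pow_def nat.rec)
  also have "\<dots> = coset (\<iota> (a ^ e)) \<otimes>\<^bsub>A\<^esub> coset (\<iota> a)" by (simp only: Suc.IH[OF Suc.prems])
  also have "\<dots> = coset (\<iota> (a ^ e * a))"
    using Suc.prems by (simp add: coset_mult \<iota>_C \<iota>_mult supp_in_power)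
  finally show ?case by (simp only: power_Suc2)
qed

lemma proj_A: "proj n \<chi> gs A a = coset a"
  by (simp add: proj_def A_simps(4) coset_def)

lemma supp_in_P: "1 \<le> k \<Longrightarrow> k \<le> m \<Longrightarrow> m \<le> n \<Longrightarrow> supp_in {1..n} (B.P T k m)"
  by (rule homog_supp_in[OF B.homog_P]) auto

abbreviation pbw' where "pbw' \<equiv> pbw (B.P {})"

lemma pbw_monomial:
  assumes "\<And>k m e. ((k, m), e) \<in> set ws \<Longrightarrow> 1 \<le> k \<and> k \<le> m \<and> m \<le> n"
  shows "supp_in {1..n} (pbw' ws)" "pbw_monomial n \<chi> gs A ws = coset (\<iota> (pbw' ws))"
proof -
  have "supp_in {1..n} (pbw' ws) \<and> pbw_monomial n \<chi> gs A ws = coset (\<iota> (pbw' ws))"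
    using assms
  proof (induction ws)
    case Nil
    show ?case by (simp add: pbw_Nil supp_in_one pbw_monomial_def A_simps(3) \<iota>_one)
  next
    case (Cons y ws)
    obtain k m e where y: "y = ((k, m), e)" by (metis prod.collapse)
    have km: "1 \<le> k" "k \<le> m" "m \<le> n" using Cons.prems y by auto
    have IH: "supp_in {1..n} (pbw' ws)" "pbw_monomial n \<chi> gs A ws = coset (\<iota> (pbw' ws))"
      using Cons.IH Cons.prems by (metis list.set_intros(2))+
    have p: "supp_in {1..n} (B.P {} k m)" by (rule supp_in_P[OF km])
    have "pbw_monomial n \<chi> gs A (y # ws) = (coset (\<iota> (B.P {} k m)) [^]\<^bsub>A\<^esub> e) \<otimes>\<^bsub>A\<^esub> pbw_monomial n \<chi> gs A ws"
      unfolding \<iota>_P[OF km] by (simp add: y pbw_monomial_def proj_A)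
    also have "\<dots> = coset (\<iota> (B.P {} k m ^ e * pbw' ws))"
      using p IH by (simp add: coset_power coset_mult \<iota>_C supp_in_power \<iota>_mult)
    finally show ?case using p IH(1) by (simp add: y pbw_Cons supp_in_mult supp_in_power)
  qed
  then show "supp_in {1..n} (pbw' ws)" "pbw_monomial n \<chi> gs A ws = coset (\<iota> (pbw' ws))" by auto
qed

text \<open>All other PBW monomials begin with some u[k', m'] with k' > k, so none of their words
  starts with x_k and the coefficient of the ascending word comes from u[k, m] alone.\<close>

lemma leading_term_lift:
  assumes km: "1 \<le> k" "k \<le> m" "m \<le> n" and c: "has_leading_term n \<chi> gs A h c k m"
  obtains a where "homog {k..m} a" "Poly_Mapping.lookup a (FW [k..<Suc m]) = 1" "c = coset (\<iota> a)"
proof -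
  obtain J \<alpha> where J: "finite J"
    "J \<subseteq> {ws \<in> pbw_exponents n h. pbw_degree ws = mset_set {k..m} \<and> ws \<noteq> [] \<and> root_less (fst (hd ws)) (k, m)}"
    and c: "c = proj n \<chi> gs A (ubr \<chi> gs k m) \<oplus>\<^bsub>A\<^esub> (\<Oplus>\<^bsub>A\<^esub>ws\<in>J. \<alpha> ws \<odot>\<^bsub>A\<^esub> pbw_monomial n \<chi> gs A ws)"
    using c unfolding has_leading_term_def by blast
  interpret M: abelian_monoid A by (rule abelian_monoid_A)
  have rng: "1 \<le> k' \<and> k' \<le> m' \<and> m' \<le> n \<and> 1 \<le> e" if "ws \<in> J" "((k', m'), e) \<in> set ws" for ws k' m' e
    using that J(2) by (fastforce simp: pbw_exponents_def)
  have pm: "supp_in {1..n} (pbw' ws)" "pbw_monomial n \<chi> gs A ws = coset (\<iota> (pbw' ws))" if "ws \<in> J" for ws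
    using rng[OF that] by (intro pbw_monomial; blast)+
  have deg: "mdeg (mset_set {k..m}) (pbw' ws)" if "ws \<in> J" for ws
  proof -
    have "mdeg (pbw_degree ws) (pbw' ws)"
      using rng[OF that] by (intro mdeg_pbw B.homog_P) blast+
    then show ?thesis using that J(2) by auto
  qed
  have fs: "(\<Oplus>\<^bsub>A\<^esub>ws\<in>J'. \<alpha> ws \<odot>\<^bsub>A\<^esub> pbw_monomial n \<chi> gs A ws) = coset (\<iota> (\<Sum>ws\<in>J'. pm_scale (\<alpha> ws) (pbw' ws)))
      \<and> supp_in {1..n} (\<Sum>ws\<in>J'. pm_scale (\<alpha> ws) (pbw' ws))"
    if "finite J'" "J' \<subseteq> J" for J'
    using that
  proof (induction J' rule: finite_induct)
    case empty
    show ?case by (simp add: coset_zero A_simps(4) supp_in_zero)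
  next
    case (insert ws F)
    have e: "\<alpha> ws \<odot>\<^bsub>A\<^esub> pbw_monomial n \<chi> gs A ws = coset (\<iota> (pm_scale (\<alpha> ws) (pbw' ws)))" if "ws \<in> J" for ws
      using pm[OF that] by (simp add: coset_smult \<iota>_scale)
    have s: "supp_in {1..n} (pm_scale (\<alpha> ws) (pbw' ws))" if "ws \<in> J" for ws
      using pm[OF that] by (intro supp_in_scale)
    have cl: "\<alpha> ws \<odot>\<^bsub>A\<^esub> pbw_monomial n \<chi> gs A ws \<in> carrier A" if "ws \<in> J" for ws
      unfolding e[OF that] A_simps(1) using \<iota>_C[OF s[OF that]] by blast
    have wsJ: "ws \<in> J" "F \<subseteq> J" using insert.prems by auto
    have "(\<Oplus>\<^bsub>A\<^esub>ws\<in>insert ws F. \<alpha> ws \<odot>\<^bsub>A\<^esub> pbw_monomial n \<chi> gs A ws) =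
       \<alpha> ws \<odot>\<^bsub>A\<^esub> pbw_monomial n \<chi> gs A ws \<oplus>\<^bsub>A\<^esub> (\<Oplus>\<^bsub>A\<^esub>ws\<in>F. \<alpha> ws \<odot>\<^bsub>A\<^esub> pbw_monomial n \<chi> gs A ws)"
      using insert.hyps wsJ cl by (intro M.finsum_insert) auto
    then show ?case
      using insert.IH[OF wsJ(2)] insert.hyps s[OF wsJ(1)]
      by (simp add: e[OF wsJ(1)] coset_add \<iota>_C \<iota>_add supp_in_add)
  qed
  let ?r = "\<Sum>ws\<in>J. pm_scale (\<alpha> ws) (pbw' ws)"
  have r: "(\<Oplus>\<^bsub>A\<^esub>ws\<in>J. \<alpha> ws \<odot>\<^bsub>A\<^esub> pbw_monomial n \<chi> gs A ws) = coset (\<iota> ?r)" "supp_in {1..n} ?r"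
    using fs[OF J(1)] by auto
  have z: "Poly_Mapping.lookup (pbw' ws) (FW [k..<Suc m]) = 0" if ws: "ws \<in> J" for ws
  proof -
    obtain k' m' e ws' where w: "ws = ((k', m'), e) # ws'"
      using ws J(2) by (cases ws) auto
    have km': "1 \<le> k'" "k' \<le> m'" "m' \<le> n" "1 \<le> e" using rng[OF ws, of k' m' e] w by auto
    \<comment> \<open>The exponent is positive, so a factor u[k', m'] really stands in
      front.\<close>
    obtain e' where e': "e = Suc e'" using km'(4) by (cases e) auto
    have d: "pbw_degree ws = mset_set {k..m}" and less: "root_less (k', m') (k, m)"
      using ws J(2) w by auto
    \<comment> \<open>The order also admits k' = k with m' > m; this is excluded by the degree, in
      which m' occurs.\<close>
    have "m' \<in># pbw_degree ws"
      unfolding w using km' e' by (auto simp: pbw_degree_def)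
    then have "m' \<le> m" unfolding d by simp
    then have "k < k'" using less by (auto simp: root_less_def)
    moreover have "pbw' ws = B.P {} k' m' * (B.P {} k' m' ^ e' * pbw' ws')"
      by (simp add: w pbw_Cons e' mult.assoc)
    moreover have "[k..<Suc m] = k # [Suc k..<Suc m]" using km by (simp add: upt_conv_Cons del: upt_Suc)
    ultimately show ?thesis
      using km' by (simp only:) (rule lookup_mult_homog_zero[OF B.homog_P], auto)
  qed
  let ?a = "B.P {} k m + ?r"
  show thesis
  proof (rule that[of ?a])
    show "homog {k..m} ?a"
      using B.homog_P[OF km(2)] deg unfolding homog_mdeg by (intro mdeg_add mdeg_sum mdeg_scale) auto
    show "Poly_Mapping.lookup ?a (FW [k..<Suc m]) = 1"
      using z km by (simp add: lookup_add lookup_sum lookup_P del: upt_Suc)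
    show "c = coset (\<iota> ?a)"
      unfolding c r(1) proj_A \<iota>_P[OF km, symmetric]
      using supp_in_P[OF km] r(2) by (simp add: coset_add \<iota>_C \<iota>_add)
  qed
qed

text \<open>Stability under derivations is the contracted coideal property, and \<open>B.J\<close>
  is included because its generators are mapped to multiples of the far commutators in
  \<open>I\<close>.\<close>

sublocale free: coideal "\<lambda>i j. \<chi> i (gs j)" q n "{a. supp_in {1..n} a \<and> \<iota> a \<in> U'}"
proof
  fix a b :: "'k free" and c :: 'k and i :: nat
  show "a + b \<in> {a. supp_in {1..n} a \<and> \<iota> a \<in> U'}"
    if "a \<in> {a. supp_in {1..n} a \<and> \<iota> a \<in> U'}" "b \<in> {a. supp_in {1..n} a \<and> \<iota> a \<in> U'}"
    using that by (auto simp: \<iota>_add intro: supp_in_add U'_add)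
  show "a * b \<in> {a. supp_in {1..n} a \<and> \<iota> a \<in> U'}"
    if "a \<in> {a. supp_in {1..n} a \<and> \<iota> a \<in> U'}" "b \<in> {a. supp_in {1..n} a \<and> \<iota> a \<in> U'}"
    using that by (auto simp: \<iota>_mult intro: supp_in_mult U'_mult)
  show "pm_scale c a \<in> {a. supp_in {1..n} a \<and> \<iota> a \<in> U'}"
    if "a \<in> {a. supp_in {1..n} a \<and> \<iota> a \<in> U'}"
    using that by (auto simp: \<iota>_scale intro: supp_in_scale U'_scale)
  show "B.der i a \<in> {a. supp_in {1..n} a \<and> \<iota> a \<in> U'}"
    if "i \<in> {1..n}" "a \<in> {a. supp_in {1..n} a \<and> \<iota> a \<in> U'}"
    using that der_in_U' supp_in_der by blast
  show "a \<in> {a. supp_in {1..n} a \<and> \<iota> a \<in> U'}" if "a \<in> B.J"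
    using that
  proof (induction rule: B.J.induct)
    case J_zero
    show ?case by (simp add: supp_in_zero I_U' I_zero)
  next
    case (J_gen i j a b)
    let ?r = "var i * var j - pm_scale (\<chi> i (gs j)) (var j * var i) :: 'k free"
    have v: "supp_in {1..n} (var i :: 'k free)" "supp_in {1..n} (var j :: 'k free)" using J_gen by (auto intro: supp_in_X)
    have "supp_in {1..n} (var i * var j + pm_scale (- \<chi> i (gs j)) (var j * var i))"
      using v by (intro supp_in_add supp_in_scale supp_in_mult)
    then have s: "supp_in {1..n} ?r" by (simp add: pm_scale_minus_left)
    have "\<iota> ?r = comm i j"
      using J_gen v by (simp only: comm_eq \<iota>_diff \<iota>_scale \<iota>_mult \<iota>_var)
    then have "\<iota> ?r \<in> I" using comm_I J_gen by simp
    then have "\<iota> (a * ?r * b) \<in> I"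
      using J_gen s by (simp add: \<iota>_mult supp_in_mult I_mult \<iota>_C)
    then show ?case using J_gen s by (simp add: I_U' supp_in_mult)
  next
    case (J_add a b)
    then show ?case by (auto simp: \<iota>_add intro: supp_in_add U'_add)
  next
    case (J_scale a c)
    then show ?case by (auto simp: \<iota>_scale intro: supp_in_scale U'_scale)
  qed
qed

theorem Psi_in_U:
  assumes km: "1 \<le> k" "k \<le> m" "m \<le> n" and c: "c \<in> U" "has_leading_term n \<chi> gs A h c k m"
  shows "\<exists>S. S \<subseteq> {k..m - 1} \<and> proj n \<chi> gs A (Psi \<chi> gs S k m) \<in> U"
proof -
  obtain a where a: "homog {k..m} a" "Poly_Mapping.lookup a (FW [k..<Suc m]) = 1" "c = coset (\<iota> a)"
    using leading_term_lift[OF km c(2)] .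
  have s: "supp_in {1..n} a" using a(1) km by (intro homog_supp_in) auto
  have "a \<in> {a. supp_in {1..n} a \<and> \<iota> a \<in> U'}" using c(1) a(3) s \<iota>_C[OF s] by (simp add: U'_def)
  moreover have "Poly_Mapping.lookup a (FW [k..<Suc m]) \<noteq> 0" using a(2) by simp
  ultimately obtain T where T: "T \<subseteq> {k..<m}" "\<iota> (B.psi k (sorted_list_of_set T) m) \<in> U'"
    using free.psi_in_U[OF km a(1)] by blast
  have "Psi \<chi> gs T k m = psi_list \<chi> gs k (sorted_list_of_set T) m"
    using T(1) by (simp add: Psi_def Int_absorb2)
  also have "\<dots> = \<iota> (B.psi k (sorted_list_of_set T) m)"
    using km T(1) finite_subset[OF T(1)] by (intro psi_list_\<iota>) auto
  finally have "proj n \<chi> gs A (Psi \<chi> gs T k m) \<in> U" using T(2) by (simp add: proj_A U'_def)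
  moreover have "T \<subseteq> {k..m - 1}" using T(1) by force
  ultimately show ?thesis by blast
qed

end

theorem proposition4p2:
  fixes q :: "'k::field"
    and n :: nat
    and gs :: "nat \<Rightarrow> 'g::ab_group_add"
    and \<chi> :: "nat \<Rightarrow> 'g \<Rightarrow> 'k"
    and A :: "('k, ('g, 'k) skew set) hopf_algebra"
    and h :: enat
    and U :: "('g, 'k) skew set set"
    and c :: "('g, 'k) skew set"
    and k m :: nat
  assumes "n \<ge> 1"
    and "q \<noteq> 0" and "q \<noteq> 1" and "q \<noteq> -1"
    and "\<And>i g g'. i \<in> {1..n} \<Longrightarrow> \<chi> i (g + g') = \<chi> i g * \<chi> i g'"
    and "\<And>i g. i \<in> {1..n} \<Longrightarrow> \<chi> i g \<noteq> 0"
    and "\<And>i. i \<in> {1..n} \<Longrightarrow> \<chi> i (gs i) = q"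
    and "\<And>i. 1 \<le> i \<Longrightarrow> i < n \<Longrightarrow> \<chi> i (gs (i + 1)) * \<chi> (i + 1) (gs i) = inverse q"
    and "\<And>i j. i \<in> {1..n} \<Longrightarrow> j \<in> {1..n} \<Longrightarrow> i + 1 < j \<or> j + 1 < i \<Longrightarrow>
           \<chi> i (gs j) * \<chi> j (gs i) = 1"
    and "(A = Uq_plus n \<chi> gs \<and> h = \<infinity>) \<or>
         (\<exists>t::nat. t > 2 \<and> q ^ t = 1 \<and> (\<forall>s. 0 < s \<and> s < t \<longrightarrow> q ^ s \<noteq> 1) \<and>
            A = small_uq_plus n \<chi> gs \<and> h = enat t)"
    and "right_coideal_subalgebra U A"
    and "group_algebra n \<chi> gs A \<subseteq> U"
    and "1 \<le> k" and "k \<le> m" and "m \<le> n"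
    and "c \<in> U" and "homogeneous n \<chi> gs A c" and "has_leading_term n \<chi> gs A h c k m"
  shows "\<exists>S. S \<subseteq> {k..m - 1} \<and> proj n \<chi> gs A (Psi \<chi> gs S k m) \<in> U"
proof -
  interpret skew_group_algebra n \<chi> gs by unfold_locales (fact assms(5), fact assms(6))
  \<comment> \<open>Both cases reduce to an ideal inside \<open>K2\<close> that contains the far
    commutators; after this the two algebras are no longer distinguished.\<close>
  obtain I where quot: "A = quot_hopf (skew_hopf n \<chi> gs) I" "ideal I (skew_hopf n \<chi> gs)" "I \<subseteq> K2"
    "\<And>i j. i \<in> {1..n} \<Longrightarrow> j \<in> {1..n} \<Longrightarrow> i + 1 < j \<or> j + 1 < i \<Longrightarrow> comm i j \<in> I"
  proof (cases "A = Uq_plus n \<chi> gs")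
    case True
    show ?thesis
      by (rule that[of "serre_ideal n \<chi> gs"]) (use True in \<open>simp_all only: Uq_plus_def serre_ideal_props\<close>)
  next
    case False
    then have A: "A = small_uq_plus n \<chi> gs" using assms(10) by blast
    show ?thesis
    proof (rule that[of "Lambda_ideal n \<chi> gs"])
      show "ideal (Lambda_ideal n \<chi> gs) (skew_hopf n \<chi> gs)" using hopf_ideal_Lambda by (simp add: hopf_ideal_def)
      show "Lambda_ideal n \<chi> gs \<subseteq> K2" using Lambda_subset K_subset by blast
      show "comm i j \<in> Lambda_ideal n \<chi> gs"
        if "i \<in> {1..n}" "j \<in> {1..n}" "i + 1 < j \<or> j + 1 < i" for i j
        using assms(9) that by (rule comm_in_Lambda)
    qed (simp add: A small_uq_plus_def)
  qed
  interpret skew_quotient n \<chi> gs I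
    by (rule skew_quotient.intro[OF skew_group_algebra_axioms skew_quotient_axioms.intro[OF quot(2,3)]])
  have pr: "proj n \<chi> gs A a = coset a" for a
    unfolding quot(1) by (simp add: proj_def A_simps(4) coset_def)
  interpret coideal_subalgebra n \<chi> gs I U
  proof
    show "right_coideal_subalgebra U (quot_hopf (skew_hopf n \<chi> gs) I)" using assms(11) unfolding quot(1) .
    show "coset (grp g) \<in> U" for g
    proof -
      have "proj n \<chi> gs A (grp g) \<in> group_algebra n \<chi> gs A"
        unfolding group_algebra_def by (intro imageI) (simp add: skew_grp_def)
      then show ?thesis using assms(12) pr by auto
    qed
  qed
  interpret quantum_coideal n \<chi> gs I U q
  proof
    show "\<chi> i (gs j) * \<chi> j (gs i) = 1" if "1 \<le> i" "i + 1 < j" "j \<le> n" for i j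
      using that by (intro assms(9)) auto
  qed (use assms(2,3,6,8) quot(4) in auto)
  show ?thesis
    using Psi_in_U[OF assms(13-16)] assms(18) unfolding quot(1) by blast
qed

end
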